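(* Let $g(re^{i\theta})=e^{i\theta}r^3+\sum_{l=1}^{\infty}a_l\bar z^{\,l}$, where $z=re^{i\theta}\in\mathbb{D}$, $a_l\in\mathbb{C}$, $a_l\neq 0$ for at least one $l\geq 5$, and the series $\sum_{l\ge 1}a_l\bar z^{\,l}$ defines a bounded function on $\mathbb{D}$. Suppose there exists a nonzero function $f\in L^1(\mathbb{D},dA)$, with $T_f$ bounded, of the form $f(re^{i\theta})=\sum_{n=-\infty}^{N}e^{in\theta}f_n(r)$ with $N\geq 1$ and $f_N\neq 0$, such that $[T_f,T_g]=0$. Then $T_f$ is a polynomial of degree at most one in $T_g$; that is, there exist constants $C_1,C_0\in\mathbb{C}$ such that $T_f=C_1T_g+C_0I$, where $I$ denotes the identity operator.
   Context: $\mathbb{D}$ is the open unit disk in $\mathbb{C}$ and $dA=r\,dr\,\frac{d\theta}{\pi}$ is normalized Lebesgue measure on it. $L^2_a(\mathbb{D})$ is the Bergman space: the closed subspace of $L^2(\mathbb{D},dA)$ consisting of analytic functions, with orthogonal basis $\{z^k: k\ge 0\}$. $P$ is the orthogonal projection of $L^2(\mathbb{D},dA)$ onto $L^2_a(\mathbb{D})$. For a symbol $f\in L^1(\mathbb{D},dA)$, the Toeplitz operator $T_f$ on $L^2_a(\mathbb{D})$ is densely defined by $T_f(h)=P(fh)$ (in particular for $h$ a polynomial); it is called bounded if it extends to a bounded operator on $L^2_a(\mathbb{D})$. Only symbols in $L^1(\mathbb{D},dA)$ are admissible. The notation $f(re^{i\theta})=\sum_{n=-\infty}^{N}e^{in\theta}f_n(r)$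 (truncated polar decomposition) means that the angular Fourier coefficients $f_n(r)=\frac1{2\pi}\int_0^{2\pi}f(re^{i\theta})e^{-in\theta}\,d\theta$ vanish for all $n>N$; the $f_n$ are radial functions in $L^1([0,1),r\,dr)$. The commutator is $[T_f,T_g]=T_fT_g-T_gT_f$; $[T_f,T_g]=0$ means $T_fT_g(z^k)=T_gT_f(z^k)$ for all integers $k\ge 0$. *)

theory Defs
  imports "HOL-Complex_Analysis.Complex_Analysis" "HOL-Computational_Algebra.Polynomial"
begin

definition disk_dA :: "complex measure" where
  "disk_dA = density (lebesgue_on (ball 0 1)) (\<lambda>_. ennreal (1 / pi))"

definition disk_L2 :: "(complex \<Rightarrow> complex) set" where
  "disk_L2 = {u \<in> borel_measurable disk_dA. integrable disk_dA (\<lambda>z. (cmod (u z))\<^sup>2)}"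

definition disk_inner :: "(complex \<Rightarrow> complex) \<Rightarrow> (complex \<Rightarrow> complex) \<Rightarrow> complex" where
  "disk_inner u v = (\<integral>z. u z * cnj (v z) \<partial>disk_dA)"

definition disk_norm :: "(complex \<Rightarrow> complex) \<Rightarrow> real" where
  "disk_norm u = sqrt (\<integral>z. (cmod (u z))\<^sup>2 \<partial>disk_dA)"

(* Functions on the disk are represented by functions on the whole plane. Requiring the
   value 0 outside the disk makes equality of elements of the Bergman space plain equality. *)
definition disk_restrict :: "(complex \<Rightarrow> complex) \<Rightarrow> complex \<Rightarrow> complex" where
  "disk_restrict h = (\<lambda>z. if z \<in> ball 0 1 then h z else 0)"

definition bergman_space :: "(complex \<Rightarrow> complex) set" where
  "bergman_space = {h \<in> disk_L2. h holomorphic_on ball 0 1 \<and> (\<forall>z. z \<notin> ball 0 1 \<longrightarrow> h z = 0)}"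

(* The Bergman projection, written with the Bergman kernel so that it also applies to
   arguments that are merely in L^1, as the products f h with f in L^1 are. On L^2 it is the
   orthogonal projection onto the Bergman space: bergman_proj_orthogonal_projection below. *)
definition bergman_proj :: "(complex \<Rightarrow> complex) \<Rightarrow> complex \<Rightarrow> complex" where
  "bergman_proj u = disk_restrict (\<lambda>z. \<integral>w. u w / (1 - z * cnj w)\<^sup>2 \<partial>disk_dA)"

definition bergman_bounded_operator ::
    "((complex \<Rightarrow> complex) \<Rightarrow> (complex \<Rightarrow> complex)) \<Rightarrow> bool" where
  "bergman_bounded_operator T \<longleftrightarrow>
     T \<in> bergman_space \<rightarrow> bergman_space \<and>
     (\<forall>h\<in>bergman_space. \<forall>k\<in>bergman_space. \<forall>c d.
        T (\<lambda>z. c * h z + d * k z) = (\<lambda>z. c * T h z + d * T k z)) \<and>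
     (\<exists>C. \<forall>h\<in>bergman_space. disk_norm (T h) \<le> C * disk_norm h)"

definition toeplitz_extension ::
    "(complex \<Rightarrow> complex) \<Rightarrow> ((complex \<Rightarrow> complex) \<Rightarrow> (complex \<Rightarrow> complex)) \<Rightarrow> bool" where
  "toeplitz_extension f T \<longleftrightarrow>
     bergman_bounded_operator T \<and>
     (\<forall>p. T (disk_restrict (poly p)) = bergman_proj (\<lambda>z. f z * poly p z))"

definition toeplitz_bounded :: "(complex \<Rightarrow> complex) \<Rightarrow> bool" where
  "toeplitz_bounded f \<longleftrightarrow> (\<exists>T. toeplitz_extension f T)"

(* Meaningful if toeplitz_bounded f; the values on the Bergman space do not depend on the
   choice, by toeplitz_extension_unique below. *)
definition toeplitz :: "(complex \<Rightarrow> complex) \<Rightarrow> (complex \<Rightarrow> complex) \<Rightarrow> (complex \<Rightarrow> complex)" where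
  "toeplitz f = (SOME T. toeplitz_extension f T)"

definition angular_coeff :: "(complex \<Rightarrow> complex) \<Rightarrow> int \<Rightarrow> real \<Rightarrow> complex" where
  "angular_coeff f n r =
     1 / (2 * pi) * (LINT \<theta>:{0..2*pi}|lebesgue. f (of_real r * cis \<theta>) * cis (- of_int n * \<theta>))"

lemma space_disk_dA [simp]: "space disk_dA = ball 0 1"
  by (simp add: disk_dA_def)

lemma borel_measurable_disk_dA: "u \<in> borel_measurable borel \<Longrightarrow> u \<in> borel_measurable disk_dA"
  unfolding disk_dA_def by (simp add: measurable_completion measurable_restrict_space1)

lemma nn_integral_disk_dA:
  assumes [measurable]: "F \<in> borel_measurable borel"
  shows "(\<integral>\<^sup>+z. F z \<partial>disk_dA) = ennreal (1 / pi) * (\<integral>\<^sup>+z. F z * indicator (ball 0 1) z \<partial>lborel)"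
proof -
  have "F \<in> borel_measurable (lebesgue_on (ball 0 1))"
    using assms by (simp add: measurable_completion measurable_restrict_space1)
  then have "(\<integral>\<^sup>+z. F z \<partial>disk_dA) = ennreal (1 / pi) * (\<integral>\<^sup>+z. F z \<partial>lebesgue_on (ball 0 1))"
    unfolding disk_dA_def by (simp add: nn_integral_density nn_integral_cmult)
  also have "(\<integral>\<^sup>+z. F z \<partial>lebesgue_on (ball 0 1)) = (\<integral>\<^sup>+z. F z * indicator (ball 0 1) z \<partial>lebesgue)"
    by (simp add: nn_integral_restrict_space)
  also have "\<dots> = (\<integral>\<^sup>+z. F z * indicator (ball 0 1) z \<partial>lborel)"
    by (simp add: nn_integral_completion)
  finally show ?thesis .
qed

lemma lborel_complex_eq_distr:
  "(lborel :: complex measure) = distr (lborel \<Otimes>\<^sub>M lborel) borel (\<lambda>(x, y). Complex x y)"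
proof (rule lborel_eqI)
  fix l u :: complex
  assume le: "\<And>b. b \<in> Basis \<Longrightarrow> l \<bullet> b \<le> u \<bullet> b"
  have le': "Re l \<le> Re u" "Im l \<le> Im u"
    using le[of 1] le[of \<i>] by (auto simp: Basis_complex_def)
  have meas: "(\<lambda>(x, y). Complex x y) \<in> borel_measurable (lborel \<Otimes>\<^sub>M lborel)"
    unfolding case_prod_beta' Complex_eq by measurable
  have "(\<lambda>(x, y). Complex x y) -` box l u = {Re l <..< Re u} \<times> {Im l <..< Im u}"
    by (auto simp: in_box_complex_iff)
  then have "emeasure (distr (lborel \<Otimes>\<^sub>M lborel) borel (\<lambda>(x, y). Complex x y)) (box l u) =
      emeasure (lborel \<Otimes>\<^sub>M lborel) ({Re l <..< Re u} \<times> {Im l <..< Im u})"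
    using meas by (subst emeasure_distr) (auto simp: space_pair_measure)
  also have "\<dots> = ennreal ((Re u - Re l) * (Im u - Im l))"
    using le' by (subst lborel.emeasure_pair_measure_Times) (auto simp: ennreal_mult)
  also have "(Re u - Re l) * (Im u - Im l) = (\<Prod>b\<in>Basis. (u - l) \<bullet> b)"
    by (simp add: Basis_complex_def)
  finally show "emeasure (distr (lborel \<Otimes>\<^sub>M lborel) borel (\<lambda>(x, y). Complex x y)) (box l u) =
      (\<Prod>b\<in>Basis. (u - l) \<bullet> b)" .
qed simp

lemma nn_integral_lborel_complex:
  fixes F :: "complex \<Rightarrow> ennreal"
  assumes [measurable]: "F \<in> borel_measurable borel"
  shows "(\<integral>\<^sup>+z. F z \<partial>lborel) = (\<integral>\<^sup>+x. \<integral>\<^sup>+y. F (Complex x y) \<partial>lborel \<partial>lborel)"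
    and "(\<integral>\<^sup>+z. F z \<partial>lborel) = (\<integral>\<^sup>+y. \<integral>\<^sup>+x. F (Complex x y) \<partial>lborel \<partial>lborel)"
proof -
  have [measurable]: "(\<lambda>(x, y). Complex x y) \<in> borel_measurable (lborel \<Otimes>\<^sub>M lborel)"
    unfolding case_prod_beta' Complex_eq by measurable
  have eq: "(\<integral>\<^sup>+z. F z \<partial>lborel) = (\<integral>\<^sup>+(x, y). F (Complex x y) \<partial>(lborel \<Otimes>\<^sub>M lborel))"
    by (subst lborel_complex_eq_distr, subst nn_integral_distr) (auto simp: case_prod_beta')
  have m: "(\<lambda>(x, y). F (Complex x y)) \<in> borel_measurable (lborel \<Otimes>\<^sub>M lborel)"
    using measurable_compose[OF \<open>(\<lambda>(x, y). Complex x y) \<in> _\<close> assms] by (simp add: case_prod_beta)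
  show "(\<integral>\<^sup>+z. F z \<partial>lborel) = (\<integral>\<^sup>+x. \<integral>\<^sup>+y. F (Complex x y) \<partial>lborel \<partial>lborel)"
    using lborel.nn_integral_fst[OF m] eq by simp
  show "(\<integral>\<^sup>+z. F z \<partial>lborel) = (\<integral>\<^sup>+y. \<integral>\<^sup>+x. F (Complex x y) \<partial>lborel \<partial>lborel)"
    using lborel_pair.nn_integral_snd[OF m] eq by simp
qed

lemma nn_integral_lborel_shift:
  fixes F :: "real \<Rightarrow> ennreal"
  assumes "F \<in> borel_measurable borel"
  shows "(\<integral>\<^sup>+x. F (x + t) \<partial>lborel) = (\<integral>\<^sup>+x. F x \<partial>lborel)"
  using nn_integral_real_affine[of F 1 t] assms by (simp add: add.commute)

lemma nn_integral_lborel_shear: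
  fixes F :: "complex \<Rightarrow> ennreal"
  assumes [measurable]: "F \<in> borel_measurable borel"
  shows "(\<integral>\<^sup>+z. F (Complex (Re z + a * Im z) (Im z)) \<partial>lborel) = (\<integral>\<^sup>+z. F z \<partial>lborel)"
    and "(\<integral>\<^sup>+z. F (Complex (Re z) (Im z + a * Re z)) \<partial>lborel) = (\<integral>\<^sup>+z. F z \<partial>lborel)"
proof -
  have [measurable]: "(\<lambda>x. Complex x y) \<in> borel_measurable borel" "Complex x \<in> borel_measurable borel" for x y
    by (simp_all add: Complex_eq[abs_def])
  have 1: "(\<lambda>z. Complex (Re z + a * Im z) (Im z)) \<in> borel_measurable borel"
       "(\<lambda>z. Complex (Re z) (Im z + a * Re z)) \<in> borel_measurable borel"
    by (simp_all add: Complex_eq)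
  have 2: "(\<lambda>z. F (Complex (Re z + a * Im z) (Im z))) \<in> borel_measurable borel"
      "(\<lambda>z. F (Complex (Re z) (Im z + a * Re z))) \<in> borel_measurable borel"
    using measurable_compose[OF 1(1) assms] measurable_compose[OF 1(2) assms] by simp_all
  show "(\<integral>\<^sup>+z. F (Complex (Re z + a * Im z) (Im z)) \<partial>lborel) = (\<integral>\<^sup>+z. F z \<partial>lborel)"
    by (subst (1 2) nn_integral_lborel_complex(2))
      (use 2 in \<open>auto intro!: nn_integral_cong nn_integral_lborel_shift\<close>)
  show "(\<integral>\<^sup>+z. F (Complex (Re z) (Im z + a * Re z)) \<partial>lborel) = (\<integral>\<^sup>+z. F z \<partial>lborel)"
    by (subst (1 2) nn_integral_lborel_complex(1))
      (use 2 in \<open>auto intro!: nn_integral_cong nn_integral_lborel_shift\<close>)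
qed

lemma nn_integral_lborel_rotate:
  fixes F :: "complex \<Rightarrow> ennreal"
  assumes F: "F \<in> borel_measurable borel" and c: "cmod c = 1" "c \<noteq> - 1"
  shows "(\<integral>\<^sup>+z. F (c * z) \<partial>lborel) = (\<integral>\<^sup>+z. F z \<partial>lborel)"
proof -
  define p q where "p = Re c" and "q = Im c"
  have pq: "p\<^sup>2 + q\<^sup>2 = 1"
    using c(1) by (simp add: p_def q_def cmod_def)
  have "p \<noteq> - 1"
    using pq c(2) by (auto simp: p_def q_def complex_eq_iff)
  define s where "s = - q / (1 + p)"
  have s1: "1 + s * q = p"
    using pq \<open>p \<noteq> - 1\<close> by (simp add: s_def field_simps power2_eq_square)
  have s2: "s * (1 + p) = - q"
    using \<open>p \<noteq> - 1\<close> by (simp add: s_def)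
  define S1 S2 where "S1 = (\<lambda>z. Complex (Re z + s * Im z) (Im z))"
    and "S2 = (\<lambda>z. Complex (Re z) (Im z + q * Re z))"
  have [measurable]: "S1 \<in> borel_measurable borel" "S2 \<in> borel_measurable borel"
    by (simp_all add: S1_def S2_def Complex_eq)
  have "S1 (S2 (S1 z)) = c * z" for z
  proof (rule complex_eqI)
    have "Re (S1 (S2 (S1 z))) = (1 + s * q) * Re z + (s * (1 + (1 + s * q))) * Im z"
      by (simp add: S1_def S2_def algebra_simps)
    then show "Re (S1 (S2 (S1 z))) = Re (c * z)"
      unfolding s1 s2 by (simp add: p_def q_def)
    have "Im (S1 (S2 (S1 z))) = q * Re z + (1 + s * q) * Im z"
      by (simp add: S1_def S2_def algebra_simps)
    then show "Im (S1 (S2 (S1 z))) = Im (c * z)"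
      unfolding s1 by (simp add: p_def q_def)
  qed
  moreover have S1: "(\<integral>\<^sup>+z. G (S1 z) \<partial>lborel) = (\<integral>\<^sup>+z. G z \<partial>lborel)"
    and S2: "(\<integral>\<^sup>+z. G (S2 z) \<partial>lborel) = (\<integral>\<^sup>+z. G z \<partial>lborel)"
    if "G \<in> borel_measurable borel" for G :: "complex \<Rightarrow> ennreal"
    using nn_integral_lborel_shear[OF that] by (simp_all add: S1_def S2_def)
  have "(\<integral>\<^sup>+z. F (S1 (S2 (S1 z))) \<partial>lborel) = (\<integral>\<^sup>+z. F z \<partial>lborel)"
    using F by (simp add: S1[of "\<lambda>z. F (S1 (S2 z))"] S2[of "\<lambda>z. F (S1 z)"] S1[of F])
  ultimately show ?thesis by simp
qed

lemma nn_integral_disk_dA_rotate: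
  fixes F :: "complex \<Rightarrow> ennreal"
  assumes F: "F \<in> borel_measurable borel" and c: "cmod c = 1" "c \<noteq> - 1"
  shows "(\<integral>\<^sup>+z. F (c * z) \<partial>disk_dA) = (\<integral>\<^sup>+z. F z \<partial>disk_dA)"
proof -
  have "(\<integral>\<^sup>+z. F (c * z) * indicator (ball 0 1) z \<partial>lborel) =
        (\<integral>\<^sup>+z. F (c * z) * indicator (ball 0 1) (c * z) \<partial>lborel)"
    using c(1) by (intro nn_integral_cong) (simp add: indicator_def norm_mult)
  also have "\<dots> = (\<integral>\<^sup>+z. F z * indicator (ball 0 1) z \<partial>lborel)"
    by (rule nn_integral_lborel_rotate[of "\<lambda>z. F z * indicator (ball 0 1) z"])
      (use F c in \<open>auto intro!: borel_measurable_times_ennreal borel_measurable_indicator\<close>)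
  finally show ?thesis
    using F by (simp add: nn_integral_disk_dA)
qed

lemma id_measurable_disk_dA [measurable]: "(\<lambda>z. z) \<in> borel_measurable disk_dA"
  by (rule borel_measurable_disk_dA) simp

lemma integral_disk_dA_rotate:
  fixes h :: "complex \<Rightarrow> complex"
  assumes h: "h \<in> borel_measurable borel" and c: "cmod c = 1" "c \<noteq> - 1"
  shows "(\<integral>z. h (c * z) \<partial>disk_dA) = (\<integral>z. h z \<partial>disk_dA)"
proof -
  have m: "(*) c \<in> borel_measurable disk_dA"
    by measurable
  have "distr disk_dA borel ((*) c) = distr disk_dA borel (\<lambda>z. z)"
  proof (rule measure_eqI)
    fix A assume "A \<in> sets (distr disk_dA borel ((*) c))"
    then have A: "A \<in> sets borel" by simp
    have "emeasure (distr disk_dA borel g) A = (\<integral>\<^sup>+z. indicator A (g z) \<partial>disk_dA)"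
      if "g \<in> borel_measurable disk_dA" for g
      using A that by (simp flip: nn_integral_indicator add: nn_integral_distr)
    then show "emeasure (distr disk_dA borel ((*) c)) A = emeasure (distr disk_dA borel (\<lambda>z. z)) A"
      using nn_integral_disk_dA_rotate[of "indicator A" c] A c m by simp
  qed simp
  then have "integral\<^sup>L (distr disk_dA borel ((*) c)) h = integral\<^sup>L (distr disk_dA borel (\<lambda>z. z)) h"
    by simp
  then show ?thesis
    using h m by (simp add: integral_distr)
qed

lemma distr_disk_dA_norm:
  "distr disk_dA borel cmod = density lborel (\<lambda>t. ennreal (2 * t) * indicator {0..1} t)"
proof (rule measure_eqI_lessThan)
  fix x :: real
  have e: "emeasure (distr disk_dA borel cmod) {x<..} =
          ennreal (1 / pi) * emeasure lborel (ball 0 1 - cball 0 x :: complex set)"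
  proof -
    have "emeasure (distr disk_dA borel cmod) {x<..} = (\<integral>\<^sup>+z. indicator {x<..} (cmod z) \<partial>disk_dA)"
      by (simp flip: nn_integral_indicator add: nn_integral_distr)
    also have "\<dots> = ennreal (1 / pi) * (\<integral>\<^sup>+z. indicator {x<..} (cmod z) * indicator (ball 0 1) z \<partial>lborel)"
      by (rule nn_integral_disk_dA) simp
    also have "(\<lambda>z. indicator {x<..} (cmod z) * indicator (ball 0 1) z :: ennreal) =
               indicator (ball 0 1 - cball 0 x)"
      by (auto simp: fun_eq_iff indicator_def)
    finally show ?thesis by simp
  qed
  define y where "y = max 0 (min x 1)"
  have y: "0 \<le> y" "y \<le> 1" by (auto simp: y_def)
  have sph: "emeasure lborel (ball 0 1 - cball 0 x :: complex set) = ennreal (pi * (1 - y\<^sup>2))"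
  proof (cases "x < 1")
    case False
    then have eq: "ball 0 1 - cball 0 x = ({} :: complex set)" and "y = 1"
      by (auto simp: y_def)
    then show ?thesis unfolding eq by simp
  next
    case True
    show ?thesis
    proof (cases "x < 0")
      case True
      then have eq: "ball 0 1 - cball 0 x = (ball 0 1 :: complex set)" and "y = 0"
        by (auto simp: y_def)
      then show ?thesis unfolding eq by (simp add: emeasure_ball unit_ball_vol_2)
    next
      case False
      then have "y = x" using True by (simp add: y_def)
      have "emeasure lborel (ball 0 1 - cball 0 x :: complex set) =
            emeasure lborel (ball 0 1 :: complex set) - emeasure lborel (cball 0 x :: complex set)"
        using False True by (intro emeasure_Diff) (auto simp: emeasure_cball)
      also have "\<dots> = ennreal pi - ennreal (pi * x\<^sup>2)"
        using False by (simp add: emeasure_ball emeasure_cball unit_ball_vol_2)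
      also have "\<dots> = ennreal (pi - pi * x\<^sup>2)"
        by (rule ennreal_minus) simp
      finally show ?thesis
        by (simp add: \<open>y = x\<close> algebra_simps)
    qed
  qed
  have "emeasure (density lborel (\<lambda>t. ennreal (2 * t) * indicator {0..1} t)) {x<..} =
        (\<integral>\<^sup>+t. ennreal (2 * t) * indicator {0..1} t * indicator {x<..} t \<partial>lborel)"
    by (simp add: emeasure_density)
  also have "\<dots> = (\<integral>\<^sup>+t. ennreal (2 * t) * indicator {y..1} t \<partial>lborel)"
  proof (rule nn_integral_cong_AE)
    have "AE t in lborel. t \<noteq> x \<and> t \<noteq> 1"
      by (intro AE_conjI AE_lborel_singleton)
    then show "AE t in lborel. ennreal (2 * t) * indicator {0..1} t * indicator {x<..} t =
                 ennreal (2 * t) * indicator {y..1} t"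
      by eventually_elim (auto simp: y_def indicator_def split: if_splits)
  qed
  also have "\<dots> = ennreal (1\<^sup>2 - y\<^sup>2)"
    by (rule nn_integral_FTC_Icc) (use y in \<open>auto intro!: derivative_eq_intros\<close>)
  finally have d: "emeasure (density lborel (\<lambda>t. ennreal (2 * t) * indicator {0..1} t)) {x<..} =
        ennreal (1 - y\<^sup>2)" by simp
  show "emeasure (distr disk_dA borel cmod) {x<..} =
        emeasure (density lborel (\<lambda>t. ennreal (2 * t) * indicator {0..1} t)) {x<..}"
    unfolding e sph d using y by (simp flip: ennreal_mult' )
  show "emeasure (distr disk_dA borel cmod) {x<..} < \<infinity>"
    unfolding e sph by (simp add: ennreal_mult_less_top)
qed simp_all

lemma finite_measure_disk_dA: "finite_measure disk_dA"
proof
  have "emeasure disk_dA (space disk_dA) = (\<integral>\<^sup>+z. 1 \<partial>disk_dA)"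
    by simp
  also have "\<dots> = ennreal (1 / pi) * emeasure lborel (ball 0 1 :: complex set)"
    by (subst nn_integral_disk_dA) simp_all
  finally show "emeasure disk_dA (space disk_dA) \<noteq> \<infinity>"
    by (simp add: emeasure_ball ennreal_mult_eq_top_iff)
qed

lemma disk_dA_moment:
  assumes r: "0 \<le> r" "r \<le> 1"
  shows "(\<integral>z. indicator (ball 0 r) z *\<^sub>R (z ^ m * cnj z ^ n) \<partial>disk_dA) =
         (if m = n then of_real (r ^ (2 * n + 2)) / of_nat (Suc n) else 0)"
proof (cases "m = n")
  case False
  define k where "k = \<bar>real m - real n\<bar>"
  have k: "k \<ge> 1" using False by (auto simp: k_def)
  define t where "t = pi / (2 * k)"
  define c where "c = cis t"
  have t: "0 < t" "t \<le> pi / 2"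
    using k by (auto simp: t_def field_simps)
  have "Re c \<ge> 0" using t by (auto simp: c_def intro: cos_ge_zero)
  then have c: "cmod c = 1" "c \<noteq> - 1" by (auto simp: c_def complex_eq_iff)
  let ?h = "\<lambda>z::complex. indicator (ball 0 r) z *\<^sub>R (z ^ m * cnj z ^ n)"
  have eq: "c ^ m * cnj c ^ n = cis (real m * t - real n * t)"
    by (simp add: c_def Complex.DeMoivre cis_cnj cis_mult)
  have "real m * t - real n * t = pi / 2 \<or> real m * t - real n * t = - (pi / 2)"
    using k by (auto simp: t_def k_def abs_if field_simps split: if_splits)
  then have "cos (real m * t - real n * t) = 0"
    by (elim disjE) (simp_all only: cos_minus cos_pi_half)
  then have ne: "c ^ m * cnj c ^ n \<noteq> 1"
    unfolding eq by (auto simp: complex_eq_iff)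
  have hm: "?h \<in> borel_measurable borel"
  proof (rule borel_measurable_scaleR)
    show "indicat_real (ball (0::complex) r) \<in> borel_measurable borel"
      by (intro borel_measurable_indicator) simp
    show "(\<lambda>z::complex. z ^ m * cnj z ^ n) \<in> borel_measurable borel"
      by (intro borel_measurable_continuous_onI continuous_intros)
  qed
  have "(\<integral>z. ?h z \<partial>disk_dA) = (\<integral>z. ?h (c * z) \<partial>disk_dA)"
    by (rule integral_disk_dA_rotate[symmetric]) (use c hm in auto)
  also have "\<dots> = (\<integral>z. (c ^ m * cnj c ^ n) * ?h z \<partial>disk_dA)"
    using c(1) by (intro Bochner_Integration.integral_cong)
      (auto simp: indicator_def norm_mult power_mult_distrib)
  also have "\<dots> = (c ^ m * cnj c ^ n) * (\<integral>z. ?h z \<partial>disk_dA)"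
    by (rule integral_mult_right_zero)
  finally have "(\<integral>z. ?h z \<partial>disk_dA) * (1 - c ^ m * cnj c ^ n) = 0"
    by (simp add: algebra_simps)
  then show ?thesis using ne False by simp
next
  case True
  let ?g = "\<lambda>t::real. indicator {..<r} t * t ^ (2 * n)"
  have "(\<integral>z. indicator (ball 0 r) z *\<^sub>R (z ^ m * cnj z ^ n) \<partial>disk_dA) =
        (\<integral>z. of_real (?g (cmod z)) \<partial>disk_dA)"
    unfolding True
  proof (intro Bochner_Integration.integral_cong refl)
    fix z
    have "z ^ n * cnj z ^ n = of_real (cmod z ^ (2 * n))"
      by (simp add: power_mult complex_norm_square[symmetric] flip: power_mult_distrib)
    then show "indicator (ball 0 r) z *\<^sub>R (z ^ n * cnj z ^ n) = of_real (?g (cmod z))"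
      by (auto simp: indicator_def)
  qed
  also have "\<dots> = of_real (\<integral>z. ?g (cmod z) \<partial>disk_dA)"
    by (rule integral_complex_of_real)
  also have "(\<integral>z. ?g (cmod z) \<partial>disk_dA) = (\<integral>t. ?g t \<partial>distr disk_dA borel cmod)"
    by (rule integral_distr[symmetric]) auto
  also have "\<dots> = (\<integral>t. ?g t \<partial>density lborel (\<lambda>t. ennreal (2 * t * indicator {0..1} t)))"
    unfolding distr_disk_dA_norm
    by (intro arg_cong2[where f="integral\<^sup>L"] arg_cong2[where f=density] refl ext) (auto simp: indicator_def)
  also have "\<dots> = (\<integral>t. (2 * t * indicator {0..1} t) *\<^sub>R ?g t \<partial>lborel)"
    by (rule integral_density) (auto simp: indicator_def)
  also have "\<dots> = (\<integral>t. (2 * t ^ (2 * n + 1)) * indicator {0..r} t \<partial>lborel)"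
  proof (rule integral_cong_AE)
    have "AE t in lborel. t \<noteq> r"
      by (rule AE_lborel_singleton)
    then show "AE t in lborel. (2 * t * indicator {0..1} t) *\<^sub>R ?g t = (2 * t ^ (2 * n + 1)) * indicator {0..r} t"
      by eventually_elim (use r in \<open>auto simp: indicator_def\<close>)
  qed auto
  also have "\<dots> = r ^ (2 * n + 2) / real (Suc n) - 0 ^ (2 * n + 2) / real (Suc n)"
  proof (rule integral_FTC_Icc_nonneg)
    fix t :: real
    have "((\<lambda>t. t ^ (2 * n + 2) / real (Suc n)) has_real_derivative
            real (2 * n + 2) * t ^ (2 * n + 1) / real (Suc n)) (at t)"
      using DERIV_cdivide[OF DERIV_pow[of "2 * n + 2" t UNIV], of "real (Suc n)"] by simp
    moreover have "real (2 * n + 2) * t ^ (2 * n + 1) / real (Suc n) = 2 * t ^ (2 * n + 1)"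
      by (simp add: field_simps)
    ultimately show "((\<lambda>t. t ^ (2 * n + 2) / real (Suc n)) has_real_derivative 2 * t ^ (2 * n + 1)) (at t)"
      by simp
  qed (use r in auto)
  finally show ?thesis using True by simp
qed

interpretation disk_dA: finite_measure disk_dA
  by (rule finite_measure_disk_dA)

lemma borel_measurable_cnj [measurable (raw)]:
  "f \<in> borel_measurable M \<Longrightarrow> (\<lambda>x. cnj (f x)) \<in> borel_measurable M"
  by (rule measurable_compose[OF _ borel_measurable_continuous_onI]) (auto intro!: continuous_intros)

lemma disk_L2_measurable: "u \<in> disk_L2 \<Longrightarrow> u \<in> borel_measurable disk_dA"
  by (simp add: disk_L2_def)

lemma disk_L2_integrable: "u \<in> disk_L2 \<Longrightarrow> integrable disk_dA (\<lambda>z. (cmod (u z))\<^sup>2)"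
  by (simp add: disk_L2_def)

lemma disk_L2_integrable_inner:
  assumes u: "u \<in> disk_L2" and v: "v \<in> disk_L2"
  shows "integrable disk_dA (\<lambda>z. u z * cnj (v z))"
proof (rule Bochner_Integration.integrable_bound)
  show "integrable disk_dA (\<lambda>z. (cmod (u z))\<^sup>2 + (cmod (v z))\<^sup>2)"
    using u v by (simp add: disk_L2_def)
  have [measurable]: "u \<in> borel_measurable disk_dA" "v \<in> borel_measurable disk_dA"
    using u v by (auto simp: disk_L2_def)
  show "(\<lambda>z. u z * cnj (v z)) \<in> borel_measurable disk_dA"
    using u v by (intro borel_measurable_times borel_measurable_cnj) (auto simp: disk_L2_def)
  have "a * b \<le> a\<^sup>2 + b\<^sup>2" for a b :: real
    using sum_squares_bound[of a b] zero_le_power2[of a] zero_le_power2[of b] by linarith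
  then show "AE z in disk_dA. norm (u z * cnj (v z)) \<le> norm ((cmod (u z))\<^sup>2 + (cmod (v z))\<^sup>2)"
    by (auto simp: norm_mult)
qed

lemma disk_L2_bounded:
  assumes "u \<in> borel_measurable disk_dA" "\<And>z. z \<in> ball 0 1 \<Longrightarrow> cmod (u z) \<le> B"
  shows "u \<in> disk_L2"
proof -
  have "integrable disk_dA (\<lambda>z. (cmod (u z))\<^sup>2)"
  proof (rule disk_dA.integrable_const_bound[where B = "B\<^sup>2"])
    have "(cmod (u z))\<^sup>2 \<le> B\<^sup>2" if "z \<in> ball 0 1" for z
      using assms(2)[OF that] by (intro power_mono) auto
    then show "AE z in disk_dA. norm ((cmod (u z))\<^sup>2) \<le> B\<^sup>2"
      by (intro AE_I2) (simp del: mem_ball)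
  qed (use assms(1) in measurable)
  then show ?thesis using assms(1) by (simp add: disk_L2_def)
qed

lemma disk_L2_continuous:
  assumes "continuous_on UNIV u"
  shows "u \<in> disk_L2"
proof -
  have "compact (u ` cball 0 1)"
    using assms by (intro compact_continuous_image) (auto intro: continuous_on_subset)
  then obtain B where B: "\<And>z. z \<in> cball 0 1 \<Longrightarrow> cmod (u z) \<le> B"
    by (force dest!: compact_imp_bounded simp: bounded_iff)
  have "u \<in> borel_measurable disk_dA"
    using assms by (intro borel_measurable_disk_dA borel_measurable_continuous_onI)
  then show ?thesis
    by (rule disk_L2_bounded[where B = B]) (use B in auto)
qed

lemma disk_L2_integrable_self: "u \<in> disk_L2 \<Longrightarrow> integrable disk_dA u"
  using disk_L2_integrable_inner[of u "\<lambda>_. 1"] disk_L2_continuous[of "\<lambda>_. 1"] by simp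

lemma disk_L2_combination:
  assumes u: "u \<in> disk_L2" and v: "v \<in> disk_L2"
  shows "(\<lambda>z. c * u z + d * v z) \<in> disk_L2"
proof -
  have [measurable]: "u \<in> borel_measurable disk_dA" "v \<in> borel_measurable disk_dA"
    using u v by (auto simp: disk_L2_def)
  have "integrable disk_dA (\<lambda>z. (cmod (c * u z + d * v z))\<^sup>2)"
  proof (rule Bochner_Integration.integrable_bound)
    show "integrable disk_dA (\<lambda>z. 2 * (cmod c)\<^sup>2 * (cmod (u z))\<^sup>2 + 2 * (cmod d)\<^sup>2 * (cmod (v z))\<^sup>2)"
      using u v by (simp add: disk_L2_def)
    have "(cmod (a + b))\<^sup>2 \<le> 2 * (cmod a)\<^sup>2 + 2 * (cmod b)\<^sup>2" for a b
    proof -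
      have "(cmod (a + b))\<^sup>2 \<le> (cmod a + cmod b)\<^sup>2"
        by (intro power_mono norm_triangle_ineq) auto
      also have "\<dots> \<le> 2 * (cmod a)\<^sup>2 + 2 * (cmod b)\<^sup>2"
        using sum_squares_bound[of "cmod a" "cmod b"] by (simp add: power2_sum)
      finally show ?thesis .
    qed
    from this[of "c * u z" "d * v z" for z]
    show "AE z in disk_dA. norm ((cmod (c * u z + d * v z))\<^sup>2)
            \<le> norm (2 * (cmod c)\<^sup>2 * (cmod (u z))\<^sup>2 + 2 * (cmod d)\<^sup>2 * (cmod (v z))\<^sup>2)"
      by (auto simp: norm_mult power_mult_distrib mult.assoc)
  qed measurable
  then show ?thesis by (simp add: disk_L2_def)
qed

lemma disk_L2_diff: "u \<in> disk_L2 \<Longrightarrow> v \<in> disk_L2 \<Longrightarrow> (\<lambda>z. u z - v z) \<in> disk_L2"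
  using disk_L2_combination[of u v 1 "-1"] by simp

lemma disk_inner_diff_left:
  assumes "u \<in> disk_L2" "v \<in> disk_L2" "w \<in> disk_L2"
  shows "disk_inner (\<lambda>z. u z - v z) w = disk_inner u w - disk_inner v w"
  using assms unfolding disk_inner_def left_diff_distrib
  by (intro Bochner_Integration.integral_diff disk_L2_integrable_inner)

lemma disk_inner_diff_right:
  assumes "u \<in> disk_L2" "v \<in> disk_L2" "w \<in> disk_L2"
  shows "disk_inner w (\<lambda>z. u z - v z) = disk_inner w u - disk_inner w v"
  using assms unfolding disk_inner_def complex_cnj_diff right_diff_distrib
  by (intro Bochner_Integration.integral_diff disk_L2_integrable_inner)

lemma disk_norm_nonneg: "disk_norm u \<ge> 0"
  by (simp add: disk_norm_def)

lemma disk_norm_power2: "(disk_norm u)\<^sup>2 = (\<integral>z. (cmod (u z))\<^sup>2 \<partial>disk_dA)"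
  by (simp add: disk_norm_def)

lemma disk_inner_self: "disk_inner u u = of_real ((disk_norm u)\<^sup>2)"
proof -
  have "disk_inner u u = (\<integral>z. of_real ((cmod (u z))\<^sup>2) \<partial>disk_dA)"
    unfolding disk_inner_def complex_norm_square ..
  also have "\<dots> = of_real (\<integral>z. (cmod (u z))\<^sup>2 \<partial>disk_dA)"
    by (rule integral_complex_of_real)
  finally show ?thesis
    by (simp only: disk_norm_power2)
qed

lemma disk_Cauchy_Schwarz:
  assumes u: "u \<in> disk_L2" and v: "v \<in> disk_L2"
  shows "cmod (disk_inner u v) \<le> disk_norm u * disk_norm v"
proof -
  define A B where "A = disk_norm u" and "B = disk_norm v"
  have nn: "A \<ge> 0" "B \<ge> 0" by (simp_all add: A_def B_def disk_norm_nonneg)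
  have *: "2 * cmod (disk_inner u v) \<le> t * A\<^sup>2 + B\<^sup>2 / t" if t: "t > 0" for t
  proof -
    have "2 * cmod (disk_inner u v) \<le> 2 * (\<integral>z. cmod (u z * cnj (v z)) \<partial>disk_dA)"
      unfolding disk_inner_def by (simp add: integral_norm_bound)
    also have "\<dots> = (\<integral>z. 2 * cmod (u z * cnj (v z)) \<partial>disk_dA)"
      by simp
    also have "\<dots> \<le> (\<integral>z. t * (cmod (u z))\<^sup>2 + (cmod (v z))\<^sup>2 / t \<partial>disk_dA)"
    proof (rule integral_mono)
      show "integrable disk_dA (\<lambda>z. 2 * cmod (u z * cnj (v z)))"
        using disk_L2_integrable_inner[OF u v] by (intro integrable_mult_right integrable_norm)
      show "integrable disk_dA (\<lambda>z. t * (cmod (u z))\<^sup>2 + (cmod (v z))\<^sup>2 / t)"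
        using u v by (simp add: disk_L2_def)
      show "2 * cmod (u z * cnj (v z)) \<le> t * (cmod (u z))\<^sup>2 + (cmod (v z))\<^sup>2 / t" for z
      proof -
        have "0 \<le> (t * cmod (u z) - cmod (v z))\<^sup>2 / t"
          using t by simp
        also have "\<dots> = t * (cmod (u z))\<^sup>2 + (cmod (v z))\<^sup>2 / t - 2 * cmod (u z * cnj (v z))"
          using t by (simp add: norm_mult power2_eq_square field_simps)
        finally show ?thesis by simp
      qed
    qed
    also have "\<dots> = t * A\<^sup>2 + B\<^sup>2 / t"
      using u v by (simp add: A_def B_def disk_norm_power2 disk_L2_def)
    finally show ?thesis .
  qed
  have eps: "cmod (disk_inner u v) \<le> (A + e) * (B + e)" if e: "e > 0" for e
  proof -
    define t where "t = (B + e) / (A + e)"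
    have pos: "A + e > 0" "B + e > 0" using nn e by auto
    then have t: "t > 0" by (simp add: t_def)
    have "2 * cmod (disk_inner u v) \<le> t * A\<^sup>2 + B\<^sup>2 / t"
      by (rule *[OF t])
    also have "\<dots> \<le> t * (A + e)\<^sup>2 + (B + e)\<^sup>2 / t"
      using nn e t by (intro add_mono mult_left_mono divide_right_mono power_mono) auto
    also have "\<dots> = 2 * ((A + e) * (B + e))"
    proof -
      have "t * (A + e)\<^sup>2 = (A + e) * (B + e)" "(B + e)\<^sup>2 / t = (A + e) * (B + e)"
        using pos by (simp_all add: t_def power2_eq_square)
      then show ?thesis by simp
    qed
    finally show ?thesis by simp
  qed
  have "((\<lambda>e. (A + e) * (B + e)) \<longlongrightarrow> (A + 0) * (B + 0)) (at_right 0)"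
    by (intro tendsto_intros)
  moreover have "eventually (\<lambda>e. cmod (disk_inner u v) \<le> (A + e) * (B + e)) (at_right 0)"
    using eps by (auto simp: eventually_at_right_field intro!: exI[of _ 1])
  ultimately have "cmod (disk_inner u v) \<le> (A + 0) * (B + 0)"
    by (intro tendsto_lowerbound[of _ _ "at_right 0"]) auto
  then show ?thesis by (simp add: A_def B_def)
qed

lemma disk_inner_tendsto:
  assumes u: "\<And>N. u N \<in> disk_L2" and l: "l \<in> disk_L2" and v: "v \<in> disk_L2"
    and lim: "(\<lambda>N. disk_norm (\<lambda>z. l z - u N z)) \<longlonglongrightarrow> 0"
  shows "(\<lambda>N. disk_inner (u N) v) \<longlonglongrightarrow> disk_inner l v"
proof -
  have "(\<lambda>N. disk_norm (\<lambda>z. l z - u N z) * disk_norm v) \<longlonglongrightarrow> 0 * disk_norm v"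
    by (intro tendsto_intros lim)
  then have "(\<lambda>N. disk_norm (\<lambda>z. l z - u N z) * disk_norm v) \<longlonglongrightarrow> 0" by simp
  then have "(\<lambda>N. disk_inner l v - disk_inner (u N) v) \<longlonglongrightarrow> 0"
    by (rule Lim_null_comparison[rotated])
      (use disk_Cauchy_Schwarz[OF disk_L2_diff[OF l u] v] disk_inner_diff_left[OF l u v] in simp)
  then have "(\<lambda>N. disk_inner l v - (disk_inner l v - disk_inner (u N) v)) \<longlonglongrightarrow> disk_inner l v - 0"
    by (intro tendsto_intros)
  then show ?thesis by simp
qed

lemma disk_inner_cnj: "disk_inner v u = cnj (disk_inner u v)"
proof -
  have "cnj (disk_inner u v) = (\<integral>z. cnj (u z * cnj (v z)) \<partial>disk_dA)"
    unfolding disk_inner_def by (rule Bochner_Integration.integral_cnj[symmetric])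
  then show ?thesis by (simp add: disk_inner_def mult.commute)
qed

lemma disk_L2_power: "(\<lambda>z. z ^ n) \<in> disk_L2"
  by (intro disk_L2_continuous continuous_intros)

lemma disk_inner_powers:
  "disk_inner (\<lambda>z. z ^ m) (\<lambda>z. z ^ n) = (if m = n then 1 / of_nat (Suc n) else 0)"
proof -
  have "disk_inner (\<lambda>z. z ^ m) (\<lambda>z. z ^ n) =
        (\<integral>z. indicator (ball 0 1) z *\<^sub>R (z ^ m * cnj z ^ n) \<partial>disk_dA)"
    unfolding disk_inner_def by (intro Bochner_Integration.integral_cong) auto
  then show ?thesis
    using disk_dA_moment[of 1 m n] by simp
qed

definition bergman_partial_sum :: "(nat \<Rightarrow> complex) \<Rightarrow> nat \<Rightarrow> complex \<Rightarrow> complex" where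
  "bergman_partial_sum c N z = (\<Sum>n<N. of_nat (Suc n) * c n * z ^ n)"

lemma bergman_partial_sum_L2: "bergman_partial_sum c N \<in> disk_L2"
  unfolding bergman_partial_sum_def[abs_def]
  by (intro disk_L2_continuous continuous_intros)

lemma disk_inner_bergman_partial_sum:
  assumes "v \<in> disk_L2"
  shows "disk_inner (bergman_partial_sum c N) v =
         (\<Sum>n<N. of_nat (Suc n) * c n * disk_inner (\<lambda>z. z ^ n) v)"
proof -
  have "disk_inner (bergman_partial_sum c N) v =
        (\<integral>z. (\<Sum>n<N. (of_nat (Suc n) * c n) * (z ^ n * cnj (v z))) \<partial>disk_dA)"
    unfolding disk_inner_def bergman_partial_sum_def sum_distrib_right by (simp add: mult.assoc)
  also have "\<dots> = (\<Sum>n<N. (\<integral>z. (of_nat (Suc n) * c n) * (z ^ n * cnj (v z)) \<partial>disk_dA))"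
    using disk_L2_integrable_inner[OF disk_L2_power assms]
    by (intro Bochner_Integration.integral_sum integrable_mult_right)
  also have "\<dots> = (\<Sum>n<N. of_nat (Suc n) * c n * disk_inner (\<lambda>z. z ^ n) v)"
    by (simp add: disk_inner_def)
  finally show ?thesis .
qed

lemma disk_inner_bergman_partial_sum_power:
  "disk_inner (bergman_partial_sum c N) (\<lambda>z. z ^ k) = (if k < N then c k else 0)"
proof -
  have "disk_inner (bergman_partial_sum c N) (\<lambda>z. z ^ k) =
        (\<Sum>n<N. of_nat (Suc n) * c n * (if n = k then 1 / of_nat (Suc k) else 0))"
    by (simp add: disk_inner_bergman_partial_sum disk_L2_power disk_inner_powers)
  also have "\<dots> = (\<Sum>n<N. if n = k then c k else 0)"
    by (intro sum.cong) (auto simp del: of_nat_Suc)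
  finally show ?thesis by simp
qed

lemma disk_norm_bergman_partial_sum_diff:
  assumes "M \<le> N"
  shows "(disk_norm (\<lambda>z. bergman_partial_sum c N z - bergman_partial_sum c M z))\<^sup>2 =
         (\<Sum>n\<in>{M..<N}. real (Suc n) * (cmod (c n))\<^sup>2)"
proof -
  define d where "d n = (if n < M then 0 else c n)" for n
  have "bergman_partial_sum c N z - bergman_partial_sum c M z = bergman_partial_sum d N z" for z
  proof -
    have "bergman_partial_sum c N z - bergman_partial_sum c M z =
          (\<Sum>n\<in>{..<N} - {..<M}. of_nat (Suc n) * c n * z ^ n)"
      unfolding bergman_partial_sum_def using assms by (subst sum_diff) auto
    also have "\<dots> = bergman_partial_sum d N z"
      unfolding bergman_partial_sum_def
      by (rule sum.mono_neutral_cong_left) (auto simp: d_def)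
    finally show ?thesis .
  qed
  then have eq: "(\<lambda>z. bergman_partial_sum c N z - bergman_partial_sum c M z) = bergman_partial_sum d N"
    by auto
  have "complex_of_real ((disk_norm (bergman_partial_sum d N))\<^sup>2) =
        (\<Sum>n<N. of_nat (Suc n) * d n * disk_inner (\<lambda>z. z ^ n) (bergman_partial_sum d N))"
    by (simp only: disk_inner_self[symmetric] disk_inner_bergman_partial_sum bergman_partial_sum_L2)
  also have "\<dots> = (\<Sum>n<N. of_real (real (Suc n) * (cmod (d n))\<^sup>2))"
  proof (rule sum.cong)
    fix n assume "n \<in> {..<N}"
    then have "disk_inner (\<lambda>z. z ^ n) (bergman_partial_sum d N) = cnj (d n)"
      by (subst disk_inner_cnj) (simp add: disk_inner_bergman_partial_sum_power)
    then show "of_nat (Suc n) * d n * disk_inner (\<lambda>z. z ^ n) (bergman_partial_sum d N) =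
               of_real (real (Suc n) * (cmod (d n))\<^sup>2)"
      by (simp only: of_real_mult complex_norm_square of_real_of_nat_eq mult.assoc)
  qed simp
  also have "\<dots> = of_real (\<Sum>n<N. real (Suc n) * (cmod (d n))\<^sup>2)"
    by simp
  finally have "(disk_norm (bergman_partial_sum d N))\<^sup>2 = (\<Sum>n<N. real (Suc n) * (cmod (d n))\<^sup>2)"
    by (simp only: of_real_eq_iff)
  also have "\<dots> = (\<Sum>n\<in>{M..<N}. real (Suc n) * (cmod (c n))\<^sup>2)"
    by (rule sum.mono_neutral_cong_right) (auto simp: d_def)
  finally show ?thesis by (simp only: eq)
qed

lemma disk_L2_iff_nn_integral:
  assumes "u \<in> borel_measurable disk_dA"
  shows "u \<in> disk_L2 \<longleftrightarrow> (\<integral>\<^sup>+z. ennreal ((cmod (u z))\<^sup>2) \<partial>disk_dA) < \<infinity>"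
  using assms by (auto simp: disk_L2_def integrable_iff_bounded)

lemma disk_norm_power2_nn_integral:
  assumes "u \<in> disk_L2"
  shows "ennreal ((disk_norm u)\<^sup>2) = (\<integral>\<^sup>+z. ennreal ((cmod (u z))\<^sup>2) \<partial>disk_dA)"
  unfolding disk_norm_power2 using assms
  by (intro nn_integral_eq_integral[symmetric]) (auto simp: disk_L2_def)

lemma holomorphic_measurable_disk_dA:
  assumes "h holomorphic_on ball 0 1"
  shows "h \<in> borel_measurable disk_dA"
proof -
  have "h \<in> borel_measurable (lebesgue_on (ball 0 1))"
    using assms by (intro continuous_imp_measurable_on_sets_lebesgue holomorphic_on_imp_continuous_on) auto
  then show ?thesis by (simp add: disk_dA_def)
qed

lemma bergman_series:
  assumes F: "\<And>z. z \<in> ball 0 1 \<Longrightarrow> (\<lambda>n. of_nat (Suc n) * c n * z ^ n) sums F z"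
    and c: "summable (\<lambda>n. real (Suc n) * (cmod (c n))\<^sup>2)"
    and F0: "\<And>z. z \<notin> ball 0 1 \<Longrightarrow> F z = 0"
  shows "F \<in> bergman_space"
    and "(\<lambda>N. disk_norm (\<lambda>z. F z - bergman_partial_sum c N z)) \<longlonglongrightarrow> 0"
proof -
  have hol: "F holomorphic_on ball 0 1"
    by (rule power_series_holomorphic[where a = "\<lambda>n. of_nat (Suc n) * c n"]) (use F in simp)
  note meas = holomorphic_measurable_disk_dA[OF hol]
  have Smeas: "bergman_partial_sum c N \<in> borel_measurable disk_dA" for N
    by (rule disk_L2_measurable[OF bergman_partial_sum_L2])
  define \<tau> where "\<tau> M = (\<Sum>n. real (Suc n) * (cmod (c n))\<^sup>2) - (\<Sum>n<M. real (Suc n) * (cmod (c n))\<^sup>2)" for M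
  have nonneg: "0 \<le> real (Suc n) * (cmod (c n))\<^sup>2" for n by simp
  have \<tau>: "(\<Sum>n\<in>{M..<N}. real (Suc n) * (cmod (c n))\<^sup>2) \<le> \<tau> M" if "M \<le> N" for M N
  proof -
    have "(\<Sum>n\<in>{M..<N}. real (Suc n) * (cmod (c n))\<^sup>2) =
          (\<Sum>n<N. real (Suc n) * (cmod (c n))\<^sup>2) - (\<Sum>n<M. real (Suc n) * (cmod (c n))\<^sup>2)"
      using that by (subst sum_diff[symmetric]) (auto intro!: sum.cong simp del: of_nat_Suc)
    moreover have "(\<Sum>n<N. real (Suc n) * (cmod (c n))\<^sup>2) \<le> (\<Sum>n. real (Suc n) * (cmod (c n))\<^sup>2)"
      by (rule sum_le_suminf[OF c]) (auto simp del: of_nat_Suc)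
    ultimately show ?thesis by (simp add: \<tau>_def)
  qed
  have \<tau>lim: "\<tau> \<longlonglongrightarrow> 0"
  proof -
    have "(\<lambda>M. (\<Sum>n. real (Suc n) * (cmod (c n))\<^sup>2) - (\<Sum>n<M. real (Suc n) * (cmod (c n))\<^sup>2)) \<longlonglongrightarrow>
          (\<Sum>n. real (Suc n) * (cmod (c n))\<^sup>2) - (\<Sum>n. real (Suc n) * (cmod (c n))\<^sup>2)"
      by (intro tendsto_intros summable_LIMSEQ c)
    then show ?thesis by (simp add: \<tau>_def[abs_def])
  qed
  have bound: "(\<integral>\<^sup>+z. ennreal ((cmod (F z - bergman_partial_sum c M z))\<^sup>2) \<partial>disk_dA) \<le> ennreal (\<tau> M)" for M
  proof -
    let ?u = "\<lambda>N z. ennreal ((cmod (bergman_partial_sum c N z - bergman_partial_sum c M z))\<^sup>2)"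
    have um: "?u N \<in> borel_measurable disk_dA" for N
    proof -
      have "(\<lambda>x. ennreal ((cmod x)\<^sup>2)) \<in> borel_measurable borel"
        by (intro measurable_compose[OF _ measurable_ennreal] borel_measurable_continuous_onI continuous_intros)
      from measurable_compose[OF borel_measurable_diff[OF Smeas Smeas] this] show ?thesis .
    qed
    have "(\<integral>\<^sup>+z. ennreal ((cmod (F z - bergman_partial_sum c M z))\<^sup>2) \<partial>disk_dA) =
          (\<integral>\<^sup>+z. liminf (\<lambda>N. ?u N z) \<partial>disk_dA)"
    proof (rule nn_integral_cong)
      fix z assume "z \<in> space disk_dA"
      then have "(\<lambda>N. bergman_partial_sum c N z) \<longlonglongrightarrow> F z"
        using F[of z] by (simp add: sums_def bergman_partial_sum_def)
      then have "(\<lambda>N. ?u N z) \<longlonglongrightarrow> ennreal ((cmod (F z - bergman_partial_sum c M z))\<^sup>2)"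
        by (intro tendsto_ennrealI tendsto_intros)
      then show "ennreal ((cmod (F z - bergman_partial_sum c M z))\<^sup>2) = liminf (\<lambda>N. ?u N z)"
        by (intro lim_imp_Liminf[symmetric]) auto
    qed
    also have "\<dots> \<le> liminf (\<lambda>N. \<integral>\<^sup>+z. ?u N z \<partial>disk_dA)"
      by (rule nn_integral_liminf[OF um])
    also have "\<dots> \<le> limsup (\<lambda>N. \<integral>\<^sup>+z. ?u N z \<partial>disk_dA)"
      by (rule Liminf_le_Limsup) simp
    also have "\<dots> \<le> ennreal (\<tau> M)"
    proof (rule Limsup_bounded)
      show "\<forall>\<^sub>F N in sequentially. (\<integral>\<^sup>+z. ?u N z \<partial>disk_dA) \<le> ennreal (\<tau> M)"
        using eventually_ge_at_top[of M]
      proof eventually_elim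
        case (elim N)
        have "(\<integral>\<^sup>+z. ?u N z \<partial>disk_dA) =
              ennreal ((disk_norm (\<lambda>z. bergman_partial_sum c N z - bergman_partial_sum c M z))\<^sup>2)"
          by (intro disk_norm_power2_nn_integral[symmetric] disk_L2_diff bergman_partial_sum_L2)
        also have "\<dots> \<le> ennreal (\<tau> M)"
          using \<tau>[OF elim] by (simp add: disk_norm_bergman_partial_sum_diff[OF elim] ennreal_leI)
        finally show ?case .
      qed
    qed
    finally show ?thesis .
  qed
  have L2: "(\<lambda>z. F z - bergman_partial_sum c M z) \<in> disk_L2" for M
  proof -
    have "(\<lambda>z. F z - bergman_partial_sum c M z) \<in> borel_measurable disk_dA"
      using meas Smeas by (intro borel_measurable_diff)
    moreover have "(\<integral>\<^sup>+z. ennreal ((cmod (F z - bergman_partial_sum c M z))\<^sup>2) \<partial>disk_dA) < \<infinity>"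
      by (rule le_less_trans[OF bound]) simp
    ultimately show ?thesis
      by (simp only: disk_L2_iff_nn_integral)
  qed
  from L2[of 0] have "F \<in> disk_L2"
    by (simp add: bergman_partial_sum_def)
  then show "F \<in> bergman_space"
    using hol F0 by (simp add: bergman_space_def del: mem_ball)
  have \<tau>0: "\<tau> M \<ge> 0" for M
    using \<tau>[of M M] by simp
  have le: "disk_norm (\<lambda>z. F z - bergman_partial_sum c M z) \<le> sqrt (\<tau> M)" for M
  proof -
    have "ennreal ((disk_norm (\<lambda>z. F z - bergman_partial_sum c M z))\<^sup>2) \<le> ennreal (\<tau> M)"
      using bound[of M] by (simp only: disk_norm_power2_nn_integral[OF L2])
    then show ?thesis
      using \<tau>0[of M] by (intro real_le_rsqrt) (simp add: ennreal_le_iff)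
  qed
  have "(\<lambda>M. sqrt (\<tau> M)) \<longlonglongrightarrow> 0"
    using tendsto_real_sqrt[OF \<tau>lim] by simp
  then show "(\<lambda>N. disk_norm (\<lambda>z. F z - bergman_partial_sum c N z)) \<longlonglongrightarrow> 0"
    by (rule Lim_null_comparison[rotated]) (simp add: le disk_norm_nonneg)
qed

lemma bergman_Bessel:
  assumes u: "u \<in> disk_L2"
  shows "summable (\<lambda>n. real (Suc n) * (cmod (disk_inner u (\<lambda>z. z ^ n)))\<^sup>2)"
proof -
  define c where "c n = disk_inner u (\<lambda>z. z ^ n)" for n
  have "(\<Sum>n<N. real (Suc n) * (cmod (c n))\<^sup>2) \<le> (disk_norm u)\<^sup>2" for N
  proof -
    let ?S = "bergman_partial_sum c N"
    have Sn: "(disk_norm ?S)\<^sup>2 = (\<Sum>n<N. real (Suc n) * (cmod (c n))\<^sup>2)"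
      using disk_norm_bergman_partial_sum_diff[of 0 N c]
      by (simp add: bergman_partial_sum_def[of c 0] lessThan_atLeast0)
    have "disk_inner ?S u = (\<Sum>n<N. of_nat (Suc n) * c n * cnj (c n))"
      unfolding disk_inner_bergman_partial_sum[OF u]
      by (intro sum.cong refl) (simp only: c_def disk_inner_cnj[of "\<lambda>z. z ^ _" u])
    also have "\<dots> = of_real (\<Sum>n<N. real (Suc n) * (cmod (c n))\<^sup>2)"
      unfolding of_real_sum by (simp only: of_real_mult complex_norm_square of_real_of_nat_eq mult.assoc)
    finally have "(disk_norm ?S)\<^sup>2 = cmod (disk_inner ?S u)"
      unfolding Sn by (simp only: norm_of_real) (simp add: sum_nonneg)
    also have "\<dots> \<le> disk_norm ?S * disk_norm u"
      by (rule disk_Cauchy_Schwarz[OF bergman_partial_sum_L2 u])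
    finally have "disk_norm ?S \<le> disk_norm u"
      using disk_norm_nonneg[of ?S] disk_norm_nonneg[of u]
      by (cases "disk_norm ?S = 0") (auto simp: power2_eq_square)
    then have "(disk_norm ?S)\<^sup>2 \<le> (disk_norm u)\<^sup>2"
      by (intro power_mono disk_norm_nonneg)
    then show ?thesis by (simp only: Sn)
  qed
  then have "summable (\<lambda>n. real (Suc n) * (cmod (c n))\<^sup>2)"
    by (intro bounded_imp_summable[where B = "(disk_norm u)\<^sup>2"])
      (auto simp flip: lessThan_Suc_atMost simp del: of_nat_Suc sum.lessThan_Suc)
  then show ?thesis by (simp add: c_def)
qed

lemma bergman_proj_sums:
  assumes u: "integrable disk_dA u" and z: "z \<in> ball 0 1"
  shows "(\<lambda>n. of_nat (Suc n) * disk_inner u (\<lambda>w. w ^ n) * z ^ n) sums bergman_proj u z"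
proof -
  have m: "u \<in> borel_measurable disk_dA" using u by auto
  have z1: "cmod z < 1" using z by simp
  let ?f = "\<lambda>n w. (of_nat (Suc n) * z ^ n) * (u w * cnj (w ^ n))"
  have bnd: "norm (?f n w) \<le> (real (Suc n) * cmod z ^ n) * norm (u w)" if "w \<in> ball 0 1" for n w
  proof -
    have "cmod w ^ n \<le> 1"
      using that by (intro power_le_one) auto
    then have "norm (u w) * cmod w ^ n \<le> norm (u w)"
      by (intro mult_left_le) auto
    then have "(real (Suc n) * cmod z ^ n) * (norm (u w) * cmod w ^ n) \<le>
               (real (Suc n) * cmod z ^ n) * norm (u w)"
      by (intro mult_left_mono) auto
    then show ?thesis
      by (simp add: norm_mult norm_power del: of_nat_Suc)
  qed
  have gs: "summable (\<lambda>n. real (Suc n) * cmod z ^ n)"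
    using geometric_deriv_sums[of "cmod z"] z1 by (auto simp: sums_iff)
  have int: "integrable disk_dA (\<lambda>w. u w * cnj (w ^ n))" for n
  proof (rule Bochner_Integration.integrable_bound[OF u])
    show "(\<lambda>w. u w * cnj (w ^ n)) \<in> borel_measurable disk_dA"
      using m disk_L2_measurable[OF disk_L2_power] by (intro borel_measurable_times borel_measurable_cnj)
    show "AE w in disk_dA. norm (u w * cnj (w ^ n)) \<le> norm (u w)"
    proof (rule AE_I2)
      fix w assume "w \<in> space disk_dA"
      then have "cmod w ^ n \<le> 1"
        by (intro power_le_one) auto
      then show "norm (u w * cnj (w ^ n)) \<le> norm (u w)"
        by (simp add: norm_mult norm_power mult_left_le)
    qed
  qed
  then have int': "integrable disk_dA (?f n)" for n
    by (intro integrable_mult_right)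
  have "(\<lambda>n. integral\<^sup>L disk_dA (?f n)) sums (\<integral>w. (\<Sum>n. ?f n w) \<partial>disk_dA)"
  proof (rule sums_integral[OF int'])
    show "AE w in disk_dA. summable (\<lambda>n. norm (?f n w))"
    proof (rule AE_I2)
      fix w assume "w \<in> space disk_dA"
      then show "summable (\<lambda>n. norm (?f n w))"
        using bnd[of w] by (intro summable_comparison_test[OF _ summable_mult2[OF gs]]) (auto intro!: exI[of _ 0] simp del: of_nat_Suc)
    qed
    show "summable (\<lambda>n. \<integral>w. norm (?f n w) \<partial>disk_dA)"
    proof (rule summable_comparison_test[OF _ summable_mult2[OF gs]], intro exI allI impI)
      fix n :: nat
      have "(\<integral>w. norm (?f n w) \<partial>disk_dA) \<le> (\<integral>w. (real (Suc n) * cmod z ^ n) * norm (u w) \<partial>disk_dA)"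
        by (rule integral_mono[OF integrable_norm[OF int'] integrable_mult_right[OF integrable_norm[OF u]]])
          (rule bnd, simp)
      then show "norm (\<integral>w. norm (?f n w) \<partial>disk_dA) \<le> (real (Suc n) * cmod z ^ n) * (\<integral>w. norm (u w) \<partial>disk_dA)"
        by (simp del: of_nat_Suc)
    qed
  qed
  also have "(\<integral>w. (\<Sum>n. ?f n w) \<partial>disk_dA) = (\<integral>w. u w / (1 - z * cnj w)\<^sup>2 \<partial>disk_dA)"
  proof (intro Bochner_Integration.integral_cong refl)
    fix w assume "w \<in> space disk_dA"
    then have "cmod (z * cnj w) < 1"
    proof -
      have "cmod z * cmod w \<le> cmod z * 1"
        using \<open>w \<in> space disk_dA\<close> by (intro mult_left_mono) auto
      then show ?thesis
        using z1 by (simp add: norm_mult)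
    qed
    from sums_mult[OF geometric_deriv_sums[OF this], of "u w"]
    have "(\<lambda>n. ?f n w) sums (u w / (1 - z * cnj w)\<^sup>2)"
      by (simp add: power_mult_distrib mult_ac del: of_nat_Suc)
    then show "(\<Sum>n. ?f n w) = u w / (1 - z * cnj w)\<^sup>2"
      by (rule sums_unique[symmetric])
  qed
  also have "\<dots> = bergman_proj u z"
    using z by (simp add: bergman_proj_def disk_restrict_def)
  also have "(\<lambda>n. integral\<^sup>L disk_dA (?f n)) = (\<lambda>n. of_nat (Suc n) * disk_inner u (\<lambda>w. w ^ n) * z ^ n)"
  proof
    fix n
    have "integral\<^sup>L disk_dA (?f n) = (of_nat (Suc n) * z ^ n) * (\<integral>w. u w * cnj (w ^ n) \<partial>disk_dA)"
      by (rule integral_mult_right_zero)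
    then show "integral\<^sup>L disk_dA (?f n) = of_nat (Suc n) * disk_inner u (\<lambda>w. w ^ n) * z ^ n"
      by (simp add: disk_inner_def del: of_nat_Suc)
  qed
  finally show ?thesis .
qed

lemma bergman_spaceD:
  assumes "h \<in> bergman_space"
  shows "h \<in> disk_L2" "h holomorphic_on ball 0 1" "\<And>z. z \<notin> ball 0 1 \<Longrightarrow> h z = 0"
  using assms by (auto simp: bergman_space_def)

lemma bergman_sums:
  assumes h: "h \<in> bergman_space" and z: "z \<in> ball 0 1"
  shows "(\<lambda>n. of_nat (Suc n) * disk_inner h (\<lambda>w. w ^ n) * z ^ n) sums h z"
proof -
  note hL2 = bergman_spaceD(1)[OF h]
  note hm = disk_L2_measurable[OF hL2]
  define b where "b n = (deriv ^^ n) h 0 / fact n" for n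
  have b: "(\<lambda>n. b n * w ^ n) sums h w" if "w \<in> ball 0 1" for w
    using holomorphic_power_series[OF bergman_spaceD(2)[OF h] that] by (simp add: b_def)
  have trunc: "(\<integral>w. indicator (ball 0 r) w *\<^sub>R (h w * cnj w ^ n) \<partial>disk_dA) =
               b n * (of_real (r ^ (2 * n + 2)) / of_nat (Suc n))" if r: "0 \<le> r" "r < 1" for r n
  proof -
    let ?f = "\<lambda>m w. b m * (indicator (ball 0 r) w *\<^sub>R (w ^ m * cnj w ^ n))"
    have bs: "summable (\<lambda>m. cmod (b m) * r ^ m)"
    proof -
      obtain s where s: "r < s" "s < 1" using dense r(2) by blast
      have "summable (\<lambda>m. b m * (of_real s) ^ m)"
        using b[of "of_real s"] r s by (auto simp: sums_iff)
      from powser_insidea[OF this, of "of_real r"] show ?thesis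
        using r s by (simp add: norm_mult norm_power)
    qed
    have bnd: "norm (?f m w) \<le> cmod (b m) * r ^ m" if "w \<in> ball 0 1" for m w
    proof (cases "w \<in> ball 0 r")
      case True
      have "cmod w ^ m * cmod w ^ n \<le> r ^ m * 1"
        using True that r by (intro mult_mono power_mono power_le_one) auto
      then show ?thesis
        using True by (simp add: norm_mult norm_power mult_left_mono)
    qed (use r in simp)
    have int: "integrable disk_dA (?f m)" for m
    proof (rule disk_dA.integrable_const_bound)
      show "AE w in disk_dA. norm (?f m w) \<le> cmod (b m) * r ^ m"
        by (rule AE_I2) (rule bnd, simp)
      have "(\<lambda>w. indicat_real (ball (0::complex) r) w) \<in> borel_measurable disk_dA"
        by (intro borel_measurable_disk_dA borel_measurable_indicator) simp
      moreover have "(\<lambda>w. w ^ m * cnj w ^ n) \<in> borel_measurable disk_dA"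
        by (intro borel_measurable_disk_dA borel_measurable_continuous_onI continuous_intros)
      ultimately show "?f m \<in> borel_measurable disk_dA"
        by (intro borel_measurable_times borel_measurable_scaleR) auto
    qed
    have "(\<lambda>m. integral\<^sup>L disk_dA (?f m)) sums (\<integral>w. (\<Sum>m. ?f m w) \<partial>disk_dA)"
    proof (rule sums_integral[OF int])
      show "AE w in disk_dA. summable (\<lambda>m. norm (?f m w))"
      proof (rule AE_I2, rule summable_comparison_test[OF _ bs], intro exI allI impI)
        fix w m assume "w \<in> space disk_dA"
        then show "norm (norm (?f m w)) \<le> cmod (b m) * r ^ m"
          using bnd[of w m] by simp
      qed
      show "summable (\<lambda>m. \<integral>w. norm (?f m w) \<partial>disk_dA)"
      proof (rule summable_comparison_test[OF _ summable_mult2[OF bs]], intro exI allI impI)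
        fix m :: nat
        have "(\<integral>w. norm (?f m w) \<partial>disk_dA) \<le> (\<integral>w. cmod (b m) * r ^ m \<partial>disk_dA)"
          by (rule integral_mono[OF integrable_norm[OF int] disk_dA.integrable_const]) (rule bnd, simp)
        then show "norm (\<integral>w. norm (?f m w) \<partial>disk_dA) \<le> cmod (b m) * r ^ m * measure disk_dA (space disk_dA)"
          by (simp add: mult_ac)
      qed
    qed
    moreover have "(\<integral>w. (\<Sum>m. ?f m w) \<partial>disk_dA) = (\<integral>w. indicator (ball 0 r) w *\<^sub>R (h w * cnj w ^ n) \<partial>disk_dA)"
    proof (intro Bochner_Integration.integral_cong refl)
      fix w assume "w \<in> space disk_dA"
      then have "(\<lambda>m. b m * w ^ m) sums h w" by (intro b) simp
      from sums_mult2[OF this, of "of_real (indicator (ball 0 r) w) * cnj w ^ n"]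
      have "(\<lambda>m. ?f m w) sums (indicator (ball 0 r) w *\<^sub>R (h w * cnj w ^ n))"
        by (simp add: scaleR_conv_of_real mult_ac)
      then show "(\<Sum>m. ?f m w) = indicator (ball 0 r) w *\<^sub>R (h w * cnj w ^ n)"
        by (rule sums_unique[symmetric])
    qed
    moreover have "integral\<^sup>L disk_dA (?f m) =
        (if m = n then b n * (of_real (r ^ (2 * n + 2)) / of_nat (Suc n)) else 0)" for m
    proof -
      have "integral\<^sup>L disk_dA (?f m) =
            b m * (\<integral>w. indicator (ball 0 r) w *\<^sub>R (w ^ m * cnj w ^ n) \<partial>disk_dA)"
        by (rule integral_mult_right_zero)
      then show ?thesis
        unfolding disk_dA_moment[OF r(1) less_imp_le[OF r(2)]] by auto
    qed
    ultimately have "(\<lambda>m. if m = n then b n * (of_real (r ^ (2 * n + 2)) / of_nat (Suc n)) else 0) sums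
        (\<integral>w. indicator (ball 0 r) w *\<^sub>R (h w * cnj w ^ n) \<partial>disk_dA)"
      by simp
    then show ?thesis
      using sums_single[of n "\<lambda>_. b n * (of_real (r ^ (2 * n + 2)) / of_nat (Suc n))"]
      by (rule sums_unique2)
  qed
  have inner: "disk_inner h (\<lambda>w. w ^ n) = b n / of_nat (Suc n)" for n
  proof -
    define r where "r k = 1 - inverse (real (Suc k))" for k
    have r: "0 \<le> r k" "r k < 1" for k
      by (simp_all add: r_def field_simps)
    have rlim: "r \<longlonglongrightarrow> 1"
    proof -
      have "(\<lambda>k. 1 - inverse (real (Suc k))) \<longlonglongrightarrow> 1 - 0"
        by (intro tendsto_intros LIMSEQ_inverse_real_of_nat)
      then show ?thesis by (simp add: r_def[abs_def])
    qed
    have int: "integrable disk_dA (\<lambda>w. h w * cnj w ^ n)"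
      using disk_L2_integrable_inner[OF hL2 disk_L2_power[of n]] by simp
    have "(\<lambda>k. \<integral>w. indicator (ball 0 (r k)) w *\<^sub>R (h w * cnj w ^ n) \<partial>disk_dA) \<longlonglongrightarrow>
          (\<integral>w. h w * cnj w ^ n \<partial>disk_dA)"
    proof (rule integral_dominated_convergence[OF _ _ integrable_norm[OF int]])
      show "(\<lambda>w. h w * cnj w ^ n) \<in> borel_measurable disk_dA"
        using int by auto
      have "(\<lambda>w. indicat_real (ball (0::complex) (r k)) w) \<in> borel_measurable disk_dA" for k
        by (intro borel_measurable_disk_dA borel_measurable_indicator) simp
      then show "(\<lambda>w. indicator (ball 0 (r k)) w *\<^sub>R (h w * cnj w ^ n)) \<in> borel_measurable disk_dA" for k
        using int by (intro borel_measurable_scaleR) auto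
      show "AE w in disk_dA. norm (indicator (ball 0 (r k)) w *\<^sub>R (h w * cnj w ^ n)) \<le> norm (h w * cnj w ^ n)" for k
        by (intro AE_I2) (simp add: indicator_def)
      show "AE w in disk_dA. (\<lambda>k. indicator (ball 0 (r k)) w *\<^sub>R (h w * cnj w ^ n)) \<longlonglongrightarrow> h w * cnj w ^ n"
      proof (rule AE_I2, rule tendsto_eventually)
        fix w assume "w \<in> space disk_dA"
        then have "cmod w < 1" by simp
        then have "eventually (\<lambda>k. cmod w < r k) sequentially"
          using order_tendstoD(1)[OF rlim] by blast
        then show "\<forall>\<^sub>F k in sequentially. indicator (ball 0 (r k)) w *\<^sub>R (h w * cnj w ^ n) = h w * cnj w ^ n"
          by eventually_elim simp
      qed
    qed
    then have "(\<lambda>k. b n * (of_real (r k ^ (2 * n + 2)) / of_nat (Suc n))) \<longlonglongrightarrow> disk_inner h (\<lambda>w. w ^ n)"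
      by (simp only: trunc[OF r] disk_inner_def complex_cnj_power)
    moreover have "(\<lambda>k. b n * (of_real (r k ^ (2 * n + 2)) / of_nat (Suc n))) \<longlonglongrightarrow>
        b n * (of_real (1 ^ (2 * n + 2)) / of_nat (Suc n))"
      by (intro tendsto_intros rlim) (simp del: of_nat_Suc)
    ultimately show ?thesis
      using LIMSEQ_unique by fastforce
  qed
  show ?thesis
    using b[OF z] by (simp add: inner del: of_nat_Suc)
qed

lemma bergman_partial_sum_tendsto:
  assumes h: "h \<in> bergman_space"
  shows "(\<lambda>N. disk_norm (\<lambda>z. h z - bergman_partial_sum (\<lambda>n. disk_inner h (\<lambda>w. w ^ n)) N z)) \<longlonglongrightarrow> 0"
  by (rule bergman_series(2)[OF bergman_sums[OF h] bergman_Bessel bergman_spaceD(3)[OF h]])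
    (use bergman_spaceD(1)[OF h] in auto)

theorem bergman_proj_orthogonal_projection:
  assumes u: "u \<in> disk_L2"
  shows "bergman_proj u \<in> bergman_space"
    and "h \<in> bergman_space \<Longrightarrow> disk_inner (\<lambda>z. u z - bergman_proj u z) h = 0"
proof -
  define c where "c n = disk_inner u (\<lambda>w. w ^ n)" for n
  have 1: "(\<lambda>n. of_nat (Suc n) * c n * z ^ n) sums bergman_proj u z" if "z \<in> ball 0 1" for z
    using bergman_proj_sums[OF disk_L2_integrable_self[OF u] that] by (simp only: c_def)
  have 2: "summable (\<lambda>n. real (Suc n) * (cmod (c n))\<^sup>2)"
    using bergman_Bessel[OF u] by (simp only: c_def)
  have 3: "bergman_proj u z = 0" if "z \<notin> ball 0 1" for z
    using that by (simp add: bergman_proj_def disk_restrict_def)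
  show P: "bergman_proj u \<in> bergman_space"
    by (rule bergman_series(1)[OF 1 2 3])
  have lim: "(\<lambda>N. disk_norm (\<lambda>z. bergman_proj u z - bergman_partial_sum c N z)) \<longlonglongrightarrow> 0"
    by (rule bergman_series(2)[OF 1 2 3])
  note PL2 = bergman_spaceD(1)[OF P]
  have pow: "disk_inner (\<lambda>z. u z - bergman_proj u z) (\<lambda>w. w ^ k) = 0" for k
  proof -
    have "(\<lambda>N. disk_inner (bergman_partial_sum c N) (\<lambda>w. w ^ k)) \<longlonglongrightarrow> disk_inner (bergman_proj u) (\<lambda>w. w ^ k)"
      by (rule disk_inner_tendsto[OF bergman_partial_sum_L2 PL2 disk_L2_power lim])
    moreover have "(\<lambda>N. disk_inner (bergman_partial_sum c N) (\<lambda>w. w ^ k)) \<longlonglongrightarrow> c k"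
      by (intro tendsto_eventually eventually_mono[OF eventually_gt_at_top[of k]])
        (simp add: disk_inner_bergman_partial_sum_power)
    ultimately have "disk_inner (bergman_proj u) (\<lambda>w. w ^ k) = c k"
      by (rule LIMSEQ_unique)
    then show ?thesis
      by (simp add: disk_inner_diff_left[OF u PL2 disk_L2_power] c_def)
  qed
  show "disk_inner (\<lambda>z. u z - bergman_proj u z) h = 0" if h: "h \<in> bergman_space"
  proof -
    note uP = disk_L2_diff[OF u PL2]
    define d where "d n = disk_inner h (\<lambda>w. w ^ n)" for n
    have "(\<lambda>N. disk_inner (bergman_partial_sum d N) (\<lambda>z. u z - bergman_proj u z)) \<longlonglongrightarrow>
          disk_inner h (\<lambda>z. u z - bergman_proj u z)"
      using bergman_partial_sum_tendsto[OF h]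
      by (intro disk_inner_tendsto[OF bergman_partial_sum_L2 bergman_spaceD(1)[OF h] uP]) (simp add: d_def[abs_def])
    moreover have "disk_inner (bergman_partial_sum d N) (\<lambda>z. u z - bergman_proj u z) = 0" for N
      unfolding disk_inner_bergman_partial_sum[OF uP]
    proof (rule sum.neutral, rule ballI)
      fix n
      have "disk_inner (\<lambda>z. z ^ n) (\<lambda>z. u z - bergman_proj u z) = 0"
        by (simp only: disk_inner_cnj[of "\<lambda>z. z ^ n"] pow complex_cnj_zero)
      then show "of_nat (Suc n) * d n * disk_inner (\<lambda>z. z ^ n) (\<lambda>z. u z - bergman_proj u z) = 0"
        by simp
    qed
    ultimately have "disk_inner h (\<lambda>z. u z - bergman_proj u z) = 0"
      by (simp add: LIMSEQ_const_iff)
    then show ?thesis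
      by (simp add: disk_inner_cnj[of "\<lambda>z. u z - bergman_proj u z" h])
  qed
qed

lemma disk_inner_cong:
  "(\<And>z. z \<in> ball 0 1 \<Longrightarrow> u z = u' z) \<Longrightarrow> (\<And>z. z \<in> ball 0 1 \<Longrightarrow> v z = v' z) \<Longrightarrow> disk_inner u v = disk_inner u' v'"
  unfolding disk_inner_def by (intro Bochner_Integration.integral_cong) auto

lemma disk_norm_cong:
  "(\<And>z. z \<in> ball 0 1 \<Longrightarrow> u z = u' z) \<Longrightarrow> disk_norm u = disk_norm u'"
  unfolding disk_norm_def by (intro arg_cong[where f = sqrt] Bochner_Integration.integral_cong) auto

lemma bergman_space_eqI:
  assumes h: "h \<in> bergman_space" and k: "k \<in> bergman_space"
    and eq: "\<And>n. disk_inner h (\<lambda>w. w ^ n) = disk_inner k (\<lambda>w. w ^ n)"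
  shows "h = k"
proof
  fix z
  show "h z = k z"
  proof (cases "z \<in> ball 0 1")
    case True
    show ?thesis
      using bergman_sums[OF h True] bergman_sums[OF k True] unfolding eq by (rule sums_unique2)
  qed (use bergman_spaceD(3)[OF h] bergman_spaceD(3)[OF k] in simp)
qed

lemma bergman_space_poly: "disk_restrict (poly p) \<in> bergman_space"
proof -
  have "disk_restrict (poly p) holomorphic_on ball 0 1 \<longleftrightarrow> poly p holomorphic_on ball 0 1"
    by (rule holomorphic_cong) (auto simp: disk_restrict_def)
  then have hol: "disk_restrict (poly p) holomorphic_on ball 0 1"
    by (simp add: poly_holomorphic_on)
  have "poly p \<in> disk_L2"
    by (intro disk_L2_continuous continuous_on_poly continuous_on_id)
  then have "integrable disk_dA (\<lambda>z. (cmod (poly p z))\<^sup>2)"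
    by (rule disk_L2_integrable)
  moreover have "integrable disk_dA (\<lambda>z. (cmod (poly p z))\<^sup>2) \<longleftrightarrow>
                 integrable disk_dA (\<lambda>z. (cmod (disk_restrict (poly p) z))\<^sup>2)"
    by (intro Bochner_Integration.integrable_cong) (auto simp: disk_restrict_def)
  ultimately show ?thesis
    using hol holomorphic_measurable_disk_dA[OF hol]
    by (simp add: bergman_space_def disk_L2_def) (simp add: disk_restrict_def)
qed

lemma toeplitz_extension_unique:
  assumes S: "toeplitz_extension f S" and T: "toeplitz_extension f T" and h: "h \<in> bergman_space"
  shows "S h = T h"
proof -
  define d where "d n = disk_inner h (\<lambda>w. w ^ n)" for n
  define p where "p N = (\<Sum>n<N. monom (of_nat (Suc n) * d n) n)" for N
  have pb: "bergman_partial_sum d N z = poly (p N) z" for N z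
    by (simp add: p_def bergman_partial_sum_def poly_sum poly_monom)
  define q where "q N = disk_restrict (poly (p N))" for N
  have q: "q N \<in> bergman_space" for N
    unfolding q_def by (rule bergman_space_poly)
  have "(\<lambda>N. disk_norm (\<lambda>z. h z - q N z)) \<longlonglongrightarrow> 0"
  proof -
    have "disk_norm (\<lambda>z. h z - q N z) = disk_norm (\<lambda>z. h z - bergman_partial_sum d N z)" for N
      by (rule disk_norm_cong) (simp add: q_def pb disk_restrict_def)
    then show ?thesis
      using bergman_partial_sum_tendsto[OF h] by (simp add: d_def[abs_def])
  qed
  note qlim = this
  have conv: "(\<lambda>N. disk_inner (R (q N)) (\<lambda>w. w ^ k)) \<longlonglongrightarrow> disk_inner (R h) (\<lambda>w. w ^ k)"
    if R: "bergman_bounded_operator R" for R k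
  proof -
    from R obtain C where C: "\<And>h. h \<in> bergman_space \<Longrightarrow> disk_norm (R h) \<le> C * disk_norm h"
      unfolding bergman_bounded_operator_def by blast
    have RB: "R h \<in> bergman_space" if "h \<in> bergman_space" for h
      using R that unfolding bergman_bounded_operator_def by auto
    have lin: "R (\<lambda>z. h z - q N z) = (\<lambda>z. R h z - R (q N) z)" for N
    proof -
      have "\<forall>h\<in>bergman_space. \<forall>k\<in>bergman_space. \<forall>c d.
          R (\<lambda>z. c * h z + d * k z) = (\<lambda>z. c * R h z + d * R k z)"
        using R unfolding bergman_bounded_operator_def by blast
      then have "R (\<lambda>z. 1 * h z + (- 1) * q N z) = (\<lambda>z. 1 * R h z + (- 1) * R (q N) z)"
        using h q by blast
      then show ?thesis by simp
    qed
    have diff: "(\<lambda>z. h z - q N z) \<in> bergman_space" for N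
      using bergman_spaceD[OF h] bergman_spaceD[OF q[of N]] 
      by (auto simp: bergman_space_def intro!: disk_L2_diff holomorphic_on_diff)
    have "(\<lambda>N. disk_norm (\<lambda>z. R h z - R (q N) z)) \<longlonglongrightarrow> 0"
    proof (rule Lim_null_comparison)
      show "\<forall>\<^sub>F N in sequentially. norm (disk_norm (\<lambda>z. R h z - R (q N) z)) \<le> C * disk_norm (\<lambda>z. h z - q N z)"
        using C[OF diff] by (simp add: lin disk_norm_nonneg)
      show "(\<lambda>N. C * disk_norm (\<lambda>z. h z - q N z)) \<longlonglongrightarrow> 0"
        using tendsto_mult_left[OF qlim, of C] by simp
    qed
    then show ?thesis
      using RB h q by (intro disk_inner_tendsto disk_L2_power bergman_spaceD(1)) auto
  qed
  have SB: "bergman_bounded_operator S" and TB: "bergman_bounded_operator T"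
    using S T by (auto simp: toeplitz_extension_def)
  have eq: "S (q N) = T (q N)" for N
    using S T by (simp add: toeplitz_extension_def q_def)
  show ?thesis
  proof (rule bergman_space_eqI)
    show "S h \<in> bergman_space" "T h \<in> bergman_space"
      using SB TB h by (auto simp: bergman_bounded_operator_def)
    show "disk_inner (S h) (\<lambda>w. w ^ n) = disk_inner (T h) (\<lambda>w. w ^ n)" for n
      using conv[OF SB, of n] conv[OF TB, of n] unfolding eq by (rule LIMSEQ_unique)
  qed
qed

end

theory Submission
  imports Defs
begin

text \<open>
In the basis e_k = (k + 1) z ^ k of the polynomials, T_g maps e_k to w(k) e_(k+1) plus the sum of a_l e_(k-l) over
1 \<le> l \<le> k, where w(x) = (x + 1) / (x + 3). As w(k) is never zero, the constant 1 is a cyclic vector. The truncation of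
the polar decomposition of f makes T_f 1 a polynomial of degree at most N, so T_f 1 = p(T_g) 1 for a polynomial p
with degree at most N, and since T_f commutes with T_g it follows that T_f = p(T_g)
(\<open>commutant_polynomial\<close>). It remains to see that p(T_g) is not a Toeplitz operator with integrable symbol unless
the degree of p is at most one (\<open>toeplitz_polynomial_degree_le_1\<close>).

The matrix elements of T_f on the n-th diagonal, from z ^ k to z ^ (k + n), are the values of a Mellin transform of the
angular coefficient f_n. They extend to a bounded holomorphic function of k with Re (2 k + n) > 0, which is
continuous up to the boundary. The matrix elements of the powers of T_g, on the other hand, are for large k the values of rational functions
of k: these are the entries of a bilateral operator that takes the same steps with the same weights w and a_l, but
also between positions with negative index. A bounded holomorphic function on a half-plane is determined by its
values at the large integers (\<open>bounded_halfplane_integer_zeros\<close>), so on each diagonal the two extensions coincide wherever both are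
defined (\<open>toeplitz_polynomial_diagonal\<close>).

For small k this is too much to ask, because the actual T_g annihilates what steps below 0. Let p have degree d \<ge> 2,
let a_l be nonzero with l \<ge> 5, and consider the paths of at most d steps from k = l - 3 to m = d - 4. A path that dips
below 0 is annihilated by T_g. In the bilateral operator it gets lost as well, since it has to take
the step from -1, of weight w(-1) = 0 (if m is -1 or -2, the factor (m + 1) (m + 2) of the normalization vanishes
instead); the exception is a path that also takes the step from -3, where w has a pole.
There is exactly one such path: down by l to -3 and then up d - 1 times (\<open>bilateral_entry_limit\<close>). Suitably
normalized it contributes 2 c_d a_l, where c_d is the leading coefficient of p. So the bilateral entry differs from the
actual one, or has a pole if d is 2 or 3, although both are given by the same Mellin transform; the assumption l \<ge> 5
guarantees that the point k = l - 3 belongs to its domain.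
\<close>

section \<open>Bounded holomorphic functions on a half-plane\<close>

text \<open>The Schwarz lemma, transported from the unit disk by the Cayley map that sends 0 to the zero p. It is
applied to H / C with C > B, because the Schwarz lemma asks for values strictly inside the disk; then C tends to B.\<close>

lemma bounded_halfplane_zero_bound:
  assumes hol: "H holomorphic_on {z. 0 < Re z}"
    and bnd: "\<And>z. 0 < Re z \<Longrightarrow> cmod (H z) \<le> B"
    and p: "0 < p" and zero: "H (of_real p) = 0" and z: "0 < Re z"
  shows "cmod (H z) \<le> B * cmod ((z - of_real p) / (z + of_real p))"
proof -
  have cayley: "0 < Re (of_real p * (1 + \<zeta>) / (1 - \<zeta>))" if "cmod \<zeta> < 1" for \<zeta>
  proof -
    have "(Re \<zeta>)\<^sup>2 + (Im \<zeta>)\<^sup>2 < 1"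
      using that by (simp add: cmod_def)
    moreover have "(1 - Re \<zeta>)\<^sup>2 + (Im \<zeta>)\<^sup>2 > 0"
      using that by (metis abs_Re_le_cmod abs_le_D1 add_pos_nonneg diff_gt_0_iff_gt le_less_trans zero_le_power2 zero_less_power)
    ultimately show ?thesis
      using p by (simp add: Re_divide divide_simps power2_eq_square) (simp add: algebra_simps flip: distrib_left right_diff_distrib)
  qed
  have le: "cmod (H z) \<le> C * cmod ((z - of_real p) / (z + of_real p))" if C: "B < C" for C
  proof -
    have C0: "0 < C"
      using bnd[OF z] C norm_ge_zero[of "H z"] by linarith
    define \<phi> where "\<phi> \<zeta> = H (of_real p * (1 + \<zeta>) / (1 - \<zeta>)) / of_real C" for \<zeta>
    define \<zeta> where "\<zeta> = (z - of_real p) / (z + of_real p)"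
    have ne: "z + of_real p \<noteq> 0"
      using z p by (auto simp: complex_eq_iff)
    have "(Re z - p)\<^sup>2 + (Im z)\<^sup>2 < (Re z + p)\<^sup>2 + (Im z)\<^sup>2"
      using z p by (simp add: power2_eq_square algebra_simps)
    then have "cmod (z - of_real p) < cmod (z + of_real p)"
      by (simp add: cmod_def)
    then have \<zeta>1: "cmod \<zeta> < 1"
      using ne by (simp add: \<zeta>_def norm_divide)
    have "1 - \<zeta> \<noteq> 0" using \<zeta>1 by auto
    have inv: "of_real p * (1 + \<zeta>) / (1 - \<zeta>) = z"
    proof -
      have "1 + \<zeta> = 2 * z / (z + of_real p)" "1 - \<zeta> = 2 * of_real p / (z + of_real p)"
        using ne by (simp_all add: \<zeta>_def field_simps)
      then show ?thesis
        using ne p by simp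
    qed
    have "cmod (\<phi> \<zeta>) \<le> cmod \<zeta>"
    proof (rule Schwarz_Lemma(1)[OF _ _ _ \<zeta>1])
      have "(H \<circ> (\<lambda>\<zeta>. of_real p * (1 + \<zeta>) / (1 - \<zeta>))) holomorphic_on ball 0 1"
        by (rule holomorphic_on_compose_gen[OF _ hol]) (auto intro!: holomorphic_intros cayley)
      then show "\<phi> holomorphic_on ball 0 1"
        unfolding \<phi>_def[abs_def] o_def by (intro holomorphic_intros) (use C0 in auto)
      show "\<phi> 0 = 0" by (simp add: \<phi>_def zero)
      show "cmod (\<phi> \<xi>) < 1" if "cmod \<xi> < 1" for \<xi>
        using bnd[OF cayley[OF that]] C C0 by (simp add: \<phi>_def norm_divide)
    qed
    moreover have "\<phi> \<zeta> = H z / of_real C"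
      by (simp only: \<phi>_def inv)
    ultimately show ?thesis
      using C0 unfolding \<zeta>_def[symmetric] by (simp add: norm_divide field_simps)
  qed
  show ?thesis
  proof (rule tendsto_lowerbound)
    show "((\<lambda>C. C * cmod ((z - of_real p) / (z + of_real p))) \<longlongrightarrow> B * cmod ((z - of_real p) / (z + of_real p))) (at_right B)"
      by (intro tendsto_intros)
    show "\<forall>\<^sub>F C in at_right B. cmod (H z) \<le> C * cmod ((z - of_real p) / (z + of_real p))"
      using le by (auto simp: eventually_at_right_field intro!: exI[of _ "B + 1"])
  qed simp
qed

text \<open>A finite Blaschke product can be split off one zero at a time: by the previous lemma, dividing by the
factor of a zero p leaves a holomorphic function with the same bound B and the remaining zeros.\<close>

lemma bounded_halfplane_zeros_bound:
  assumes "finite P" "P \<subseteq> {0<..}"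
    and "H holomorphic_on {z. 0 < Re z}"
    and "\<And>z. 0 < Re z \<Longrightarrow> cmod (H z) \<le> B"
    and "\<And>p. p \<in> P \<Longrightarrow> H (of_real p) = 0" and "0 < Re z"
  shows "cmod (H z) \<le> B * (\<Prod>p\<in>P. cmod ((z - of_real p) / (z + of_real p)))"
  using assms
proof (induction P arbitrary: H z rule: finite_induct)
  case empty
  then show ?case by simp
next
  case (insert p P)
  have p: "0 < p" using insert.prems(1) by simp
  have opn: "open {z. 0 < Re z}" by (rule open_halfspace_Re_gt)
  have ne: "z + of_real p \<noteq> 0" if "0 < Re z" for z
    using that p by (auto simp: complex_eq_iff)
  \<comment> \<open>the quotient of H by the Blaschke factor of p, with its removable singularity filled in\<close>
  define Q where "Q w = (if w = of_real p then deriv H (of_real p) else (H w - H (of_real p)) / (w - of_real p))" for w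
  have Q: "Q holomorphic_on {z. 0 < Re z}"
    unfolding Q_def[abs_def] by (rule pole_lemma_open[OF insert.prems(2) opn])
  define K where "K w = Q w * (w + of_real p)" for w
  have HK: "H w = K w * ((w - of_real p) / (w + of_real p))" if "0 < Re w" for w
    using ne[OF that] insert.prems(4)[of p] by (auto simp: K_def Q_def)
  have Khol: "K holomorphic_on {z. 0 < Re z}"
    unfolding K_def[abs_def] by (intro holomorphic_intros Q)
  have KB: "cmod (K w) \<le> B" if w: "0 < Re w" "w \<noteq> of_real p" for w
  proof -
    have "cmod (H w) \<le> B * cmod ((w - of_real p) / (w + of_real p))"
      using insert.prems by (intro bounded_halfplane_zero_bound p w) auto
    then show ?thesis
    proof -
      have "0 < cmod ((w - of_real p) / (w + of_real p))"
        using w ne[OF w(1)] by simp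
      moreover have "cmod (K w) * cmod ((w - of_real p) / (w + of_real p)) \<le>
          B * cmod ((w - of_real p) / (w + of_real p))"
        using \<open>cmod (H w) \<le> _\<close> unfolding HK[OF w(1)] norm_mult .
      ultimately show ?thesis
        by (simp only: mult_le_cancel_right)
    qed
  qed
  have KB: "cmod (K w) \<le> B" if w: "0 < Re w" for w
  proof (cases "w = of_real p")
    case True
    have "(K \<longlongrightarrow> K w) (at w)"
      using holomorphic_on_imp_continuous_on[OF Khol] w opn
      by (simp add: continuous_on_eq_continuous_at isCont_def)
    then have "((\<lambda>v. cmod (K v)) \<longlongrightarrow> cmod (K w)) (at w)"
      by (rule tendsto_norm)
    moreover have "\<forall>\<^sub>F v in at w. cmod (K v) \<le> B"
      using eventually_at_in_open[OF opn, of w] w True by (auto elim!: eventually_mono intro: KB)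
    ultimately show ?thesis
      by (rule tendsto_upperbound) simp
  qed (use KB w in blast)
  have "cmod (K z) \<le> B * (\<Prod>p\<in>P. cmod ((z - of_real p) / (z + of_real p)))"
  proof (rule insert.IH[OF _ Khol KB _ \<open>0 < Re z\<close>])
    show "P \<subseteq> {0<..}" using insert.prems(1) by simp
    fix q assume q: "q \<in> P"
    then have "0 < q" "q \<noteq> p" using insert.prems(1) insert.hyps by auto
    then show "K (of_real q) = 0"
      using insert.prems(4)[of q] insert.prems(4)[of p] q by (simp add: K_def Q_def)
  qed
  then have "cmod (K z) * cmod ((z - of_real p) / (z + of_real p)) \<le>
      B * (\<Prod>p\<in>P. cmod ((z - of_real p) / (z + of_real p))) * cmod ((z - of_real p) / (z + of_real p))"
    by (intro mult_right_mono) auto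
  then show ?case
    unfolding HK[OF \<open>0 < Re z\<close>] norm_mult prod.insert[OF insert.hyps] by (simp only: mult_ac)
qed

text \<open>The integers violate the Blaschke condition of the half-plane: for 0 < x < 1 the factor of the zero j is
at most 1 - x / j, hence at most exp (- x / j), and the harmonic series diverges. So H vanishes on (0, 1),
and the identity theorem does the rest. This is the uniqueness theorem that lets the
matrix elements of a Toeplitz operator at large integers determine all of them.\<close>

lemma bounded_halfplane_integer_zeros:
  assumes hol: "H holomorphic_on {z. 0 < Re z}"
    and bnd: "\<And>z. 0 < Re z \<Longrightarrow> cmod (H z) \<le> B"
    and zeros: "\<And>j::nat. 0 < j \<Longrightarrow> H (of_nat j) = 0"
    and z: "0 < Re z"
  shows "H z = 0"
proof -
  have unit: "H (of_real x) = 0" if x: "0 < x" "x < 1" for x :: real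
  proof -
    have B: "0 \<le> B" using bnd[OF z] norm_ge_zero[of "H z"] by linarith
    have "cmod (H (of_real x)) \<le> B * exp (- x * harm n)" for n
    proof -
      have "cmod (H (of_real x)) \<le>
          B * (\<Prod>p\<in>real ` {1..n}. cmod ((of_real x - of_real p) / (of_real x + of_real p)))"
        by (rule bounded_halfplane_zeros_bound) (use hol bnd zeros x in auto)
      also have "(\<Prod>p\<in>real ` {1..n}. cmod ((of_real x - of_real p) / (of_real x + of_real p))) =
          (\<Prod>j\<in>{1..n}. cmod ((of_real x - of_real (real j)) / (of_real x + of_real (real j))))"
        by (subst prod.reindex) (auto simp: inj_on_def)
      also have "\<dots> \<le> (\<Prod>j\<in>{1..n}. exp (- x * inverse (real j)))"
      proof (rule prod_mono, rule conjI)
        fix j assume "j \<in> {1..n}"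
        then have j: "1 \<le> real j" by simp
        have "cmod ((of_real x - of_real (real j)) / (of_real x + of_real (real j))) = \<bar>(x - real j) / (x + real j)\<bar>"
          by (metis norm_of_real of_real_add of_real_diff of_real_divide)
        also have "\<dots> = (real j - x) / (real j + x)"
          using x j by (simp add: abs_if field_simps)
        also have "\<dots> \<le> 1 + - x * inverse (real j)"
        proof -
          have "x * x + x * real j \<le> 2 * x * real j"
            using x j by (simp add: mult_left_mono)
          then show ?thesis
            using x j by (simp add: field_simps)
        qed
        also have "\<dots> \<le> exp (- x * inverse (real j))"
          by (rule exp_ge_add_one_self)
        finally show "cmod ((of_real x - of_real (real j)) / (of_real x + of_real (real j))) \<le> exp (- x * inverse (real j))" .
      qed simp
      also have "\<dots> = exp (- x * harm n)"
        by (simp add: exp_sum[symmetric] harm_def sum_distrib_left sum_negf)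
      finally show ?thesis using B by (simp add: mult_left_mono)
    qed
    moreover have "(\<lambda>n. B * exp (- x * harm n)) \<longlonglongrightarrow> B * 0"
    proof (intro tendsto_intros filterlim_compose[OF exp_at_bot])
      have "filterlim (\<lambda>n. harm n :: real) at_top sequentially"
        by (rule filterlim_at_top_mono[OF filterlim_compose[OF ln_at_top filterlim_compose[OF _ filterlim_real_sequentially]]])
           (use ln_le_harm filterlim_tendsto_add_at_top[OF tendsto_const filterlim_ident, of 1] in \<open>auto simp: add.commute intro: always_eventually\<close>)
      then show "filterlim (\<lambda>n. - x * harm n) at_bot sequentially"
        using x by (intro filterlim_tendsto_neg_mult_at_bot[OF tendsto_const]) auto
    qed
    ultimately have "cmod (H (of_real x)) \<le> B * 0"
      by (intro LIMSEQ_le_const[of "\<lambda>n. B * exp (- x * harm n)"]) auto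
    then show ?thesis by simp
  qed
  show ?thesis
  proof (rule analytic_continuation[OF hol open_halfspace_Re_gt])
    show "connected {z. 0 < Re z}"
      by (intro convex_connected convex_halfspace_Re_gt)
    show "of_real ` {0<..<1::real} \<subseteq> {z. 0 < Re z}" "of_real (1/2) \<in> {z. 0 < Re z}"
      by auto
    have "(1/2::real) islimpt {0<..<1}"
      by (simp add: islimpt_greaterThanLessThan1 open_imp_islimpt interior_limit_point)
    then show "(of_real (1/2) :: complex) islimpt of_real ` {0<..<1::real}"
      unfolding islimpt_approachable
    proof (intro allI impI)
      fix e :: real assume "0 < e" "\<forall>e>0. \<exists>x'\<in>{0<..<1}. x' \<noteq> 1 / 2 \<and> dist x' (1 / 2 :: real) < e"
      then obtain x :: real where "x \<in> {0<..<1}" "x \<noteq> 1 / 2" "dist x (1 / 2) < e" by blast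
      then show "\<exists>x'\<in>of_real ` {0<..<1::real}. x' \<noteq> of_real (1/2) \<and> dist x' (of_real (1/2) :: complex) < e"
        by (intro bexI[of _ "of_real x"]) (simp_all only: dist_of_real of_real_eq_iff imageI not_False_eq_True simp_thms)
    qed
  qed (use unit z in auto)
qed

section \<open>Laplace transforms of integrable functions\<close>

text \<open>With v = ln |w| on the disk these transforms become Mellin transforms in the radius. For v \<le> 0 the
integrand is dominated by the density u throughout the closed right half-plane; this gives
boundedness and continuity up to the boundary, and holomorphy inside.\<close>

lemma laplace_integrand_le:
  assumes "v \<le> 0" "0 \<le> Re s"
  shows "cmod (c * exp (s * of_real v)) \<le> cmod c"
proof -
  have "Re s * v \<le> 0"
    using assms by (simp add: mult_nonneg_nonpos)
  then show ?thesis
    by (simp add: norm_mult mult_left_le)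
qed

lemma laplace_integrable:
  assumes u: "integrable M u" and v [measurable]: "v \<in> borel_measurable M"
    and v0: "\<And>w. w \<in> space M \<Longrightarrow> v w \<le> 0" and s: "0 \<le> Re s"
  shows "integrable M (\<lambda>w. u w * exp (s * complex_of_real (v w)))"
proof (rule Bochner_Integration.integrable_bound[OF u])
  have [measurable]: "u \<in> borel_measurable M" using u by auto
  have [measurable]: "exp \<in> borel_measurable (borel :: complex measure)"
    by (intro borel_measurable_continuous_onI continuous_intros)
  show "(\<lambda>w. u w * exp (s * complex_of_real (v w))) \<in> borel_measurable M"
    by measurable
  show "AE w in M. cmod (u w * exp (s * complex_of_real (v w))) \<le> cmod (u w)"
    by (intro AE_I2 laplace_integrand_le v0 s)
qed

lemma laplace_norm_le:
  assumes u: "integrable M u" and v: "v \<in> borel_measurable M"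
    and v0: "\<And>w. w \<in> space M \<Longrightarrow> v w \<le> 0" and s: "0 \<le> Re s"
  shows "cmod (\<integral>w. u w * exp (s * complex_of_real (v w)) \<partial>M) \<le> (\<integral>w. cmod (u w) \<partial>M)"
proof -
  have "cmod (\<integral>w. u w * exp (s * complex_of_real (v w)) \<partial>M) \<le>
      (\<integral>w. cmod (u w * exp (s * complex_of_real (v w))) \<partial>M)"
    by (rule integral_norm_bound)
  also have "\<dots> \<le> (\<integral>w. cmod (u w) \<partial>M)"
    by (rule integral_mono[OF integrable_norm[OF laplace_integrable[OF assms]] integrable_norm[OF u]])
      (assumption | rule laplace_integrand_le v0 s)+
  finally show ?thesis .
qed

lemma laplace_tendsto:
  assumes u: "integrable M u" and v: "v \<in> borel_measurable M"
    and v0: "\<And>w. w \<in> space M \<Longrightarrow> v w \<le> 0" and s: "\<And>i. 0 \<le> Re (s i)" and lim: "s \<longlonglongrightarrow> l"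
  shows "(\<lambda>i. \<integral>w. u w * exp (s i * complex_of_real (v w)) \<partial>M) \<longlonglongrightarrow> (\<integral>w. u w * exp (l * complex_of_real (v w)) \<partial>M)"
proof (rule integral_dominated_convergence[OF _ _ integrable_norm[OF u]])
  have l: "0 \<le> Re l"
    using tendsto_Re[OF lim] s by (intro LIMSEQ_le_const) auto
  show "(\<lambda>w. u w * exp (l * complex_of_real (v w))) \<in> borel_measurable M"
    "(\<lambda>w. u w * exp (s i * complex_of_real (v w))) \<in> borel_measurable M" for i
    using laplace_integrable[OF u v v0 l] laplace_integrable[OF u v v0 s[of i]] by auto
  show "AE w in M. (\<lambda>i. u w * exp (s i * complex_of_real (v w))) \<longlonglongrightarrow> u w * exp (l * complex_of_real (v w))"
    by (intro AE_I2 tendsto_intros lim)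
  show "AE w in M. cmod (u w * exp (s i * complex_of_real (v w))) \<le> cmod (u w)" for i
    by (intro AE_I2 laplace_integrand_le v0 s)
qed

text \<open>Around c the exponential is expanded in powers of s - c. The sum of the absolute values of the terms is
|u| exp (Re c v + |v| |s - c|), which is at most |u| as long as |s - c| < Re c; so on this disk summation and
integration can be interchanged, and the transform is a power series.\<close>

lemma laplace_holomorphic:
  assumes u: "integrable M u" and v [measurable]: "v \<in> borel_measurable M"
    and v0: "\<And>w. w \<in> space M \<Longrightarrow> v w \<le> 0"
  shows "(\<lambda>s. \<integral>w. u w * exp (s * complex_of_real (v w)) \<partial>M) holomorphic_on {s. 0 < Re s}"
    (is "?L holomorphic_on _")
proof -
  have [measurable]: "u \<in> borel_measurable M" using u by auto
  have [measurable]: "exp \<in> borel_measurable (borel :: complex measure)"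
    by (intro borel_measurable_continuous_onI continuous_intros)
  have ball: "?L holomorphic_on ball c (Re c)" if c: "0 < Re c" for c
  proof (rule power_series_holomorphic)
    fix s assume s: "s \<in> ball c (Re c)"
    define d where "d = cmod (s - c)"
    have d: "0 \<le> d" "d < Re c"
      using s by (simp_all add: d_def dist_norm norm_minus_commute)
    let ?f = "\<lambda>n w. u w * exp (c * of_real (v w)) * (of_real (v w) ^ n / of_nat (fact n)) * (s - c) ^ n"
    have exp_norm: "(\<lambda>n. norm (?f n w)) sums (cmod (u w) * exp (Re c * v w) * exp (\<bar>v w\<bar> * d))" for w
    proof -
      have "(\<lambda>n. (\<bar>v w\<bar> * d) ^ n /\<^sub>R fact n) sums exp (\<bar>v w\<bar> * d)"
        by (rule exp_converges)
      from sums_mult[OF this, of "cmod (u w) * exp (Re c * v w)"] show ?thesis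
        by (simp add: norm_mult norm_power norm_divide d_def power_mult_distrib field_simps)
    qed
    have total: "cmod (u w) * exp (Re c * v w) * exp (\<bar>v w\<bar> * d) \<le> cmod (u w)" if "w \<in> space M" for w
    proof -
      have "Re c * v w + \<bar>v w\<bar> * d = (Re c - d) * v w"
        using v0[OF that] by (simp add: algebra_simps)
      also have "\<dots> \<le> 0"
        using v0[OF that] d by (simp add: mult_nonneg_nonpos)
      finally have "exp (Re c * v w) * exp (\<bar>v w\<bar> * d) \<le> 1"
        by (simp flip: exp_add)
      then show ?thesis
        by (simp add: mult.assoc mult_left_le)
    qed
    have part: "(\<Sum>n<k. norm (?f n w)) \<le> cmod (u w)" if "w \<in> space M" for k w
      using sum_le_suminf[OF sums_summable[OF exp_norm[of w]], of "{..<k}"] sums_unique[OF exp_norm[of w]] total[OF that]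
      by simp
    have int: "integrable M (?f n)" for n
    proof (rule Bochner_Integration.integrable_bound[OF u])
      show "AE w in M. norm (?f n w) \<le> norm (u w)"
      proof (rule AE_I2)
        fix w assume w: "w \<in> space M"
        have "norm (?f n w) \<le> (\<Sum>n<Suc n. norm (?f n w))"
          unfolding sum.lessThan_Suc by (simp add: sum_nonneg)
        then show "norm (?f n w) \<le> norm (u w)"
          using part[OF w, of "Suc n"] by linarith
      qed
    qed measurable
    have "(\<lambda>n. integral\<^sup>L M (?f n)) sums (\<integral>w. (\<Sum>n. ?f n w) \<partial>M)"
    proof (rule sums_integral[OF int])
      show "AE w in M. summable (\<lambda>n. norm (?f n w))"
        using exp_norm by (auto simp: sums_iff)
      show "summable (\<lambda>n. \<integral>w. norm (?f n w) \<partial>M)"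
      proof (rule bounded_imp_summable)
        show "0 \<le> (\<integral>w. norm (?f n w) \<partial>M)" for n by simp
        fix n
        have "(\<Sum>k\<le>n. \<integral>w. norm (?f k w) \<partial>M) = (\<integral>w. (\<Sum>k\<le>n. norm (?f k w)) \<partial>M)"
          by (rule Bochner_Integration.integral_sum[symmetric]) (rule integrable_norm[OF int])
        also have "\<dots> \<le> (\<integral>w. norm (u w) \<partial>M)"
          by (rule integral_mono[OF Bochner_Integration.integrable_sum integrable_norm[OF u]])
            (use integrable_norm[OF int] part[of _ "Suc n"] lessThan_Suc_atMost in auto)
        finally show "(\<Sum>k\<le>n. \<integral>w. norm (?f k w) \<partial>M) \<le> (\<integral>w. norm (u w) \<partial>M)" .
      qed
    qed
    also have "(\<integral>w. (\<Sum>n. ?f n w) \<partial>M) = ?L s"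
    proof (intro Bochner_Integration.integral_cong refl)
      fix w
      have "(\<lambda>n. ((s - c) * of_real (v w)) ^ n /\<^sub>R fact n) sums exp ((s - c) * of_real (v w))"
        by (rule exp_converges)
      have "(\<lambda>n. ?f n w) sums (u w * exp (c * of_real (v w)) * exp ((s - c) * of_real (v w)))"
        using sums_mult[OF \<open>(\<lambda>n. ((s - c) * of_real (v w)) ^ n /\<^sub>R fact n) sums _\<close>, of "u w * exp (c * of_real (v w))"]
        by (simp add: scaleR_conv_of_real power_mult_distrib divide_inverse mult_ac)
      moreover have "u w * exp (c * of_real (v w)) * exp ((s - c) * of_real (v w)) = u w * exp (s * of_real (v w))"
        by (simp add: mult.assoc algebra_simps flip: exp_add)
      ultimately show "(\<Sum>n. ?f n w) = u w * exp (s * of_real (v w))"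
        by (simp add: sums_iff)
    qed
    also have "(\<lambda>n. integral\<^sup>L M (?f n)) =
        (\<lambda>n. (\<integral>w. u w * exp (c * of_real (v w)) * (of_real (v w) ^ n / of_nat (fact n)) \<partial>M) * (s - c) ^ n)"
      by (intro ext integral_mult_left_zero)
    finally show "(\<lambda>n. (\<integral>w. u w * exp (c * of_real (v w)) * (of_real (v w) ^ n / of_nat (fact n)) \<partial>M) * (s - c) ^ n) sums ?L s" .
  qed
  show ?thesis
  proof (rule holomorphic_onI)
    fix c assume "c \<in> {s. 0 < Re s}"
    then have "?L field_differentiable at c"
      using ball[of c] by (intro holomorphic_on_imp_differentiable_at[of _ "ball c (Re c)"]) auto
    then show "?L field_differentiable at c within {s. 0 < Re s}"
      by (rule field_differentiable_at_within)
  qed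
qed

section \<open>Polar coordinates and angular coefficients\<close>

text \<open>Fubini's theorem is applied to these Borel versions of the measure of the disk and of the normalized
measure of the circle. With all of the plane and of the real line as underlying spaces, every Borel
function of a point and an angle is measurable for their product.\<close>

definition disk_borel :: "complex measure" where
  "disk_borel = density lborel (\<lambda>z. ennreal (1 / pi * indicator (ball 0 1) z))"

definition angle_borel :: "real measure" where
  "angle_borel = density lborel (\<lambda>\<alpha>. ennreal (1 / (2 * pi) * indicator {0..<2 * pi} \<alpha>))"

lemma sets_disk_borel [measurable_cong, simp]: "sets disk_borel = sets borel"
  by (simp add: disk_borel_def)

lemma sets_angle_borel [measurable_cong, simp]: "sets angle_borel = sets borel"
  by (simp add: angle_borel_def)

lemma space_disk_borel [simp]: "space disk_borel = UNIV"
  by (simp add: disk_borel_def)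

lemma space_angle_borel [simp]: "space angle_borel = UNIV"
  by (simp add: angle_borel_def)

lemma nn_integral_disk_borel:
  assumes [measurable]: "F \<in> borel_measurable borel"
  shows "(\<integral>\<^sup>+z. F z \<partial>disk_borel) = (\<integral>\<^sup>+z. F z \<partial>disk_dA)"
proof -
  have "(\<integral>\<^sup>+z. F z \<partial>disk_borel) = (\<integral>\<^sup>+z. ennreal (1 / pi) * (F z * indicator (ball 0 1) z) \<partial>lborel)"
    unfolding disk_borel_def
    by (subst nn_integral_density) (auto intro!: nn_integral_cong simp: indicator_def)
  also have "\<dots> = ennreal (1 / pi) * (\<integral>\<^sup>+z. F z * indicator (ball 0 1) z \<partial>lborel)"
    by (rule nn_integral_cmult) (simp add: borel_measurable_times_ennreal borel_measurable_indicator)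
  finally show ?thesis
    by (simp only: nn_integral_disk_dA[OF assms])
qed

lemma disk_borel_eq_distr: "disk_borel = distr disk_dA borel (\<lambda>z. z)"
proof (rule measure_eqI)
  fix A assume "A \<in> sets disk_borel"
  then have A: "A \<in> sets borel" by simp
  have "emeasure disk_borel A = (\<integral>\<^sup>+z. indicator A z \<partial>disk_borel)"
    using A by simp
  also have "\<dots> = (\<integral>\<^sup>+z. indicator A z \<partial>disk_dA)"
    using A by (intro nn_integral_disk_borel) simp
  also have "\<dots> = emeasure (distr disk_dA borel (\<lambda>z. z)) A"
    using A by (simp flip: nn_integral_indicator add: nn_integral_distr)
  finally show "emeasure disk_borel A = emeasure (distr disk_dA borel (\<lambda>z. z)) A" .
qed simp

lemma finite_measure_disk_borel: "finite_measure disk_borel"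
  unfolding disk_borel_eq_distr by (rule disk_dA.finite_measure_distr) measurable

lemma nn_integral_angle_borel:
  assumes [measurable]: "F \<in> borel_measurable borel"
  shows "(\<integral>\<^sup>+\<alpha>. F \<alpha> \<partial>angle_borel) = ennreal (1 / (2 * pi)) * (\<integral>\<^sup>+\<alpha>. F \<alpha> * indicator {0..<2 * pi} \<alpha> \<partial>lborel)"
proof -
  have "(\<integral>\<^sup>+\<alpha>. F \<alpha> \<partial>angle_borel) = (\<integral>\<^sup>+\<alpha>. ennreal (1 / (2 * pi)) * (F \<alpha> * indicator {0..<2 * pi} \<alpha>) \<partial>lborel)"
    unfolding angle_borel_def
    by (subst nn_integral_density) (auto intro!: nn_integral_cong simp: indicator_def)
  then show ?thesis
    by (simp add: nn_integral_cmult)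
qed

lemma prob_angle_borel: "emeasure angle_borel UNIV = 1"
proof -
  have "emeasure angle_borel UNIV = (\<integral>\<^sup>+\<alpha>. 1 \<partial>angle_borel)"
    by simp
  also have "\<dots> = ennreal (1 / (2 * pi)) * ennreal (2 * pi)"
    by (subst nn_integral_angle_borel) simp_all
  also have "\<dots> = 1"
    by (subst ennreal_mult[symmetric]) simp_all
  finally show ?thesis .
qed

lemma finite_measure_angle_borel: "finite_measure angle_borel"
  by (rule finite_measureI) (simp add: prob_angle_borel)

lemma nn_integral_period_shift:
  fixes v :: "real \<Rightarrow> ennreal"
  assumes v [measurable]: "v \<in> borel_measurable borel" and per: "\<And>\<alpha>. v (\<alpha> + 2 * pi) = v \<alpha>"
    and t: "0 \<le> t" "t < 2 * pi"
  shows "(\<integral>\<^sup>+\<alpha>. v (\<alpha> + t) \<partial>angle_borel) = (\<integral>\<^sup>+\<alpha>. v \<alpha> \<partial>angle_borel)"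
proof -
  have "(\<integral>\<^sup>+\<alpha>. v (\<alpha> + t) * indicator {0..<2 * pi} \<alpha> \<partial>lborel) =
      (\<integral>\<^sup>+\<alpha>. v (\<alpha> + t) * indicator {t..<2 * pi + t} (\<alpha> + t) \<partial>lborel)"
    by (intro nn_integral_cong) (simp add: indicator_def)
  also have "\<dots> = (\<integral>\<^sup>+\<alpha>. v \<alpha> * indicator {t..<2 * pi + t} \<alpha> \<partial>lborel)"
    by (rule nn_integral_lborel_shift) measurable
  also have "\<dots> = (\<integral>\<^sup>+\<alpha>. v \<alpha> * indicator {t..<2 * pi} \<alpha> + v \<alpha> * indicator {2 * pi..<2 * pi + t} \<alpha> \<partial>lborel)"
    using t by (intro nn_integral_cong) (auto simp: indicator_def)
  also have "\<dots> = (\<integral>\<^sup>+\<alpha>. v \<alpha> * indicator {t..<2 * pi} \<alpha> \<partial>lborel) +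
      (\<integral>\<^sup>+\<alpha>. v \<alpha> * indicator {2 * pi..<2 * pi + t} \<alpha> \<partial>lborel)"
    by (rule nn_integral_add) measurable
  also have "(\<integral>\<^sup>+\<alpha>. v \<alpha> * indicator {2 * pi..<2 * pi + t} \<alpha> \<partial>lborel) =
      (\<integral>\<^sup>+\<alpha>. v (\<alpha> + 2 * pi) * indicator {2 * pi..<2 * pi + t} (\<alpha> + 2 * pi) \<partial>lborel)"
    by (rule nn_integral_lborel_shift[symmetric]) measurable
  also have "\<dots> = (\<integral>\<^sup>+\<alpha>. v \<alpha> * indicator {0..<t} \<alpha> \<partial>lborel)"
    by (intro nn_integral_cong) (simp add: indicator_def per)
  also have "(\<integral>\<^sup>+\<alpha>. v \<alpha> * indicator {t..<2 * pi} \<alpha> \<partial>lborel) + (\<integral>\<^sup>+\<alpha>. v \<alpha> * indicator {0..<t} \<alpha> \<partial>lborel) =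
      (\<integral>\<^sup>+\<alpha>. v \<alpha> * indicator {t..<2 * pi} \<alpha> + v \<alpha> * indicator {0..<t} \<alpha> \<partial>lborel)"
    by (rule nn_integral_add[symmetric]) measurable
  also have "\<dots> = (\<integral>\<^sup>+\<alpha>. v \<alpha> * indicator {0..<2 * pi} \<alpha> \<partial>lborel)"
    using t by (intro nn_integral_cong) (auto simp: indicator_def)
  finally show ?thesis
    by (simp add: nn_integral_angle_borel)
qed

lemma measurable_cis [measurable]: "cis \<in> borel_measurable borel"
  by (intro borel_measurable_continuous_onI continuous_intros)

lemma measurable_polar [measurable]:
  "(\<lambda>(z, \<alpha>). of_real (cmod z) * cis \<alpha>) \<in> borel_measurable (disk_borel \<Otimes>\<^sub>M angle_borel)"
  by measurable

text \<open>Polar coordinates, in the form that a random point of the disk keeps its distribution when its angle is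
replaced by an independent uniform one. The measure is invariant under each rotation, hence under a
random one, and rotating z by a uniform angle produces the same distribution on the circle of radius |z|
as forgetting the angle of z altogether.\<close>

lemma disk_borel_polar:
  "disk_borel = distr (disk_borel \<Otimes>\<^sub>M angle_borel) borel (\<lambda>(z, \<alpha>). of_real (cmod z) * cis \<alpha>)"
proof (rule measure_eqI)
  interpret D: finite_measure disk_borel by (rule finite_measure_disk_borel)
  interpret C: finite_measure angle_borel by (rule finite_measure_angle_borel)
  interpret DC: pair_sigma_finite disk_borel angle_borel ..
  fix A assume "A \<in> sets disk_borel"
  then have A [measurable]: "A \<in> sets borel" by simp
  let ?F = "indicator A :: complex \<Rightarrow> ennreal"
  have "emeasure (distr (disk_borel \<Otimes>\<^sub>M angle_borel) borel (\<lambda>(z, \<alpha>). of_real (cmod z) * cis \<alpha>)) A =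
      (\<integral>\<^sup>+x. ?F (of_real (cmod (fst x)) * cis (snd x)) \<partial>(disk_borel \<Otimes>\<^sub>M angle_borel))"
    by (simp flip: nn_integral_indicator add: nn_integral_distr case_prod_beta')
  also have "\<dots> = (\<integral>\<^sup>+z. \<integral>\<^sup>+\<alpha>. ?F (of_real (cmod z) * cis \<alpha>) \<partial>angle_borel \<partial>disk_borel)"
    by (subst C.nn_integral_fst[symmetric]) simp_all
  also have "\<dots> = (\<integral>\<^sup>+z. \<integral>\<^sup>+\<alpha>. ?F (cis \<alpha> * z) \<partial>angle_borel \<partial>disk_borel)"
  proof (rule nn_integral_cong)
    fix z
    define t where "t = Arg2pi z"
    have z: "cis \<alpha> * z = of_real (cmod z) * cis (\<alpha> + t)" for \<alpha>
      using Arg2pi_eq[of z] by (simp add: t_def cis_conv_exp[symmetric] flip: cis_mult)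
    show "(\<integral>\<^sup>+\<alpha>. ?F (of_real (cmod z) * cis \<alpha>) \<partial>angle_borel) = (\<integral>\<^sup>+\<alpha>. ?F (cis \<alpha> * z) \<partial>angle_borel)"
      unfolding z
      by (rule nn_integral_period_shift[symmetric])
        (use Arg2pi[of z] in \<open>auto simp: t_def simp flip: cis_mult\<close>)
  qed
  also have "\<dots> = (\<integral>\<^sup>+\<alpha>. \<integral>\<^sup>+z. ?F (cis \<alpha> * z) \<partial>disk_borel \<partial>angle_borel)"
    by (rule DC.Fubini'[symmetric]) simp
  also have "\<dots> = (\<integral>\<^sup>+\<alpha>. (\<integral>\<^sup>+z. ?F z \<partial>disk_borel) \<partial>angle_borel)"
  proof (rule nn_integral_cong_AE)
    \<comment> \<open>the half-turn, excluded from the rotation lemma, is a null set of angles\<close>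
    have "AE \<alpha> in lborel. \<alpha> \<noteq> pi"
      by (rule AE_lborel_singleton)
    then have "AE \<alpha> in angle_borel. \<alpha> \<in> {0..<2 * pi} \<and> \<alpha> \<noteq> pi"
      unfolding angle_borel_def by (subst AE_density) (auto simp: indicator_def elim!: eventually_mono)
    then show "AE \<alpha> in angle_borel. (\<integral>\<^sup>+z. ?F (cis \<alpha> * z) \<partial>disk_borel) = (\<integral>\<^sup>+z. ?F z \<partial>disk_borel)"
    proof eventually_elim
      case (elim \<alpha>)
      have "cis \<alpha> \<noteq> - 1"
      proof
        assume "cis \<alpha> = - 1"
        then have "cos \<alpha> = - 1" by (simp add: complex_eq_iff)
        then obtain k :: int where "\<alpha> = (2 * of_int k + 1) * pi"
          using cos_eq_minus1[of \<alpha>] by (auto simp: algebra_simps)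
        moreover from this elim have "0 * pi \<le> (2 * real_of_int k + 1) * pi" "(2 * real_of_int k + 1) * pi < 2 * pi"
          by auto
        then have "0 \<le> 2 * real_of_int k + 1" "2 * real_of_int k + 1 < 2"
          using mult_le_cancel_right_pos[OF pi_gt_zero] mult_less_cancel_right_pos[OF pi_gt_zero] by blast+
        then have "k = 0" by linarith
        ultimately show False using elim by simp
      qed
      then have "(\<integral>\<^sup>+z. ?F (cis \<alpha> * z) \<partial>disk_dA) = (\<integral>\<^sup>+z. ?F z \<partial>disk_dA)"
        by (intro nn_integral_disk_dA_rotate) auto
      moreover have "(\<lambda>z. ?F (cis \<alpha> * z)) \<in> borel_measurable borel" "?F \<in> borel_measurable borel"
        by simp_all
      ultimately show ?case
        by (simp only: nn_integral_disk_borel)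
    qed
  qed
  also have "\<dots> = emeasure disk_borel A"
    by (simp add: prob_angle_borel)
  finally show "emeasure disk_borel A =
      emeasure (distr (disk_borel \<Otimes>\<^sub>M angle_borel) borel (\<lambda>(z, \<alpha>). of_real (cmod z) * cis \<alpha>)) A" ..
qed simp

text \<open>Needed because an integrable function on the disk is only Lebesgue measurable, so its composition with
polar coordinates need not be measurable for the product measure.\<close>

lemma disk_dA_borel_representative:
  assumes f: "f \<in> borel_measurable disk_dA"
  obtains f' :: "complex \<Rightarrow> complex" where "f' \<in> borel_measurable borel" "AE z in lborel. z \<in> ball 0 1 \<longrightarrow> f z = f' z"
proof -
  have "f \<in> borel_measurable (lebesgue_on (ball 0 1))"
    using f by (simp add: disk_dA_def)
  then have m: "(\<lambda>z. indicator (ball 0 1) z *\<^sub>R f z) \<in> borel_measurable lebesgue"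
    by (subst (asm) borel_measurable_restrict_space_iff) (simp_all add: mult.commute)
  have "(\<lambda>z. Re (indicator (ball 0 1) z *\<^sub>R f z)) \<in> borel_measurable lebesgue"
    "(\<lambda>z. Im (indicator (ball 0 1) z *\<^sub>R f z)) \<in> borel_measurable lebesgue"
    using m by measurable
  then obtain p q where pq [measurable]: "p \<in> borel_measurable lborel" "q \<in> borel_measurable lborel"
    and ae: "AE z in lborel. Re (indicator (ball 0 1) z *\<^sub>R f z) = p z"
      "AE z in lborel. Im (indicator (ball 0 1) z *\<^sub>R f z) = q z"
    using completion_ex_borel_measurable_real by blast
  show thesis
  proof
    show "(\<lambda>z. Complex (p z) (q z)) \<in> borel_measurable borel"
      unfolding Complex_eq using pq by measurable
    show "AE z in lborel. z \<in> ball 0 1 \<longrightarrow> f z = Complex (p z) (q z)"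
      using ae by eventually_elim (auto simp: complex_eq_iff)
  qed
qed

text \<open>In polar coordinates the integral over each circle is r ^ (p + q) times the angular coefficient of index
q - p. The difficulty is one of null sets: the equality with a Borel representative and the vanishing of the coefficient
hold almost everywhere on the disk and on [0,1), and have to be transported to almost every circle.\<close>

lemma angular_coeff_orthogonal:
  assumes f: "integrable disk_dA f"
    and zero: "AE r in lebesgue_on {0..<1}. angular_coeff f (int q - int p) r = 0"
  shows "(\<integral>z. f z * (z ^ p * cnj z ^ q) \<partial>disk_dA) = 0"
proof -
  interpret D: finite_measure disk_borel by (rule finite_measure_disk_borel)
  interpret C: finite_measure angle_borel by (rule finite_measure_angle_borel)
  interpret DC: pair_sigma_finite disk_borel angle_borel ..
  have fm [measurable]: "f \<in> borel_measurable disk_dA" using f by auto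
  obtain f' where f' [measurable]: "f' \<in> borel_measurable borel"
    and ff': "AE z in lborel. z \<in> ball 0 1 \<longrightarrow> f z = f' z"
    by (rule disk_dA_borel_representative[OF fm])
  have ffA: "AE z in disk_dA. f z = f' z"
    unfolding disk_dA_def using ff'
    by (subst AE_density) (auto simp: AE_restrict_space_iff AE_completion)
  define m where "m z = z ^ p * cnj z ^ q" for z :: complex
  have m [measurable]: "m \<in> borel_measurable borel"
    unfolding m_def[abs_def] by (intro borel_measurable_continuous_onI continuous_intros)
  have mA [measurable]: "m \<in> borel_measurable disk_dA"
    by (rule borel_measurable_disk_dA[OF m])
  have f'A [measurable]: "f' \<in> borel_measurable disk_dA"
    by (rule borel_measurable_disk_dA[OF f'])
  have "integrable disk_dA (\<lambda>z. f' z * m z)"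
  proof (rule Bochner_Integration.integrable_bound[OF f])
    show "AE z in disk_dA. norm (f' z * m z) \<le> norm (f z)"
      using ffA AE_space
    proof eventually_elim
      case (elim z)
      then have "cmod z ^ p * cmod z ^ q \<le> 1"
        by (intro mult_le_one power_le_one) auto
      then show ?case
        using elim by (simp add: m_def norm_mult norm_power mult_left_le)
    qed
  qed measurable
  then have "integrable disk_borel (\<lambda>z. f' z * m z)"
    unfolding disk_borel_eq_distr by (subst integrable_distr_eq) auto
  then have int: "integrable (disk_borel \<Otimes>\<^sub>M angle_borel)
      (\<lambda>(z, \<alpha>). f' (of_real (cmod z) * cis \<alpha>) * m (of_real (cmod z) * cis \<alpha>))"
    by (subst (asm) disk_borel_polar, subst (asm) integrable_distr_eq) (auto simp: case_prod_beta')
  have "(\<integral>z. f z * m z \<partial>disk_dA) = (\<integral>z. f' z * m z \<partial>disk_dA)"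
    using ffA by (intro integral_cong_AE) (auto elim!: eventually_mono)
  also have "\<dots> = (\<integral>z. f' z * m z \<partial>disk_borel)"
    unfolding disk_borel_eq_distr by (subst integral_distr) auto
  also have "\<dots> = (\<integral>x. (\<lambda>(z, \<alpha>). f' (of_real (cmod z) * cis \<alpha>) * m (of_real (cmod z) * cis \<alpha>)) x \<partial>(disk_borel \<Otimes>\<^sub>M angle_borel))"
    by (subst disk_borel_polar, subst integral_distr) (auto simp: case_prod_beta')
  also have "\<dots> = (\<integral>z. \<integral>\<alpha>. f' (of_real (cmod z) * cis \<alpha>) * m (of_real (cmod z) * cis \<alpha>) \<partial>angle_borel \<partial>disk_borel)"
    using DC.integral_fst'[OF int] by simp
  also have "\<dots> = (\<integral>z. 0 \<partial>disk_borel)"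
  proof (rule integral_cong_AE)
    have "AE z in disk_borel. z \<in> ball 0 1 \<and> f z = f' z"
      unfolding disk_borel_def using ff' by (subst AE_density) (auto simp: indicator_def elim!: eventually_mono)
    then have "AE x in disk_borel \<Otimes>\<^sub>M angle_borel. of_real (cmod (fst x)) * cis (snd x) \<in> ball 0 1 \<and>
        f (of_real (cmod (fst x)) * cis (snd x)) = f' (of_real (cmod (fst x)) * cis (snd x))"
      by (subst (asm) disk_borel_polar) (drule AE_distrD[rotated], auto simp: case_prod_beta')
    from DC.AE_pair[OF this]
    have 1: "AE z in disk_borel. AE \<alpha> in angle_borel. f (of_real (cmod z) * cis \<alpha>) = f' (of_real (cmod z) * cis \<alpha>)"
      by (auto elim!: eventually_mono)
    have "AE r in lborel. r \<in> {0..<1} \<longrightarrow> angular_coeff f (int q - int p) r = 0"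
      using zero by (subst (asm) AE_restrict_space_iff) (auto simp: AE_completion_iff)
    then have "AE r in distr disk_dA borel cmod. r \<in> {0..<1} \<longrightarrow> angular_coeff f (int q - int p) r = 0"
      unfolding distr_disk_dA_norm by (subst AE_density) auto
    moreover have "distr disk_dA borel cmod = distr disk_borel borel cmod"
      unfolding disk_borel_eq_distr by (subst distr_distr) (auto simp: o_def)
    ultimately have ad: "AE r in distr disk_borel borel cmod. r \<in> {0..<1} \<longrightarrow> angular_coeff f (int q - int p) r = 0"
      by (simp only:)
    have 2: "AE z in disk_borel. cmod z \<in> {0..<1} \<longrightarrow> angular_coeff f (int q - int p) (cmod z) = 0"
      by (rule AE_distrD[OF _ ad]) (simp add: measurable_cong_sets[OF sets_disk_borel refl])
    have 3: "AE z in disk_borel. cmod z < 1"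
      unfolding disk_borel_def by (subst AE_density) (auto simp: indicator_def)
    show "AE z in disk_borel. (\<integral>\<alpha>. f' (of_real (cmod z) * cis \<alpha>) * m (of_real (cmod z) * cis \<alpha>) \<partial>angle_borel) = 0"
      using 1 2 3
    proof eventually_elim
      case (elim z)
      define r where "r = cmod z"
      define n where "n = int q - int p"
      have ac: "angular_coeff f n r = 0"
        using elim by (simp add: r_def n_def)
      have mr: "m (of_real r * cis \<alpha>) = of_real (r ^ (p + q)) * cis (- of_int n * \<alpha>)" for \<alpha>
      proof -
        have "cis (- of_int n * \<alpha>) = cis (real p * \<alpha>) * cis (- (real q * \<alpha>))"
          by (simp add: n_def cis_mult algebra_simps)
        then show ?thesis
          by (simp add: m_def power_mult_distrib power_add Complex.DeMoivre cis_cnj)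
      qed
      have ae: "AE \<alpha> in lborel. \<alpha> \<in> {0..<2 * pi} \<longrightarrow> f (of_real r * cis \<alpha>) = f' (of_real r * cis \<alpha>)"
        using elim(1) unfolding angle_borel_def r_def
        by (subst (asm) AE_density) (auto simp: indicator_def elim!: eventually_mono)
      define h where "h \<alpha> = indicator {0..<2 * pi} \<alpha> *\<^sub>R (f' (of_real r * cis \<alpha>) * cis (- of_int n * \<alpha>))" for \<alpha>
      have hm [measurable]: "h \<in> borel_measurable borel"
        unfolding h_def[abs_def] by measurable
      have ae2: "AE \<alpha> in lebesgue. h \<alpha> = indicator {0..2 * pi} \<alpha> *\<^sub>R (f (of_real r * cis \<alpha>) * cis (- of_int n * \<alpha>))"
        using AE_completion[OF ae] AE_completion[OF AE_lborel_singleton[of "2 * pi"]]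
        by eventually_elim (auto simp: h_def indicator_def)
      have hl: "h \<in> borel_measurable lebesgue"
        by (rule measurable_completion) simp
      have "(LINT \<theta>:{0..2*pi}|lebesgue. f (of_real r * cis \<theta>) * cis (- of_int n * \<theta>)) = (\<integral>\<alpha>. h \<alpha> \<partial>lebesgue)"
        unfolding set_lebesgue_integral_def
        using borel_measurable_AE[OF hl ae2] hl ae2 by (intro integral_cong_AE) (auto elim!: eventually_mono)
      also have "\<dots> = (\<integral>\<alpha>. h \<alpha> \<partial>lborel)"
        by (rule integral_completion) simp
      finally have h0: "(\<integral>\<alpha>. h \<alpha> \<partial>lborel) = 0"
        using ac by (simp add: angular_coeff_def)
      have "(\<integral>\<alpha>. f' (of_real r * cis \<alpha>) * m (of_real r * cis \<alpha>) \<partial>angle_borel) =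
          (\<integral>\<alpha>. (1 / (2 * pi) * indicator {0..<2 * pi} \<alpha>) *\<^sub>R (f' (of_real r * cis \<alpha>) * m (of_real r * cis \<alpha>)) \<partial>lborel)"
        unfolding angle_borel_def by (rule integral_density) auto
      also have "\<dots> = (\<integral>\<alpha>. (of_real (1 / (2 * pi)) * of_real (r ^ (p + q))) * h \<alpha> \<partial>lborel)"
        by (intro Bochner_Integration.integral_cong refl) (simp add: mr h_def scaleR_conv_of_real)
      also have "\<dots> = 0"
        by (simp only: integral_mult_right_zero h0 mult_zero_right)
      finally show ?case by (simp add: r_def)
    qed
  qed (use DC.integrable_fst'[OF int] in auto)
  finally show ?thesis by (simp add: m_def)
qed

section \<open>Polynomials in the Bergman space\<close>

abbreviation disk_monomial :: "nat \<Rightarrow> complex \<Rightarrow> complex" where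
  "disk_monomial k \<equiv> disk_restrict (\<lambda>z. z ^ k)"

text \<open>For h in the Bergman space, (n + 1) times the n-th moment is the n-th Taylor coefficient of h. Moments are the
coordinates used throughout, because those of a projection P u are those of u itself.\<close>

definition moment :: "(complex \<Rightarrow> complex) \<Rightarrow> nat \<Rightarrow> complex" where
  "moment u m = disk_inner u (\<lambda>w. w ^ m)"

lemma powser_coeffs_unique:
  fixes b c :: "nat \<Rightarrow> complex"
  assumes "\<And>z. z \<in> ball 0 1 \<Longrightarrow> (\<lambda>n. b n * z ^ n) sums h z"
    and "\<And>z. z \<in> ball 0 1 \<Longrightarrow> (\<lambda>n. c n * z ^ n) sums h z"
  shows "b = c"
proof -
  have "h has_fps_expansion Abs_fps d" if "\<And>z. z \<in> ball 0 1 \<Longrightarrow> (\<lambda>n. d n * z ^ n) sums h z" for d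
    by (rule has_fps_expansionI, rule eventually_nhds_in_open[of "ball 0 1" 0, THEN eventually_mono])
      (use that in auto)
  then have "Abs_fps b = Abs_fps c"
    using assms fps_expansion_unique_complex by blast
  then show ?thesis
    by (metis ext fps_nth_Abs_fps)
qed

lemma moment_bergman_powser:
  assumes h: "h \<in> bergman_space" and b: "\<And>z. z \<in> ball 0 1 \<Longrightarrow> (\<lambda>n. b n * z ^ n) sums h z"
  shows "moment h n = b n / of_nat (Suc n)"
proof -
  have "b = (\<lambda>n. of_nat (Suc n) * moment h n)"
    by (rule powser_coeffs_unique[OF b]) (use bergman_sums[OF h] in \<open>simp_all add: moment_def\<close>)
  then show ?thesis by (simp del: of_nat_Suc)
qed

text \<open>Pairing with a power of z does not see the projection, even if the argument is merely integrable and the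
projection is defined by the Bergman kernel only.\<close>

lemma moment_bergman_proj:
  assumes u: "integrable disk_dA u" and P: "bergman_proj u \<in> bergman_space"
  shows "moment (bergman_proj u) n = moment u n"
  using moment_bergman_powser[OF P, of "\<lambda>n. of_nat (Suc n) * moment u n" n] bergman_proj_sums[OF u]
  by (simp add: moment_def del: of_nat_Suc)

lemma disk_monomial_poly: "disk_monomial k = disk_restrict (poly (monom 1 k))"
  by (simp add: disk_restrict_def poly_monom fun_eq_iff)

lemma disk_monomial_bergman: "disk_monomial k \<in> bergman_space"
  unfolding disk_monomial_poly by (rule bergman_space_poly)

lemma moment_cong: "(\<And>z. z \<in> ball 0 1 \<Longrightarrow> u z = v z) \<Longrightarrow> moment u m = moment v m"
  unfolding moment_def by (rule disk_inner_cong) auto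

lemma moment_disk_monomial: "moment (disk_monomial k) m = (if m = k then 1 / of_nat (Suc k) else 0)"
proof -
  have "moment (disk_monomial k) m = moment (\<lambda>z. z ^ k) m"
    by (rule moment_cong) (simp add: disk_restrict_def)
  then show ?thesis
    by (auto simp: moment_def disk_inner_powers)
qed

lemma bergman_space_combination:
  assumes "h \<in> bergman_space" "k \<in> bergman_space"
  shows "(\<lambda>z. c * h z + d * k z) \<in> bergman_space"
  using bergman_spaceD[OF assms(1)] bergman_spaceD[OF assms(2)]
  by (auto simp: bergman_space_def intro!: disk_L2_combination holomorphic_intros)

lemma bergman_space_zero: "(\<lambda>z. 0) \<in> bergman_space"
  using bergman_space_combination[OF disk_monomial_bergman disk_monomial_bergman, of 0 0 0 0] by simp

lemma bergman_space_sum: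
  assumes "finite I" "\<And>i. i \<in> I \<Longrightarrow> h i \<in> bergman_space"
  shows "(\<lambda>z. \<Sum>i\<in>I. c i * h i z) \<in> bergman_space"
  using assms
proof (induction I rule: finite_induct)
  case (insert i I)
  then show ?case
    using bergman_space_combination[of "h i" "\<lambda>z. \<Sum>i\<in>I. c i * h i z" "c i" 1] by simp
qed (simp add: bergman_space_zero)

lemma moment_combination:
  assumes "h \<in> disk_L2" "k \<in> disk_L2"
  shows "moment (\<lambda>z. c * h z + d * k z) m = c * moment h m + d * moment k m"
proof -
  have "moment (\<lambda>z. c * h z + d * k z) m = (\<integral>z. c * (h z * cnj (z ^ m)) + d * (k z * cnj (z ^ m)) \<partial>disk_dA)"
    unfolding moment_def disk_inner_def
    by (intro Bochner_Integration.integral_cong refl) (simp add: algebra_simps)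
  also have "\<dots> = (\<integral>z. c * (h z * cnj (z ^ m)) \<partial>disk_dA) + (\<integral>z. d * (k z * cnj (z ^ m)) \<partial>disk_dA)"
    by (intro Bochner_Integration.integral_add integrable_mult_right disk_L2_integrable_inner assms disk_L2_power)
  finally show ?thesis
    by (simp add: moment_def disk_inner_def)
qed

lemma moment_zero: "moment (\<lambda>z. 0) m = 0"
  by (simp add: moment_def disk_inner_def)

lemma moment_sum:
  assumes "finite I" "\<And>i. i \<in> I \<Longrightarrow> h i \<in> bergman_space"
  shows "moment (\<lambda>z. \<Sum>i\<in>I. c i * h i z) m = (\<Sum>i\<in>I. c i * moment (h i) m)"
  using assms
proof (induction I rule: finite_induct)
  case (insert i I)
  have "moment (\<lambda>z. c i * h i z + 1 * (\<Sum>i\<in>I. c i * h i z)) m =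
      c i * moment (h i) m + 1 * moment (\<lambda>z. \<Sum>i\<in>I. c i * h i z) m"
    by (rule moment_combination) (use insert in \<open>auto intro!: bergman_spaceD(1) bergman_space_sum\<close>)
  then show ?case using insert by simp
qed (simp add: moment_zero)

lemma bergman_eqI:
  assumes "h \<in> bergman_space" "k \<in> bergman_space" "\<And>m. moment h m = moment k m"
  shows "h = k"
  using assms bergman_space_eqI by (simp add: moment_def)

text \<open>The degree bound is expressed by moments, which is the form in which it is obtained from the
symbols.\<close>

definition poly_space :: "nat \<Rightarrow> (complex \<Rightarrow> complex) set" where
  "poly_space M = {h \<in> bergman_space. \<forall>m>M. moment h m = 0}"

lemma poly_space_expansion:
  assumes "h \<in> poly_space M"
  shows "h = (\<lambda>z. \<Sum>k\<le>M. (of_nat (Suc k) * moment h k) * disk_monomial k z)"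
proof (rule bergman_eqI)
  show "h \<in> bergman_space" using assms by (simp add: poly_space_def)
  show "(\<lambda>z. \<Sum>k\<le>M. (of_nat (Suc k) * moment h k) * disk_monomial k z) \<in> bergman_space"
    by (intro bergman_space_sum disk_monomial_bergman) simp
  fix m
  have "moment (\<lambda>z. \<Sum>k\<le>M. (of_nat (Suc k) * moment h k) * disk_monomial k z) m =
      (\<Sum>k\<le>M. (of_nat (Suc k) * moment h k) * (if m = k then 1 / of_nat (Suc k) else 0))"
    unfolding moment_disk_monomial[symmetric]
    by (intro moment_sum disk_monomial_bergman) simp
  also have "\<dots> = (\<Sum>k\<le>M. if m = k then moment h k else 0)"
    by (intro sum.cong) (auto simp del: of_nat_Suc)
  also have "\<dots> = moment h m"
    using assms by (simp add: poly_space_def)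
  finally show "moment h m = moment (\<lambda>z. \<Sum>k\<le>M. (of_nat (Suc k) * moment h k) * disk_monomial k z) m" ..
qed

lemma poly_spaceD: "h \<in> poly_space M \<Longrightarrow> h \<in> bergman_space" "h \<in> poly_space M \<Longrightarrow> M < m \<Longrightarrow> moment h m = 0"
  by (auto simp: poly_space_def)

lemma disk_monomial_poly_space: "k \<le> M \<Longrightarrow> disk_monomial k \<in> poly_space M"
  by (auto simp: poly_space_def disk_monomial_bergman moment_disk_monomial)

text \<open>Boundedness is left out, so that the algebraic part of the argument applies to all powers of an operator and
to their combinations without norm estimates.\<close>

definition bergman_linear :: "((complex \<Rightarrow> complex) \<Rightarrow> (complex \<Rightarrow> complex)) \<Rightarrow> bool" where
  "bergman_linear T \<longleftrightarrow> T \<in> bergman_space \<rightarrow> bergman_space \<and>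
     (\<forall>h\<in>bergman_space. \<forall>k\<in>bergman_space. \<forall>c d.
        T (\<lambda>z. c * h z + d * k z) = (\<lambda>z. c * T h z + d * T k z))"

lemma bergman_linear_in: "bergman_linear T \<Longrightarrow> h \<in> bergman_space \<Longrightarrow> T h \<in> bergman_space"
  by (auto simp: bergman_linear_def)

lemma bergman_linearD:
  "bergman_linear T \<Longrightarrow> h \<in> bergman_space \<Longrightarrow> k \<in> bergman_space \<Longrightarrow>
    T (\<lambda>z. c * h z + d * k z) = (\<lambda>z. c * T h z + d * T k z)"
  by (simp add: bergman_linear_def)

lemma bergman_linear_zero:
  assumes "bergman_linear T" shows "T (\<lambda>z. 0) = (\<lambda>z. 0)"
  using bergman_linearD[OF assms bergman_space_zero bergman_space_zero, of 0 0] by simp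

lemma bergman_linear_sum:
  assumes T: "bergman_linear T" and "finite I" "\<And>i. i \<in> I \<Longrightarrow> h i \<in> bergman_space"
  shows "T (\<lambda>z. \<Sum>i\<in>I. c i * h i z) = (\<lambda>z. \<Sum>i\<in>I. c i * T (h i) z)"
  using assms(2,3)
proof (induction I rule: finite_induct)
  case (insert i I)
  have "h i \<in> bergman_space" "(\<lambda>z. \<Sum>i\<in>I. c i * h i z) \<in> bergman_space"
    using insert by (auto intro: bergman_space_sum)
  from bergman_linearD[OF T this, of "c i" 1] show ?case
    using insert by simp
qed (simp add: bergman_linear_zero[OF T])

lemma bergman_linear_funpow:
  assumes "bergman_linear T" shows "bergman_linear (T ^^ j)"
proof (induction j)
  case (Suc j)
  show ?case
    unfolding bergman_linear_def
  proof (intro conjI funcsetI ballI allI)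
    show "(T ^^ Suc j) h \<in> bergman_space" if "h \<in> bergman_space" for h
      using bergman_linear_in[OF assms] bergman_linear_in[OF Suc] that by simp
    fix h k c d assume hk: "h \<in> bergman_space" "k \<in> bergman_space"
    show "(T ^^ Suc j) (\<lambda>z. c * h z + d * k z) = (\<lambda>z. c * (T ^^ Suc j) h z + d * (T ^^ Suc j) k z)"
      using bergman_linearD[OF assms bergman_linear_in[OF Suc hk(1)] bergman_linear_in[OF Suc hk(2)], of c d]
        bergman_linearD[OF Suc hk, of c d] by simp
  qed
qed (auto simp: bergman_linear_def)

lemma bergman_linear_combination:
  assumes "bergman_linear S" "bergman_linear T"
  shows "bergman_linear (\<lambda>h z. a * S h z + b * T h z)"
  unfolding bergman_linear_def
proof (intro conjI funcsetI ballI allI)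
  show "(\<lambda>z. a * S h z + b * T h z) \<in> bergman_space" if "h \<in> bergman_space" for h
    by (rule bergman_space_combination[OF bergman_linear_in[OF assms(1) that] bergman_linear_in[OF assms(2) that]])
  fix h k c d assume hk: "h \<in> bergman_space" "k \<in> bergman_space"
  show "(\<lambda>z. a * S (\<lambda>z. c * h z + d * k z) z + b * T (\<lambda>z. c * h z + d * k z) z) =
      (\<lambda>z. c * (a * S h z + b * T h z) + d * (a * S k z + b * T k z))"
    unfolding bergman_linearD[OF assms(1) hk] bergman_linearD[OF assms(2) hk] by (simp add: algebra_simps)
qed

lemma bergman_linear_powers_sum:
  assumes T: "bergman_linear T"
  shows "bergman_linear (\<lambda>h z. \<Sum>j\<le>N. c j * (T ^^ j) h z)"
proof (induction N)
  case 0
  show ?case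
    using bergman_linear_combination[OF bergman_linear_funpow[OF T, of 0] bergman_linear_funpow[OF T, of 0], of "c 0" 0]
    by simp
next
  case (Suc N)
  show ?case
    using bergman_linear_combination[OF Suc bergman_linear_funpow[OF T, of "Suc N"], of 1 "c (Suc N)"]
    by simp
qed

text \<open>If S raises degrees by exactly one, then 1 is a cyclic vector for S on the polynomials: z ^ (k + 1) is a
multiple of S (z ^ k) up to lower degrees. So an operator X that commutes with S and kills 1 kills all
polynomials, one degree at a time.\<close>

lemma cyclic_annihilator:
  assumes X: "bergman_linear X" and S: "bergman_linear S"
    and deg: "\<And>k. S (disk_monomial k) \<in> poly_space (Suc k)"
    and top: "\<And>k. moment (S (disk_monomial k)) (Suc k) \<noteq> 0"
    and comm: "\<And>k. X (S (disk_monomial k)) = S (X (disk_monomial k))"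
    and one: "X (disk_monomial 0) = (\<lambda>z. 0)"
  shows "X (disk_monomial k) = (\<lambda>z. 0)"
proof (induction k rule: less_induct)
  case (less k)
  show ?case
  proof (cases k)
    case 0
    then show ?thesis using one by simp
  next
    case (Suc i)
    define d where "d j = of_nat (Suc j) * moment (S (disk_monomial i)) j" for j
    have "(\<lambda>z. 0) = S (X (disk_monomial i))"
      using less[of i] Suc bergman_linear_zero[OF S] by simp
    also have "\<dots> = X (S (disk_monomial i))"
      by (rule comm[symmetric])
    also have "S (disk_monomial i) = (\<lambda>z. \<Sum>j\<le>Suc i. d j * disk_monomial j z)"
      unfolding d_def by (rule poly_space_expansion[OF deg])
    also have "X \<dots> = (\<lambda>z. \<Sum>j\<le>Suc i. d j * X (disk_monomial j) z)"
      by (rule bergman_linear_sum[OF X]) (auto intro: disk_monomial_bergman)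
    also have "\<dots> = (\<lambda>z. d (Suc i) * X (disk_monomial k) z)"
      using less Suc by (simp add: fun_eq_iff)
    finally have "(\<lambda>z. 0) = (\<lambda>z. d (Suc i) * X (disk_monomial k) z)" .
    then have "d (Suc i) * X (disk_monomial k) z = 0" for z
      by (auto simp: fun_eq_iff)
    moreover have "d (Suc i) \<noteq> 0"
      using top[of i] by (simp add: d_def del: of_nat_Suc)
    ultimately show ?thesis by auto
  qed
qed

lemma cyclic_span:
  assumes deg: "\<And>j. u j \<in> poly_space j" and top: "\<And>j. moment (u j) j \<noteq> 0"
    and h: "h \<in> poly_space N"
  shows "\<exists>c. h = (\<lambda>z. \<Sum>j\<le>N. c j * u j z)"
  using h
proof (induction N arbitrary: h)
  case 0
  define c where "c = moment h 0 / moment (u 0) 0"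
  have "h = (\<lambda>z. c * u 0 z + 0 * u 0 z)"
  proof (rule bergman_eqI)
    show "h \<in> bergman_space" by (rule poly_spaceD(1)[OF 0])
    show "(\<lambda>z. c * u 0 z + 0 * u 0 z) \<in> bergman_space"
      by (rule bergman_space_combination[OF poly_spaceD(1)[OF deg] poly_spaceD(1)[OF deg]])
    fix m
    have "moment (\<lambda>z. c * u 0 z + 0 * u 0 z) m = c * moment (u 0) m + 0 * moment (u 0) m"
      by (rule moment_combination[OF bergman_spaceD(1)[OF poly_spaceD(1)[OF deg]] bergman_spaceD(1)[OF poly_spaceD(1)[OF deg]]])
    also have "\<dots> = moment h m"
      using poly_spaceD(2)[OF 0, of m] poly_spaceD(2)[OF deg, of 0 m] top[of 0]
      by (cases "m = 0") (auto simp: c_def)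
    finally show "moment h m = moment (\<lambda>z. c * u 0 z + 0 * u 0 z) m" ..
  qed
  then show ?case by (intro exI[of _ "\<lambda>_. c"]) simp
next
  case (Suc N)
  define c where "c = moment h (Suc N) / moment (u (Suc N)) (Suc N)"
  define k where "k = (\<lambda>z. 1 * h z + (- c) * u (Suc N) z)"
  have hu: "h \<in> bergman_space" "u (Suc N) \<in> bergman_space"
    using Suc.prems deg by (auto dest: poly_spaceD)
  have mk: "moment k m = 1 * moment h m + (- c) * moment (u (Suc N)) m" for m
    unfolding k_def by (rule moment_combination[OF bergman_spaceD(1)[OF hu(1)] bergman_spaceD(1)[OF hu(2)]])
  have "k \<in> poly_space N"
    unfolding poly_space_def
  proof (safe)
    show "k \<in> bergman_space"
      unfolding k_def by (rule bergman_space_combination[OF hu])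
    fix m assume "N < m"
    then show "moment k m = 0"
      using poly_spaceD(2)[OF Suc.prems, of m] poly_spaceD(2)[OF deg, of "Suc N" m] top[of "Suc N"]
      unfolding mk by (cases "m = Suc N") (auto simp: c_def)
  qed
  from Suc.IH[OF this] obtain d where "k = (\<lambda>z. \<Sum>j\<le>N. d j * u j z)" by blast
  moreover have "h = (\<lambda>z. k z + c * u (Suc N) z)"
    by (simp add: k_def)
  ultimately have "h = (\<lambda>z. \<Sum>j\<le>Suc N. (d(Suc N := c)) j * u j z)"
    by (simp add: fun_eq_iff)
  then show ?case by (rule exI[of _ "d(Suc N := c)"])
qed

section \<open>Bounded operators and Toeplitz operators\<close>

lemma bounded_operator_linear: "bergman_bounded_operator T \<Longrightarrow> bergman_linear T"
  by (simp add: bergman_bounded_operator_def bergman_linear_def)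

lemma bounded_operator_bound:
  assumes "bergman_bounded_operator T"
  obtains C where "0 \<le> C" "\<And>h. h \<in> bergman_space \<Longrightarrow> disk_norm (T h) \<le> C * disk_norm h"
proof -
  from assms obtain C where C: "\<forall>h\<in>bergman_space. disk_norm (T h) \<le> C * disk_norm h"
    by (auto simp: bergman_bounded_operator_def)
  show thesis
  proof
    fix h assume "h \<in> bergman_space"
    then have "disk_norm (T h) \<le> C * disk_norm h" using C by blast
    also have "\<dots> \<le> max C 0 * disk_norm h"
      by (intro mult_right_mono disk_norm_nonneg) simp
    finally show "disk_norm (T h) \<le> max C 0 * disk_norm h" .
  qed simp
qed

lemma disk_norm_combination:
  assumes u: "u \<in> disk_L2" and v: "v \<in> disk_L2"
  shows "(disk_norm (\<lambda>z. c * u z + d * v z))\<^sup>2 \<le> 2 * (cmod c)\<^sup>2 * (disk_norm u)\<^sup>2 + 2 * (cmod d)\<^sup>2 * (disk_norm v)\<^sup>2"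
proof -
  have "(\<integral>z. (cmod (c * u z + d * v z))\<^sup>2 \<partial>disk_dA) \<le>
      (\<integral>z. 2 * (cmod c)\<^sup>2 * (cmod (u z))\<^sup>2 + 2 * (cmod d)\<^sup>2 * (cmod (v z))\<^sup>2 \<partial>disk_dA)"
  proof (rule integral_mono)
    show "integrable disk_dA (\<lambda>z. (cmod (c * u z + d * v z))\<^sup>2)"
      by (rule disk_L2_integrable[OF disk_L2_combination[OF u v]])
    show "integrable disk_dA (\<lambda>z. 2 * (cmod c)\<^sup>2 * (cmod (u z))\<^sup>2 + 2 * (cmod d)\<^sup>2 * (cmod (v z))\<^sup>2)"
      using u v by (simp add: disk_L2_def)
    fix z
    have "(cmod (c * u z + d * v z))\<^sup>2 \<le> (cmod (c * u z) + cmod (d * v z))\<^sup>2"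
      by (intro power_mono norm_triangle_ineq) auto
    also have "\<dots> \<le> 2 * (cmod (c * u z))\<^sup>2 + 2 * (cmod (d * v z))\<^sup>2"
      using sum_squares_bound[of "cmod (c * u z)" "cmod (d * v z)"] by (simp add: power2_sum)
    finally show "(cmod (c * u z + d * v z))\<^sup>2 \<le> 2 * (cmod c)\<^sup>2 * (cmod (u z))\<^sup>2 + 2 * (cmod d)\<^sup>2 * (cmod (v z))\<^sup>2"
      by (simp add: norm_mult power_mult_distrib mult.assoc)
  qed
  also have "\<dots> = 2 * (cmod c)\<^sup>2 * (disk_norm u)\<^sup>2 + 2 * (cmod d)\<^sup>2 * (disk_norm v)\<^sup>2"
    using u v by (simp add: disk_norm_power2 disk_L2_def)
  finally show ?thesis by (simp add: disk_norm_power2)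
qed

lemma bounded_operator_combination:
  assumes S: "bergman_bounded_operator S" and T: "bergman_bounded_operator T"
  shows "bergman_bounded_operator (\<lambda>h z. a * S h z + b * T h z)"
proof -
  obtain C where C: "0 \<le> C" "\<And>h. h \<in> bergman_space \<Longrightarrow> disk_norm (S h) \<le> C * disk_norm h"
    using bounded_operator_bound[OF S] by blast
  obtain D where D: "0 \<le> D" "\<And>h. h \<in> bergman_space \<Longrightarrow> disk_norm (T h) \<le> D * disk_norm h"
    using bounded_operator_bound[OF T] by blast
  have lin: "bergman_linear S" "bergman_linear T"
    using S T by (simp_all add: bounded_operator_linear)
  define E where "E = sqrt (2 * (cmod a)\<^sup>2 * C\<^sup>2 + 2 * (cmod b)\<^sup>2 * D\<^sup>2)"
  have "disk_norm (\<lambda>z. a * S h z + b * T h z) \<le> E * disk_norm h" if h: "h \<in> bergman_space" for h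
  proof (rule power2_le_imp_le)
    have "(disk_norm (\<lambda>z. a * S h z + b * T h z))\<^sup>2 \<le>
        2 * (cmod a)\<^sup>2 * (disk_norm (S h))\<^sup>2 + 2 * (cmod b)\<^sup>2 * (disk_norm (T h))\<^sup>2"
      by (rule disk_norm_combination[OF bergman_spaceD(1)[OF bergman_linear_in[OF lin(1) h]] bergman_spaceD(1)[OF bergman_linear_in[OF lin(2) h]]])
    also have "\<dots> \<le> 2 * (cmod a)\<^sup>2 * (C * disk_norm h)\<^sup>2 + 2 * (cmod b)\<^sup>2 * (D * disk_norm h)\<^sup>2"
      by (intro add_mono mult_left_mono power_mono C D h disk_norm_nonneg) auto
    also have "\<dots> = (E * disk_norm h)\<^sup>2"
      by (simp add: E_def power_mult_distrib algebra_simps)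
    finally show "(disk_norm (\<lambda>z. a * S h z + b * T h z))\<^sup>2 \<le> (E * disk_norm h)\<^sup>2" .
    show "0 \<le> E * disk_norm h"
      by (intro mult_nonneg_nonneg disk_norm_nonneg) (simp add: E_def)
  qed
  then show ?thesis
    using bergman_linear_combination[OF lin, of a b]
    unfolding bergman_bounded_operator_def bergman_linear_def by blast
qed

lemma bounded_operator_identity: "bergman_bounded_operator (\<lambda>h. h)"
  by (auto simp: bergman_bounded_operator_def intro: exI[of _ 1])

lemma toeplitz_extension_toeplitz: "toeplitz_bounded f \<Longrightarrow> toeplitz_extension f (toeplitz f)"
  unfolding toeplitz_bounded_def toeplitz_def by (rule someI_ex[of "toeplitz_extension f"])

lemma disk_norm_bergman_proj_le:
  assumes u: "u \<in> disk_L2"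
  shows "disk_norm (bergman_proj u) \<le> disk_norm u"
proof -
  note P = bergman_proj_orthogonal_projection(1)[OF u]
  note PL2 = bergman_spaceD(1)[OF P]
  have "disk_inner u (bergman_proj u) = disk_inner (bergman_proj u) (bergman_proj u)"
    using bergman_proj_orthogonal_projection(2)[OF u P] disk_inner_diff_left[OF u PL2 PL2] by simp
  then have "cmod (disk_inner u (bergman_proj u)) = (disk_norm (bergman_proj u))\<^sup>2"
    by (simp only: disk_inner_self norm_of_real) simp
  then have "(disk_norm (bergman_proj u))\<^sup>2 \<le> disk_norm u * disk_norm (bergman_proj u)"
    using disk_Cauchy_Schwarz[OF u PL2] by simp
  then show ?thesis
    using disk_norm_nonneg[of u] disk_norm_nonneg[of "bergman_proj u"]
    by (cases "disk_norm (bergman_proj u) = 0") (auto simp: power2_eq_square)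
qed

lemma bergman_proj_cong: "(\<And>z. z \<in> ball 0 1 \<Longrightarrow> u z = v z) \<Longrightarrow> bergman_proj u = bergman_proj v"
  unfolding bergman_proj_def disk_restrict_def
  by (intro ext if_cong refl Bochner_Integration.integral_cong) auto

lemma bergman_proj_combination:
  assumes u: "u \<in> disk_L2" and v: "v \<in> disk_L2"
  shows "bergman_proj (\<lambda>z. c * u z + d * v z) = (\<lambda>z. c * bergman_proj u z + d * bergman_proj v z)"
proof (rule bergman_eqI)
  note uv = disk_L2_combination[OF u v, of c d]
  note P = bergman_proj_orthogonal_projection(1)
  show "bergman_proj (\<lambda>z. c * u z + d * v z) \<in> bergman_space"
    by (rule P[OF uv])
  show "(\<lambda>z. c * bergman_proj u z + d * bergman_proj v z) \<in> bergman_space"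
    by (rule bergman_space_combination[OF P[OF u] P[OF v]])
  fix m
  show "moment (bergman_proj (\<lambda>z. c * u z + d * v z)) m = moment (\<lambda>z. c * bergman_proj u z + d * bergman_proj v z) m"
    unfolding moment_combination[OF bergman_spaceD(1)[OF P[OF u]] bergman_spaceD(1)[OF P[OF v]]]
      moment_bergman_proj[OF disk_L2_integrable_self[OF uv] P[OF uv]]
      moment_bergman_proj[OF disk_L2_integrable_self[OF u] P[OF u]]
      moment_bergman_proj[OF disk_L2_integrable_self[OF v] P[OF v]]
      moment_combination[OF u v] ..
qed

lemma disk_L2_mult_bounded:
  assumes g: "g \<in> borel_measurable disk_dA" and B: "\<And>z. z \<in> ball 0 1 \<Longrightarrow> cmod (g z) \<le> B" and h: "h \<in> disk_L2"
  shows "(\<lambda>z. g z * h z) \<in> disk_L2" and "disk_norm (\<lambda>z. g z * h z) \<le> B * disk_norm h"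
proof -
  have B0: "0 \<le> B" using order_trans[OF norm_ge_zero B[of 0]] by simp
  have le: "(cmod (g z * h z))\<^sup>2 \<le> B\<^sup>2 * (cmod (h z))\<^sup>2" if "z \<in> space disk_dA" for z
    unfolding norm_mult power_mult_distrib using B[of z] that by (intro mult_right_mono power_mono) auto
  have hm: "h \<in> borel_measurable disk_dA" by (rule disk_L2_measurable[OF h])
  have m: "(\<lambda>z. g z * h z) \<in> borel_measurable disk_dA"
    using g hm by (rule borel_measurable_times)
  have int: "integrable disk_dA (\<lambda>z. B\<^sup>2 * (cmod (h z))\<^sup>2)"
    using disk_L2_integrable[OF h] by simp
  have int2: "integrable disk_dA (\<lambda>z. (cmod (g z * h z))\<^sup>2)"
  proof (rule Bochner_Integration.integrable_bound[OF int])
    show "(\<lambda>z. (cmod (g z * h z))\<^sup>2) \<in> borel_measurable disk_dA"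
      by (rule borel_measurable_power[OF measurable_compose[OF m borel_measurable_norm]])
    show "AE z in disk_dA. norm ((cmod (g z * h z))\<^sup>2) \<le> norm (B\<^sup>2 * (cmod (h z))\<^sup>2)"
    proof (rule AE_I2)
      fix z assume "z \<in> space disk_dA"
      then show "norm ((cmod (g z * h z))\<^sup>2) \<le> norm (B\<^sup>2 * (cmod (h z))\<^sup>2)"
        using le[of z] by (simp del: space_disk_dA)
    qed
  qed
  show L2: "(\<lambda>z. g z * h z) \<in> disk_L2"
    using m int2 by (simp add: disk_L2_def)
  have "(disk_norm (\<lambda>z. g z * h z))\<^sup>2 \<le> (\<integral>z. B\<^sup>2 * (cmod (h z))\<^sup>2 \<partial>disk_dA)"
    unfolding disk_norm_power2 by (rule integral_mono[OF int2 int le])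
  also have "\<dots> = (B * disk_norm h)\<^sup>2"
    by (simp add: power_mult_distrib disk_norm_power2)
  finally show "disk_norm (\<lambda>z. g z * h z) \<le> B * disk_norm h"
    by (rule power2_le_imp_le) (intro mult_nonneg_nonneg B0 disk_norm_nonneg)
qed

lemma toeplitz_bounded_symbol:
  assumes g: "g \<in> borel_measurable disk_dA" and B: "\<And>z. z \<in> ball 0 1 \<Longrightarrow> cmod (g z) \<le> B"
  shows "toeplitz_bounded g"
proof -
  define T where "T h = bergman_proj (\<lambda>z. g z * h z)" for h
  note L2 = disk_L2_mult_bounded[OF g B bergman_spaceD(1)]
  have "bergman_bounded_operator T"
    unfolding bergman_bounded_operator_def
  proof (intro conjI ballI allI funcsetI exI[of _ B])
    fix h assume h: "h \<in> bergman_space"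
    show "T h \<in> bergman_space"
      unfolding T_def by (rule bergman_proj_orthogonal_projection(1)[OF L2(1)[OF _ h]])
    show "disk_norm (T h) \<le> B * disk_norm h"
      unfolding T_def using disk_norm_bergman_proj_le[OF L2(1)[OF _ h]] L2(2)[OF _ h] by (rule order_trans)
    fix k c d assume k: "k \<in> bergman_space"
    have "(\<lambda>z. g z * (c * h z + d * k z)) = (\<lambda>z. c * (g z * h z) + d * (g z * k z))"
      by (simp add: algebra_simps)
    then show "T (\<lambda>z. c * h z + d * k z) = (\<lambda>z. c * T h z + d * T k z)"
      unfolding T_def using bergman_proj_combination[OF L2(1)[OF _ h] L2(1)[OF _ k], of c d] by simp
  qed
  moreover have "T (disk_restrict (poly p)) = bergman_proj (\<lambda>z. g z * poly p z)" for p
    unfolding T_def by (rule bergman_proj_cong) (simp add: disk_restrict_def)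
  ultimately show ?thesis
    unfolding toeplitz_bounded_def toeplitz_extension_def by blast
qed

lemma integrable_times_monomials:
  assumes f: "integrable disk_dA f"
  shows "integrable disk_dA (\<lambda>z. f z * (z ^ p * cnj z ^ q))"
proof (rule Bochner_Integration.integrable_bound[OF f])
  show "(\<lambda>z. f z * (z ^ p * cnj z ^ q)) \<in> borel_measurable disk_dA"
    by (intro borel_measurable_times borel_measurable_disk_dA[of "\<lambda>z. z ^ p * cnj z ^ q"]
        borel_measurable_continuous_onI continuous_intros) (use f in auto)
  show "AE z in disk_dA. norm (f z * (z ^ p * cnj z ^ q)) \<le> norm (f z)"
  proof (rule AE_I2)
    fix z :: complex assume "z \<in> space disk_dA"
    then have "cmod z ^ p * cmod z ^ q \<le> 1"
      by (intro mult_le_one power_le_one) auto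
    then show "norm (f z * (z ^ p * cnj z ^ q)) \<le> norm (f z)"
      by (simp add: norm_mult norm_power mult_left_le)
  qed
qed

text \<open>The projection drops out of the matrix elements of a Toeplitz operator: pairing with z ^ m only sees the
integral of the symbol against monomials.\<close>

lemma moment_toeplitz_monomial:
  assumes f: "integrable disk_dA f" and T: "toeplitz_extension f T"
  shows "moment (T (disk_monomial k)) m = (\<integral>z. f z * (z ^ k * cnj z ^ m) \<partial>disk_dA)"
proof -
  have eq: "T (disk_monomial k) = bergman_proj (\<lambda>z. f z * z ^ k)"
    using T unfolding toeplitz_extension_def disk_monomial_poly by (simp add: poly_monom)
  have "T (disk_monomial k) \<in> bergman_space"
    using T disk_monomial_bergman bergman_linear_in[OF bounded_operator_linear]
    unfolding toeplitz_extension_def by blast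
  then have "moment (T (disk_monomial k)) m = moment (\<lambda>z. f z * z ^ k) m"
    unfolding eq by (intro moment_bergman_proj) (use integrable_times_monomials[OF f, of k 0] in auto)
  then show ?thesis
    by (simp add: moment_def disk_inner_def mult.assoc)
qed

section \<open>The commutant of the Toeplitz operator with symbol g\<close>

text \<open>The symbol is written without polar coordinates: the term e^(i theta) r^3 equals z^2 cnj z.\<close>

locale cubic_coanalytic_symbol =
  fixes a :: "nat \<Rightarrow> complex" and g :: "complex \<Rightarrow> complex"
  assumes coanalytic_summable: "\<And>z. z \<in> ball 0 1 \<Longrightarrow> summable (\<lambda>l. a (Suc l) * cnj z ^ Suc l)"
    and coanalytic_bounded: "bounded ((\<lambda>z. \<Sum>l. a (Suc l) * cnj z ^ Suc l) ` ball 0 1)"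
    and symbol_eq: "\<And>z. z \<in> ball 0 1 \<Longrightarrow> g z = z ^ 2 * cnj z + (\<Sum>l. a (Suc l) * cnj z ^ Suc l)"
begin

text \<open>The conjugate of the coanalytic part of the symbol: a bounded analytic function, whose Bergman moments
are its Taylor coefficients up to a factor. This makes it unnecessary to integrate the series of the symbol
term by term.\<close>

definition conj_part :: "complex \<Rightarrow> complex" where
  "conj_part = disk_restrict (\<lambda>z. cnj (\<Sum>l. a (Suc l) * cnj z ^ Suc l))"

lemma conj_part_sums:
  assumes "z \<in> ball 0 1"
  shows "(\<lambda>n. (if n = 0 then 0 else cnj (a n)) * z ^ n) sums conj_part z"
proof -
  have "(\<lambda>l. cnj (a (Suc l) * cnj z ^ Suc l)) sums cnj (\<Sum>l. a (Suc l) * cnj z ^ Suc l)"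
    by (rule sums_cnj[THEN iffD2], rule summable_sums[OF coanalytic_summable[OF assms]])
  then have "(\<lambda>l. (if Suc l = 0 then 0 else cnj (a (Suc l))) * z ^ Suc l) sums conj_part z"
    using assms by (simp add: conj_part_def disk_restrict_def)
  from sums_Suc[OF this] show ?thesis by simp
qed

lemma conj_part_bound: obtains B where "\<And>z. z \<in> ball 0 1 \<Longrightarrow> cmod (conj_part z) \<le> B"
proof -
  from coanalytic_bounded obtain B where
    B: "\<forall>x\<in>(\<lambda>z. \<Sum>l. a (Suc l) * cnj z ^ Suc l) ` ball 0 1. cmod x \<le> B"
    unfolding bounded_iff by blast
  show thesis
  proof (rule that)
    fix z :: complex assume z: "z \<in> ball 0 1"
    then have "cmod (\<Sum>l. a (Suc l) * cnj z ^ Suc l) \<le> B" using B by blast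
    then show "cmod (conj_part z) \<le> B"
      using z by (simp add: conj_part_def disk_restrict_def)
  qed
qed

lemma conj_part_holomorphic: "conj_part holomorphic_on ball 0 1"
  by (rule power_series_holomorphic[where a = "\<lambda>n. if n = 0 then 0 else cnj (a n)"])
    (use conj_part_sums in simp)

lemma symbol_conj_part: "z \<in> ball 0 1 \<Longrightarrow> g z = z ^ 2 * cnj z + cnj (conj_part z)"
  by (simp add: symbol_eq conj_part_def disk_restrict_def)

lemma symbol_measurable: "g \<in> borel_measurable disk_dA"
proof -
  have "(\<lambda>z. z ^ 2 * cnj z + cnj (conj_part z)) \<in> borel_measurable disk_dA"
    by (intro borel_measurable_add borel_measurable_cnj holomorphic_measurable_disk_dA[OF conj_part_holomorphic]
        borel_measurable_disk_dA[of "\<lambda>z. z ^ 2 * cnj z"] borel_measurable_continuous_onI continuous_intros)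
  then show ?thesis
    by (subst measurable_cong[of _ _ "\<lambda>z. z ^ 2 * cnj z + cnj (conj_part z)"]) (simp_all add: symbol_conj_part)
qed

lemma symbol_bound: obtains B where "\<And>z. z \<in> ball 0 1 \<Longrightarrow> cmod (g z) \<le> B"
proof -
  obtain B where B: "\<And>z. z \<in> ball 0 1 \<Longrightarrow> cmod (conj_part z) \<le> B"
    using conj_part_bound by blast
  have "cmod (g z) \<le> 1 + B" if z: "z \<in> ball 0 1" for z
  proof -
    have "cmod (z ^ 2 * cnj z) \<le> 1"
      using z by (auto simp: norm_mult norm_power intro!: mult_le_one power_le_one)
    then show ?thesis
      unfolding symbol_conj_part[OF z] using B[OF z] norm_triangle_ineq[of "z ^ 2 * cnj z" "cnj (conj_part z)"] by simp
  qed
  then show thesis using that by blast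
qed

lemma symbol_integrable: "integrable disk_dA g"
proof -
  obtain B where "\<And>z. z \<in> ball 0 1 \<Longrightarrow> cmod (g z) \<le> B"
    using symbol_bound by blast
  from disk_L2_integrable_self[OF disk_L2_bounded[OF symbol_measurable this]] show ?thesis .
qed

lemma toeplitz_extension_symbol: "toeplitz_extension g (toeplitz g)"
proof -
  obtain B where "\<And>z. z \<in> ball 0 1 \<Longrightarrow> cmod (g z) \<le> B"
    using symbol_bound by blast
  from toeplitz_bounded_symbol[OF symbol_measurable this] show ?thesis
    by (rule toeplitz_extension_toeplitz)
qed

lemma toeplitz_symbol_bounded: "bergman_bounded_operator (toeplitz g)"
  using toeplitz_extension_symbol by (simp add: toeplitz_extension_def)

lemma toeplitz_symbol_linear: "bergman_linear (toeplitz g)"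
  by (rule bounded_operator_linear[OF toeplitz_symbol_bounded])

lemma coanalytic_moment:
  "(\<integral>z. cnj (conj_part z) * (z ^ k * cnj z ^ m) \<partial>disk_dA) = (if m < k then a (k - m) / of_nat (Suc k) else 0)"
proof -
  define h where "h = disk_restrict (\<lambda>z. conj_part z * z ^ m)"
  obtain B where B: "\<And>z. z \<in> ball 0 1 \<Longrightarrow> cmod (conj_part z) \<le> B"
    using conj_part_bound by blast
  have "h holomorphic_on ball 0 1 \<longleftrightarrow> (\<lambda>z. conj_part z * z ^ m) holomorphic_on ball 0 1"
    by (rule holomorphic_cong) (auto simp: h_def disk_restrict_def)
  then have hol: "h holomorphic_on ball 0 1"
    by (auto intro!: holomorphic_intros conj_part_holomorphic)
  have "h \<in> disk_L2"
  proof (rule disk_L2_bounded[OF holomorphic_measurable_disk_dA[OF hol], of B])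
    fix z :: complex assume z: "z \<in> ball 0 1"
    then have "cmod z ^ m \<le> 1" by (auto intro!: power_le_one)
    then have "cmod (conj_part z) * cmod z ^ m \<le> cmod (conj_part z)"
      by (intro mult_left_le) auto
    then show "cmod (h z) \<le> B"
      using B[OF z] z by (simp add: h_def disk_restrict_def norm_mult norm_power)
  qed
  then have hB: "h \<in> bergman_space"
    using hol by (auto simp: bergman_space_def h_def disk_restrict_def)
  define b where "b n = (if n \<le> m then 0 else cnj (a (n - m)))" for n
  have "(\<lambda>n. b n * z ^ n) sums h z" if z: "z \<in> ball 0 1" for z
  proof -
    have "(\<lambda>n. (if n = 0 then 0 else cnj (a n)) * z ^ n * z ^ m) sums (conj_part z * z ^ m)"
      by (rule sums_mult2[OF conj_part_sums[OF z]])
    moreover have "(\<lambda>n. (if n = 0 then 0 else cnj (a n)) * z ^ n * z ^ m) = (\<lambda>n. b (n + m) * z ^ (n + m))"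
      by (auto simp: b_def power_add fun_eq_iff)
    moreover have "conj_part z * z ^ m = h z"
      using z by (simp add: h_def disk_restrict_def)
    ultimately have "(\<lambda>n. b (n + m) * z ^ (n + m)) sums h z" by simp
    then show ?thesis
      by (subst (asm) sums_zero_iff_shift) (auto simp: b_def)
  qed
  then have "moment h k = b k / of_nat (Suc k)"
    by (rule moment_bergman_powser[OF hB])
  moreover have "(\<integral>z. cnj (conj_part z) * (z ^ k * cnj z ^ m) \<partial>disk_dA) = cnj (moment h k)"
    unfolding moment_def disk_inner_def
    by (subst Bochner_Integration.integral_cnj[symmetric], intro Bochner_Integration.integral_cong refl)
      (simp add: h_def disk_restrict_def mult_ac)
  ultimately show ?thesis
    by (auto simp: b_def simp del: of_nat_Suc)
qed

lemma moment_symbol_monomial: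
  "moment (toeplitz g (disk_monomial k)) m =
     (if m = Suc k then 1 / of_nat (k + 3) else 0) + (if m < k then a (k - m) / of_nat (Suc k) else 0)"
proof -
  have 1: "integrable disk_dA (\<lambda>z. z ^ (k + 2) * cnj (z ^ (m + 1)))"
    by (rule disk_L2_integrable_inner[OF disk_L2_power disk_L2_power])
  obtain B where B: "\<And>z. z \<in> ball 0 1 \<Longrightarrow> cmod (conj_part z) \<le> B"
    using conj_part_bound by blast
  have "integrable disk_dA (\<lambda>z. cnj (conj_part z))"
    by (rule disk_L2_integrable_self, rule disk_L2_bounded[of _ B])
      (use borel_measurable_cnj[OF holomorphic_measurable_disk_dA[OF conj_part_holomorphic]] B in simp_all)
  then have 2: "integrable disk_dA (\<lambda>z. cnj (conj_part z) * (z ^ k * cnj z ^ m))"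
    by (rule integrable_times_monomials)
  have "moment (toeplitz g (disk_monomial k)) m = (\<integral>z. g z * (z ^ k * cnj z ^ m) \<partial>disk_dA)"
    by (rule moment_toeplitz_monomial[OF symbol_integrable toeplitz_extension_symbol])
  also have "\<dots> = (\<integral>z. z ^ (k + 2) * cnj (z ^ (m + 1)) + cnj (conj_part z) * (z ^ k * cnj z ^ m) \<partial>disk_dA)"
    by (intro Bochner_Integration.integral_cong refl)
      (simp add: symbol_conj_part algebra_simps power_add power2_eq_square)
  also have "\<dots> = disk_inner (\<lambda>z. z ^ (k + 2)) (\<lambda>z. z ^ (m + 1)) + (\<integral>z. cnj (conj_part z) * (z ^ k * cnj z ^ m) \<partial>disk_dA)"
    unfolding disk_inner_def by (rule Bochner_Integration.integral_add[OF 1 2])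
  also have "disk_inner (\<lambda>z. z ^ (k + 2)) (\<lambda>z. z ^ (m + 1)) = (if m = Suc k then 1 / of_nat (k + 3) else 0)"
    unfolding disk_inner_powers by (auto simp: eval_nat_numeral)
  finally show ?thesis
    by (simp only: coanalytic_moment)
qed

text \<open>The action of T_g on moments. In terms of the vectors (k + 1) z ^ k it reads: up by one step with weight
m / (m + 2), where m is the index reached, and down by l with weight a l.\<close>

lemma moment_symbol:
  assumes h: "h \<in> poly_space M"
  shows "moment (toeplitz g h) m =
     (if m = 0 then 0 else of_nat m / of_nat (m + 2) * moment h (m - 1)) + (\<Sum>l\<in>{1..M - m}. a l * moment h (m + l))"
proof -
  have lin: "toeplitz g h = (\<lambda>z. \<Sum>k\<le>M. (of_nat (Suc k) * moment h k) * toeplitz g (disk_monomial k) z)"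
    by (subst poly_space_expansion[OF h], rule bergman_linear_sum[OF toeplitz_symbol_linear])
      (simp_all add: disk_monomial_bergman)
  have "moment (toeplitz g h) m = (\<Sum>k\<le>M. (of_nat (Suc k) * moment h k) * moment (toeplitz g (disk_monomial k)) m)"
    unfolding lin by (intro moment_sum bergman_linear_in[OF toeplitz_symbol_linear] disk_monomial_bergman) simp
  also have "\<dots> = (\<Sum>k\<le>M. if k = m - 1 then (if m = 0 then 0 else of_nat m / of_nat (m + 2) * moment h (m - 1)) else 0) +
      (\<Sum>k\<le>M. if m < k then a (k - m) * moment h k else 0)"
    unfolding sum.distrib[symmetric] moment_symbol_monomial
  proof (intro sum.cong refl)
    fix k
    have three: "of_nat k + 3 = (of_nat (Suc (Suc (Suc k))) :: complex)" by simp
    have "of_nat (Suc k) * (x / of_nat (Suc k)) = (x :: complex)" for x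
      by (simp del: of_nat_Suc)
    then show "(of_nat (Suc k) * moment h k) * ((if m = Suc k then 1 / of_nat (k + 3) else 0) +
          (if m < k then a (k - m) / of_nat (Suc k) else 0)) =
        (if k = m - 1 then (if m = 0 then 0 else of_nat m / of_nat (m + 2) * moment h (m - 1)) else 0) +
        (if m < k then a (k - m) * moment h k else 0)"
      using three by (cases m) (auto simp del: of_nat_Suc simp: mult_ac)
  qed
  also have "(\<Sum>k\<le>M. if k = m - 1 then (if m = 0 then 0 else of_nat m / of_nat (m + 2) * moment h (m - 1)) else 0) =
      (if m = 0 then 0 else of_nat m / of_nat (m + 2) * moment h (m - 1))"
    using poly_spaceD(2)[OF h, of "m - 1"] by (simp add: sum.delta')
  also have "(\<Sum>k\<le>M. if m < k then a (k - m) * moment h k else 0) = (\<Sum>k\<in>{m<..M}. a (k - m) * moment h k)"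
    by (rule sum.mono_neutral_cong_right) auto
  also have "\<dots> = (\<Sum>l\<in>{1..M - m}. a l * moment h (m + l))"
    by (rule sum.reindex_bij_witness[of _ "\<lambda>l. m + l" "\<lambda>k. k - m"]) auto
  finally show ?thesis .
qed

lemma symbol_poly_space:
  assumes h: "h \<in> poly_space M" shows "toeplitz g h \<in> poly_space (Suc M)"
  unfolding poly_space_def
proof safe
  show "toeplitz g h \<in> bergman_space"
    by (rule bergman_linear_in[OF toeplitz_symbol_linear poly_spaceD(1)[OF h]])
  fix m assume "Suc M < m"
  then show "moment (toeplitz g h) m = 0"
    by (simp add: moment_symbol[OF h] poly_spaceD(2)[OF h])
qed

lemma symbol_funpow_poly_space: "(toeplitz g ^^ j) (disk_monomial k) \<in> poly_space (k + j)"
  by (induction j) (auto intro: symbol_poly_space disk_monomial_poly_space)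

lemma symbol_funpow_leading: "moment ((toeplitz g ^^ j) (disk_monomial k)) (k + j) \<noteq> 0"
proof (induction j)
  case (Suc j)
  then show ?case
    by (simp add: moment_symbol[OF symbol_funpow_poly_space] del: of_nat_Suc of_nat_add)
qed (simp add: moment_disk_monomial del: of_nat_Suc)

text \<open>Since 1 is cyclic for T_g on the polynomials, an operator commuting with T_g is determined by its value at 1. If
this value is a polynomial, then it agrees with p(T_g) 1 for some polynomial p, and hence the operator
agrees with p(T_g).\<close>

lemma commutant_polynomial:
  assumes T: "bergman_linear T" and deg: "T (disk_monomial 0) \<in> poly_space N"
    and comm: "\<And>k. T (toeplitz g (disk_monomial k)) = toeplitz g (T (disk_monomial k))"
  shows "\<exists>c. \<forall>k. T (disk_monomial k) = (\<lambda>z. \<Sum>j\<le>N. c j * (toeplitz g ^^ j) (disk_monomial k) z)"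
proof -
  let ?S = "toeplitz g"
  have "\<exists>c. T (disk_monomial 0) = (\<lambda>z. \<Sum>j\<le>N. c j * (?S ^^ j) (disk_monomial 0) z)"
    using symbol_funpow_poly_space[of _ 0] symbol_funpow_leading[of _ 0] by (intro cyclic_span deg) auto
  then obtain c where c: "T (disk_monomial 0) = (\<lambda>z. \<Sum>j\<le>N. c j * (?S ^^ j) (disk_monomial 0) z)"
    by blast
  define Y where "Y h = (\<lambda>z. \<Sum>j\<le>N. c j * (?S ^^ j) h z)" for h
  have Y: "bergman_linear Y"
    unfolding Y_def[abs_def] by (rule bergman_linear_powers_sum[OF toeplitz_symbol_linear])
  have Ycomm: "Y (?S h) = ?S (Y h)" if h: "h \<in> bergman_space" for h
  proof -
    have "?S (Y h) = (\<lambda>z. \<Sum>j\<le>N. c j * ?S ((?S ^^ j) h) z)"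
      unfolding Y_def
      by (rule bergman_linear_sum[OF toeplitz_symbol_linear])
        (simp_all add: bergman_linear_in[OF bergman_linear_funpow[OF toeplitz_symbol_linear] h])
    then show ?thesis
      unfolding Y_def by (simp add: funpow_swap1)
  qed
  define X where "X h = (\<lambda>z. 1 * T h z + (- 1) * Y h z)" for h
  have "X (disk_monomial k) = (\<lambda>z. 0)" for k
  proof (rule cyclic_annihilator[OF _ toeplitz_symbol_linear])
    show "bergman_linear X"
      unfolding X_def[abs_def] by (rule bergman_linear_combination[OF T Y])
    show "?S (disk_monomial k) \<in> poly_space (Suc k)" for k
      by (intro symbol_poly_space disk_monomial_poly_space) simp
    show "moment (?S (disk_monomial k)) (Suc k) \<noteq> 0" for k
      using symbol_funpow_leading[of 1 k] by simp
    show "X (?S (disk_monomial k)) = ?S (X (disk_monomial k))" for k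
      unfolding X_def comm Ycomm[OF disk_monomial_bergman]
      by (rule bergman_linearD[OF toeplitz_symbol_linear bergman_linear_in[OF T disk_monomial_bergman]
            bergman_linear_in[OF Y disk_monomial_bergman], symmetric])
    show "X (disk_monomial 0) = (\<lambda>z. 0)"
      unfolding X_def Y_def c by simp
  qed
  then have "T (disk_monomial k) = Y (disk_monomial k)" for k
    by (simp add: X_def fun_eq_iff)
  then show ?thesis
    unfolding Y_def by blast
qed

end

section \<open>Matrix entries of the powers and their rational continuations\<close>

text \<open>The weight of the step from (k + 1) z ^ k to (k + 2) z ^ (k + 1) under T_g.\<close>

definition shift_weight :: "complex \<Rightarrow> complex" where
  "shift_weight z = (z + 1) / (z + 3)"

text \<open>The coefficient of the basis vector with index k + n in the image of the vector with index k under the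
J-th power of T_g, with respect to the vectors (k + 1) z ^ k. The first case of the conditional is the truncation:
there are no vectors with negative index.\<close>

fun power_entry :: "(nat \<Rightarrow> complex) \<Rightarrow> nat \<Rightarrow> int \<Rightarrow> nat \<Rightarrow> complex" where
  "power_entry a 0 n k = (if n = 0 then 1 else 0)"
| "power_entry a (Suc J) n k = (if int k + n < 0 then 0 else
     shift_weight (of_int (int k + n - 1)) * power_entry a J (n - 1) k +
     (\<Sum>l\<in>{1..nat (int J - n)}. a l * power_entry a J (n + int l) k))"

text \<open>The same recursion without truncation, so that k can be replaced by a complex variable z: the entries of a
bilateral operator in which the steps from negative positions have weights, too. In z this is a rational
function, with poles at integers only.\<close>

fun bilateral_entry :: "(nat \<Rightarrow> complex) \<Rightarrow> nat \<Rightarrow> int \<Rightarrow> complex \<Rightarrow> complex" where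
  "bilateral_entry a 0 n z = (if n = 0 then 1 else 0)"
| "bilateral_entry a (Suc J) n z =
     shift_weight (z + of_int (n - 1)) * bilateral_entry a J (n - 1) z +
     (\<Sum>l\<in>{1..nat (int J - n)}. a l * bilateral_entry a J (n + int l) z)"

lemma bilateral_entry_fun:
  "bilateral_entry a 0 n = (\<lambda>z. if n = 0 then 1 else 0)"
  "bilateral_entry a (Suc J) n = (\<lambda>z. shift_weight (z + of_int (n - 1)) * bilateral_entry a J (n - 1) z +
     (\<Sum>l\<in>{1..nat (int J - n)}. a l * bilateral_entry a J (n + int l) z))"
  by (rule ext, rule bilateral_entry.simps)+

lemma power_entry_negative: "int k + n < 0 \<Longrightarrow> power_entry a J n k = 0"
  by (cases J) auto

text \<open>A path with at most J steps and total displacement n goes down by at most J - n in total, so from k \<ge> J - n it never meets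
the truncation.\<close>

lemma power_entry_eq_bilateral: "int J - n \<le> int k \<Longrightarrow> power_entry a J n k = bilateral_entry a J n (of_nat k)"
proof (induction J arbitrary: n)
  case (Suc J)
  have "power_entry a J (n - 1) k = bilateral_entry a J (n - 1) (of_nat k)"
    "power_entry a J (n + int l) k = bilateral_entry a J (n + int l) (of_nat k)" for l
    using Suc.prems by (intro Suc.IH; simp)+
  moreover have "\<not> int k + n < 0" using Suc.prems by simp
  ultimately show ?case by (simp add: algebra_simps)
qed simp

lemma bilateral_entry_holomorphic: "bilateral_entry a J n holomorphic_on - \<int>"
proof (induction J arbitrary: n)
  case 0
  show ?case unfolding bilateral_entry_fun by (rule holomorphic_on_const)
next
  case (Suc J)
  have "z + of_int (n - 1) + 3 \<noteq> 0" if "z \<in> - \<int>" for z :: complex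
  proof
    assume "z + of_int (n - 1) + 3 = 0"
    then have "z = - (of_int (n - 1) + 3)"
      by (simp only: eq_neg_iff_add_eq_0 add.assoc)
    also have "\<dots> = of_int (- n - 2)" by simp
    finally show False using that Ints_of_int[of "- n - 2"] by simp
  qed
  then show ?case
    unfolding bilateral_entry_fun shift_weight_def by (intro holomorphic_intros Suc) auto
qed

lemma bilateral_entry_halfplane:
  "bilateral_entry a J n holomorphic_on {z. of_int (int J - n) < Re z} \<and>
    (\<exists>B. \<forall>z. of_int (int J - n) < Re z \<longrightarrow> cmod (bilateral_entry a J n z) \<le> B)"
proof (induction J arbitrary: n)
  case 0
  show ?case
    unfolding bilateral_entry_fun by (auto intro: exI[of _ 1])
next
  case (Suc J)
  let ?H = "{z. of_int (int (Suc J) - n) < Re z}"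
  have sub: "?H \<subseteq> {z. of_int (int J - (n - 1)) < Re z}" "?H \<subseteq> {z. of_int (int J - (n + int l)) < Re z}" for l
    by auto
  note hol = Suc.IH[THEN conjunct1, THEN holomorphic_on_subset]
  have pos: "0 < Re (z + of_int (n - 1))" if "z \<in> ?H" for z
    using that by simp
  have "z + of_int (n - 1) + 3 \<noteq> 0" if "z \<in> ?H" for z
    using pos[OF that] by (auto simp: complex_eq_iff)
  then have "bilateral_entry a (Suc J) n holomorphic_on ?H"
    unfolding bilateral_entry_fun shift_weight_def
    by (intro holomorphic_intros hol[OF sub(1)] hol[OF sub(2)]) auto
  moreover obtain B where B: "\<And>n z. of_int (int J - n) < Re z \<Longrightarrow> cmod (bilateral_entry a J n z) \<le> B n"
    using Suc.IH[THEN conjunct2] by metis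
  have w: "cmod (shift_weight z) \<le> 1" if "0 < Re z" for z
  proof -
    have "(Re z + 1)\<^sup>2 + (Im z)\<^sup>2 \<le> (Re z + 3)\<^sup>2 + (Im z)\<^sup>2"
      using that by (intro add_right_mono power_mono) auto
    then have "cmod (z + 1) \<le> cmod (z + 3)"
      by (simp add: cmod_def)
    then show ?thesis
      using that by (auto simp: shift_weight_def norm_divide divide_le_eq_1)
  qed
  moreover have "cmod (bilateral_entry a (Suc J) n z) \<le>
      1 * B (n - 1) + (\<Sum>l\<in>{1..nat (int J - n)}. cmod (a l) * B (n + int l))" if z: "z \<in> ?H" for z
    unfolding bilateral_entry.simps
  proof (rule order_trans[OF norm_triangle_ineq add_mono])
    show "cmod (shift_weight (z + of_int (n - 1)) * bilateral_entry a J (n - 1) z) \<le> 1 * B (n - 1)"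
      unfolding norm_mult using z by (intro mult_mono w pos B) auto
    show "cmod (\<Sum>l\<in>{1..nat (int J - n)}. a l * bilateral_entry a J (n + int l) z) \<le>
        (\<Sum>l\<in>{1..nat (int J - n)}. cmod (a l) * B (n + int l))"
      by (rule sum_norm_le) (use z in \<open>auto simp: norm_mult intro!: mult_left_mono B\<close>)
  qed
  ultimately show ?case by blast
qed

lemma of_int_add_ne_zero:
  assumes "0 < t" "t < 1" shows "of_int i + complex_of_real t \<noteq> 0"
proof
  assume "of_int i + complex_of_real t = 0"
  then have "real_of_int i + t = 0" by (simp add: complex_eq_iff)
  with assms have "real_of_int (- 1) < real_of_int i" "real_of_int i < real_of_int 0" by simp_all
  then have "- 1 < i" "i < 0" by (simp_all only: of_int_less_iff)
  then show False by linarith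
qed

text \<open>This is where truncated and untruncated entries are compared at small k. Let a path start at k + t and end at
m + t with t near 0. Without truncation it may pass through negative positions, where two things can
happen. Climbing from -2 or -1 to nonnegative positions, it takes the step from -1, of weight t / (2 + t), so it
contributes nothing in the limit. Only from -3 and below does it meet the pole of the weight at -3, which
cancels that zero. If m \<ge> J - 4, then a path of J steps can reach a position \<le> -3 in just one way, for m = J - 4:
its first step goes down from k to -3, with weight a (k + 3), and all others go up.
The product of the weights of J - 1 steps up from -3 + t is (t - 2) (t - 1) divided by (m + 1 + t) (m + 2 + t).
Multiplying by the denominator removes the poles that occur if m is -1 or -2, and gives the
discrepancy 2 a (k + 3) in all cases.

The proof is by induction on J along the recursion for the normalized entries b, in which steps up have
weight 1 and a step down by l to m has weight a l times the ratio \<rho>.\<close>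

lemma bilateral_entry_limit:
  fixes k :: nat and m :: int
  assumes "int J - 4 \<le> m"
  shows "((\<lambda>t::real. (of_int m + 1 + of_real t) * (of_int m + 2 + of_real t) * bilateral_entry a J (m - int k) (of_nat k + of_real t)) \<longlongrightarrow>
    of_int ((m + 1) * (m + 2)) * power_entry a J (m - int k) k + (if m = int J - 4 \<and> 1 \<le> J then 2 * a (k + 3) else 0)) (at_right 0)"
  using assms
proof (induction J arbitrary: m)
  case 0
  have lim: "((\<lambda>t::real. (of_int m + 1 + of_real t) * (of_int m + 2 + of_real t) * c) \<longlongrightarrow>
      (of_int m + 1 + of_real 0) * (of_int m + 2 + of_real 0) * c) (at_right 0)" for c :: complex
    by (intro tendsto_intros)
  show ?case using lim[of "power_entry a 0 (m - int k) k"] by simp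
next
  case (Suc J)
  define b where "b J m t = (of_int m + 1 + of_real t) * (of_int m + 2 + of_real t) * bilateral_entry a J (m - int k) (of_nat k + of_real t)"
    for J and m :: int and t :: real
  define D where "D J m = (if m = int J - 4 \<and> 1 \<le> J then 2 * a (k + 3) else 0)" for J and m :: int
  have m: "int J - 3 \<le> m" using Suc.prems by simp
  have IH: "(b J i \<longlongrightarrow> of_int ((i + 1) * (i + 2)) * power_entry a J (i - int k) k + D J i) (at_right 0)" if "int J - 4 \<le> i" for i
    using Suc.IH[OF that] by (simp only: b_def[abs_def] D_def)
  define \<rho> :: "nat \<Rightarrow> real \<Rightarrow> complex" where "\<rho> l t = (of_int m + 1 + of_real t) * (of_int m + 2 + of_real t) /
      ((of_int (m + int l) + 1 + of_real t) * (of_int (m + int l) + 2 + of_real t))" for l t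
  let ?I = "{1..nat (int J - (m - int k))}"
  have ev: "\<forall>\<^sub>F t::real in at_right 0. 0 < t \<and> t < 1"
    by (auto simp: eventually_at_right_field intro!: exI[of _ 1])
  have step: "b (Suc J) m t = b J (m - 1) t + (\<Sum>l\<in>?I. a l * (\<rho> l t * b J (m + int l) t))" if t: "0 < t" "t < 1" for t
  proof -
    have ne: "of_int i + 1 + complex_of_real t \<noteq> 0" "of_int i + 2 + complex_of_real t \<noteq> 0" for i
      using of_int_add_ne_zero[OF t, of "i + 1"] of_int_add_ne_zero[OF t, of "i + 2"] by simp_all
    have 1: "(of_int m + 1 + of_real t) * (of_int m + 2 + of_real t) *
        (shift_weight (of_nat k + of_real t + of_int (m - int k - 1)) * bilateral_entry a J (m - int k - 1) (of_nat k + of_real t)) = b J (m - 1) t"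
    proof -
      have sw: "shift_weight (of_nat k + of_real t + of_int (m - int k - 1)) = (of_int m + of_real t) / (of_int m + 2 + of_real t)"
        by (simp add: shift_weight_def algebra_simps)
      have index: "m - int k - 1 = m - 1 - int k" by simp
      show ?thesis
        unfolding sw unfolding b_def index using ne(2)[of m] by (simp add: mult_ac add_ac)
    qed
    have 2: "(of_int m + 1 + of_real t) * (of_int m + 2 + of_real t) * (a l * bilateral_entry a J (m - int k + int l) (of_nat k + of_real t)) =
        a l * (\<rho> l t * b J (m + int l) t)" for l
    proof -
      have index: "m - int k + int l = m + int l - int k" by simp
      show ?thesis
        unfolding b_def \<rho>_def index using ne[of "m + int l"] by (simp add: mult_ac)
    qed
    show ?thesis
      unfolding b_def[of "Suc J"] bilateral_entry.simps
        distrib_left[of "(of_int m + 1 + of_real t) * (of_int m + 2 + of_real t)"] sum_distrib_left 1 2 ..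
  qed
  have summand: "((\<lambda>t. \<rho> l t * b J (m + int l) t) \<longlongrightarrow> of_int ((m + 1) * (m + 2)) * power_entry a J (m + int l - int k) k) (at_right 0)"
    if l: "1 \<le> l" for l
  proof (cases "m + int l = - 1 \<or> m + int l = - 2")
    case False
    have "m + int l + 1 \<noteq> 0" "m + int l + 2 \<noteq> 0" using False by linarith+
    then have "of_int (m + int l + 1) \<noteq> (0::complex)" "of_int (m + int l + 2) \<noteq> (0::complex)"
      by (simp_all only: of_int_eq_0_iff not_False_eq_True)
    then have ne: "of_int (m + int l) + 1 + of_real 0 \<noteq> (0::complex)" "of_int (m + int l) + 2 + of_real 0 \<noteq> (0::complex)"
      by (simp_all only: of_int_add of_int_1 of_int_numeral of_real_0 add_0_right not_False_eq_True)
    have "(\<rho> l \<longlongrightarrow> \<rho> l 0) (at_right 0)"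
      unfolding \<rho>_def[abs_def] by (intro tendsto_intros) (use ne in simp)
    moreover have "(b J (m + int l) \<longlongrightarrow> of_int ((m + int l + 1) * (m + int l + 2)) * power_entry a J (m + int l - int k) k) (at_right 0)"
      using IH[of "m + int l"] m l by (simp add: D_def)
    ultimately have "((\<lambda>t. \<rho> l t * b J (m + int l) t) \<longlongrightarrow>
        \<rho> l 0 * (of_int ((m + int l + 1) * (m + int l + 2)) * power_entry a J (m + int l - int k) k)) (at_right 0)"
      by (rule tendsto_mult)
    moreover have "\<rho> l 0 * of_int ((m + int l + 1) * (m + int l + 2)) = of_int ((m + 1) * (m + 2))"
      using ne by (simp add: \<rho>_def)
    ultimately show ?thesis
      by (simp only: mult.assoc[symmetric])
  next
    case True
    then have neg: "power_entry a J (m + int l - int k) k = 0"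
      by (intro power_entry_negative) auto
    \<comment> \<open>a pole of the ratio, compensated by the vanishing entry at m + l\<close>
    show ?thesis
    proof (cases "J = 0")
      case J: True
      have "m + int l - int k \<noteq> 0" using True by auto
      then have "b J (m + int l) t = 0" for t
        by (simp add: b_def J)
      then show ?thesis using neg by simp
    next
      case False
      then have ml: "m = - 2" "l = 1" "J = 1" using True m l by linarith+
      have "\<forall>\<^sub>F t in at_right 0. (of_real t - 1) / (of_real t + 1) = \<rho> l t"
        using ev
      proof eventually_elim
        case (elim t)
        have "\<rho> l t = ((of_real t - 1) * of_real t) / ((of_real t + 1) * of_real t)"
          unfolding \<rho>_def ml by (simp add: algebra_simps)
        then show ?case using elim by simp
      qed
      moreover have "((\<lambda>t::real. (of_real t - 1) / (of_real t + 1)) \<longlongrightarrow> (of_real 0 - 1) / (of_real 0 + 1 :: complex)) (at_right 0)"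
        by (intro tendsto_intros) simp
      ultimately have "(\<rho> l \<longlongrightarrow> (of_real 0 - 1) / (of_real 0 + 1 :: complex)) (at_right 0)"
        by (rule Lim_transform_eventually[rotated])
      moreover have "(b J (m + int l) \<longlongrightarrow> 0) (at_right 0)"
        using IH[of "m + int l"] neg ml by (simp add: D_def)
      ultimately have "((\<lambda>t. \<rho> l t * b J (m + int l) t) \<longlongrightarrow> (of_real 0 - 1) / (of_real 0 + 1 :: complex) * 0) (at_right 0)"
        by (rule tendsto_mult)
      then show ?thesis using neg by simp
    qed
  qed
  have "((\<lambda>t. b J (m - 1) t + (\<Sum>l\<in>?I. a l * (\<rho> l t * b J (m + int l) t))) \<longlongrightarrow>
      (of_int ((m - 1 + 1) * (m - 1 + 2)) * power_entry a J (m - 1 - int k) k + D J (m - 1)) +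
      (\<Sum>l\<in>?I. a l * (of_int ((m + 1) * (m + 2)) * power_entry a J (m + int l - int k) k))) (at_right 0)"
    using m by (intro tendsto_intros IH summand) auto
  moreover have "\<forall>\<^sub>F t in at_right 0. b J (m - 1) t + (\<Sum>l\<in>?I. a l * (\<rho> l t * b J (m + int l) t)) = b (Suc J) m t"
    using ev by eventually_elim (simp add: step)
  ultimately have "(b (Suc J) m \<longlongrightarrow>
      (of_int ((m - 1 + 1) * (m - 1 + 2)) * power_entry a J (m - 1 - int k) k + D J (m - 1)) +
      (\<Sum>l\<in>?I. a l * (of_int ((m + 1) * (m + 2)) * power_entry a J (m + int l - int k) k))) (at_right 0)"
    by (rule Lim_transform_eventually)
  also have "(of_int ((m - 1 + 1) * (m - 1 + 2)) * power_entry a J (m - 1 - int k) k + D J (m - 1)) +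
      (\<Sum>l\<in>?I. a l * (of_int ((m + 1) * (m + 2)) * power_entry a J (m + int l - int k) k)) =
      of_int ((m + 1) * (m + 2)) * power_entry a (Suc J) (m - int k) k + D (Suc J) m" (is "?l + ?s = _")
  proof (cases "0 \<le> m")
    case True
    have "complex_of_int (m + 2) \<noteq> 0" using True by (simp only: of_int_eq_0_iff)
    moreover have "shift_weight (of_int (int k + (m - int k) - 1)) = of_int m / of_int (m + 2)"
      by (simp add: shift_weight_def)
    ultimately have weight: "of_int ((m + 1) * (m + 2)) * shift_weight (of_int (int k + (m - int k) - 1)) = of_int (m * (m + 1))"
      unfolding of_int_mult by simp
    have "D J (m - 1) = D (Suc J) m"
      using True by (auto simp: D_def)
    moreover have "?s = of_int ((m + 1) * (m + 2)) * (\<Sum>l\<in>?I. a l * power_entry a J (m - int k + int l) k)"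
      unfolding sum_distrib_left by (intro sum.cong refl) (simp add: algebra_simps)
    moreover have "?l = of_int ((m + 1) * (m + 2)) *
        (shift_weight (of_int (int k + (m - int k) - 1)) * power_entry a J (m - int k - 1) k) + D J (m - 1)"
      unfolding mult.assoc[symmetric] weight by (simp add: diff_diff_eq add.commute mult.commute)
    ultimately show ?thesis
      using True by (simp add: distrib_left del: of_int_mult)
  next
    case False
    then have 0: "power_entry a (Suc J) (m - int k) k = 0" "power_entry a J (m - 1 - int k) k = 0"
      by (auto intro!: power_entry_negative)
    show ?thesis
    proof (cases "m = - 3")
      case True
      \<comment> \<open>the single path with a discrepancy arises here, as the step down from k to -3\<close>
      then have J: "J = 0" using m by simp
      have "?s = (\<Sum>l\<in>?I. if l = k + 3 then 2 * a (k + 3) else 0)"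
        by (intro sum.cong refl) (auto simp: True J)
      also have "\<dots> = 2 * a (k + 3)"
        using True J by simp
      finally have "?s = 2 * a (k + 3)" .
      then show ?thesis
        unfolding 0 by (simp add: D_def J True)
    next
      case ne: False
      then have m12: "m = - 1 \<or> m = - 2" using False m by linarith
      then have factor: "(m + 1) * (m + 2) = 0" by auto
      have "D J (m - 1) = D (Suc J) m"
        using m12 by (auto simp: D_def)
      then show ?thesis
        unfolding 0 factor by simp
    qed
  qed
  finally show ?case
    by (simp only: b_def[abs_def] D_def)
qed

text \<open>The factor k + 1 passes from the monomial z ^ k to the basis vector (k + 1) z ^ k.\<close>

lemma (in cubic_coanalytic_symbol) moment_power_entry:
  "of_nat (Suc k) * moment ((toeplitz g ^^ J) (disk_monomial k)) m = power_entry a J (int m - int k) k"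
proof (induction J arbitrary: m)
  case 0
  show ?case by (auto simp: moment_disk_monomial simp del: of_nat_Suc)
next
  case (Suc J)
  let ?h = "(toeplitz g ^^ J) (disk_monomial k)"
  have 1: "of_nat (Suc k) * (if m = 0 then 0 else of_nat m / of_nat (m + 2) * moment ?h (m - 1)) =
      shift_weight (of_int (int k + (int m - int k) - 1)) * power_entry a J (int m - int k - 1) k"
  proof (cases m)
    case 0
    then show ?thesis by (simp add: shift_weight_def)
  next
    case (Suc i)
    then have "shift_weight (of_int (int k + (int m - int k) - 1)) = of_nat m / of_nat (m + 2)"
      by (simp add: shift_weight_def algebra_simps)
    moreover have "power_entry a J (int m - int k - 1) k = of_nat (Suc k) * moment ?h (m - 1)"
      using Suc.IH[of "m - 1"] Suc by (simp add: algebra_simps)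
    ultimately show ?thesis using Suc by (simp del: of_nat_Suc)
  qed
  have 2: "of_nat (Suc k) * (\<Sum>l\<in>{1..k + J - m}. a l * moment ?h (m + l)) =
      (\<Sum>l\<in>{1..nat (int J - (int m - int k))}. a l * power_entry a J (int m - int k + int l) k)"
    unfolding sum_distrib_left
  proof (rule sum.cong)
    show "{1..k + J - m} = {1..nat (int J - (int m - int k))}" by auto
    fix l
    have "power_entry a J (int m - int k + int l) k = of_nat (Suc k) * moment ?h (m + l)"
      using Suc.IH[of "m + l"] by (simp add: algebra_simps)
    then show "of_nat (Suc k) * (a l * moment ?h (m + l)) = a l * power_entry a J (int m - int k + int l) k"
      by simp
  qed
  have "of_nat (Suc k) * moment ((toeplitz g ^^ Suc J) (disk_monomial k)) m =
      of_nat (Suc k) * (if m = 0 then 0 else of_nat m / of_nat (m + 2) * moment ?h (m - 1)) +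
      of_nat (Suc k) * (\<Sum>l\<in>{1..k + J - m}. a l * moment ?h (m + l))"
    by (simp only: funpow.simps o_def moment_symbol[OF symbol_funpow_poly_space] distrib_left)
  then show ?case
    unfolding 1 2 by simp
qed

section \<open>Toeplitz operators that are polynomials in the operator with symbol g\<close>

text \<open>The phase of w ^ k * cnj w ^ (k + n), which does not depend on k. One of the two exponents is zero.\<close>

definition angular_phase :: "int \<Rightarrow> complex \<Rightarrow> complex" where
  "angular_phase n w = cnj (sgn w) ^ nat n * sgn w ^ nat (- n)"

lemma angular_phase_norm_le: "cmod (angular_phase n w) \<le> 1"
  by (auto simp: angular_phase_def norm_mult norm_power norm_sgn intro!: mult_le_one power_le_one)

lemma angular_phase_measurable: "angular_phase n \<in> borel_measurable borel"
proof -
  have "(sgn :: complex \<Rightarrow> complex) = (\<lambda>w. inverse (cmod w) *\<^sub>R w)"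
    by (rule ext) (rule sgn_div_norm)
  then have sgn: "(sgn :: complex \<Rightarrow> complex) \<in> borel_measurable borel"
    by simp
  then show ?thesis
    unfolding angular_phase_def[abs_def]
    by (intro borel_measurable_times borel_measurable_power borel_measurable_cnj)
qed

lemma monomial_polar:
  assumes n: "int m - int k = n" and w: "w \<noteq> 0"
  shows "w ^ k * cnj w ^ m = angular_phase n w * exp (of_nat (k + m) * of_real (ln (cmod w)))"
proof -
  define r where "r = complex_of_real (cmod w)"
  have sw: "w = r * sgn w"
    using w by (simp add: r_def sgn_div_norm scaleR_conv_of_real)
  then have "cnj w = cnj (r * sgn w)"
    by (rule arg_cong)
  then have cw: "cnj w = r * cnj (sgn w)"
    by (simp add: r_def)
  have unit: "sgn w * cnj (sgn w) = 1"
    using w by (simp add: complex_norm_square[symmetric] norm_sgn)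
  have ex: "exp (of_nat (k + m) * of_real (ln (cmod w))) = r ^ (k + m)"
    using w by (simp add: exp_of_nat_mult exp_of_real r_def del: of_nat_add)
  have "w ^ k * cnj w ^ m = (r * sgn w) ^ k * (r * cnj (sgn w)) ^ m"
    using sw cw by simp
  also have "\<dots> = r ^ (k + m) * (sgn w ^ k * cnj (sgn w) ^ m)"
    by (simp add: power_mult_distrib power_add)
  also have "sgn w ^ k * cnj (sgn w) ^ m = angular_phase n w"
  proof (cases "0 \<le> n")
    case True
    then have m: "m = k + nat n" using n by linarith
    have "sgn w ^ k * cnj (sgn w) ^ m = (sgn w * cnj (sgn w)) ^ k * cnj (sgn w) ^ nat n"
      unfolding m by (simp add: power_add power_mult_distrib)
    then show ?thesis
      using True by (simp add: unit angular_phase_def)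
  next
    case False
    then have k: "k = m + nat (- n)" using n by linarith
    have "sgn w ^ k * cnj (sgn w) ^ m = (sgn w * cnj (sgn w)) ^ m * sgn w ^ nat (- n)"
      unfolding k by (simp add: power_add power_mult_distrib)
    then show ?thesis
      using False by (simp add: unit angular_phase_def)
  qed
  finally show ?thesis
    unfolding ex by (simp add: mult.commute)
qed

lemma AE_disk_dA_nonzero: "AE w in disk_dA. w \<noteq> 0"
  unfolding disk_dA_def using AE_completion[OF AE_lborel_singleton[of "0::complex"]]
  by (subst AE_density) (auto simp: AE_restrict_space_iff)

text \<open>In terms of the angular coefficient f_n this is twice its Mellin transform at s + 2. At s = 2 k + n its value is the
matrix element of T_f from z ^ k to z ^ (k + n), so the n-th diagonal of a Toeplitz operator extends to a holomorphic
function of k. At w = 0, where the logarithm has the value 0, the integrand stays bounded.\<close>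

definition diagonal_mellin :: "(complex \<Rightarrow> complex) \<Rightarrow> int \<Rightarrow> complex \<Rightarrow> complex" where
  "diagonal_mellin f n s = (\<integral>w. f w * angular_phase n w * exp (s * of_real (ln (cmod w))) \<partial>disk_dA)"

lemma diagonal_mellin_prems:
  assumes f: "integrable disk_dA f"
  shows "integrable disk_dA (\<lambda>w. f w * angular_phase n w)"
    and "(\<lambda>w. ln (cmod w)) \<in> borel_measurable disk_dA"
    and "\<And>w. w \<in> space disk_dA \<Longrightarrow> ln (cmod w) \<le> 0"
proof -
  show "integrable disk_dA (\<lambda>w. f w * angular_phase n w)"
  proof (rule Bochner_Integration.integrable_bound[OF f])
    show "(\<lambda>w. f w * angular_phase n w) \<in> borel_measurable disk_dA"
      by (rule borel_measurable_times[OF borel_measurable_integrable[OF f] borel_measurable_disk_dA[OF angular_phase_measurable]])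
    show "AE w in disk_dA. norm (f w * angular_phase n w) \<le> norm (f w)"
      by (intro AE_I2) (simp add: norm_mult mult_left_le angular_phase_norm_le)
  qed
  have "(\<lambda>w::complex. ln (cmod w)) \<in> borel_measurable borel"
    by (intro borel_measurable_ln borel_measurable_norm)  
  then show "(\<lambda>w. ln (cmod w)) \<in> borel_measurable disk_dA"
    by (rule borel_measurable_disk_dA)
  show "ln (cmod w) \<le> 0" if "w \<in> space disk_dA" for w
    using that by (cases "w = 0") (auto simp: ln_le_zero_iff)
qed

lemma moment_eq_diagonal_mellin:
  assumes f: "integrable disk_dA f" and T: "toeplitz_extension f T" and n: "int m - int k = n"
  shows "moment (T (disk_monomial k)) m = diagonal_mellin f n (of_nat (k + m))"
proof -
  have "moment (T (disk_monomial k)) m = (\<integral>z. f z * (z ^ k * cnj z ^ m) \<partial>disk_dA)"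
    by (rule moment_toeplitz_monomial[OF f T])
  also have "\<dots> = diagonal_mellin f n (of_nat (k + m))"
    unfolding diagonal_mellin_def
  proof (rule integral_cong_AE)
    show "(\<lambda>z. f z * (z ^ k * cnj z ^ m)) \<in> borel_measurable disk_dA"
      by (rule borel_measurable_integrable[OF integrable_times_monomials[OF f]])
    have "integrable disk_dA (\<lambda>w. (f w * angular_phase n w) * exp (of_nat (k + m) * complex_of_real (ln (cmod w))))"
      by (rule laplace_integrable[OF diagonal_mellin_prems[OF f]]) simp_all
    then show "(\<lambda>w. f w * angular_phase n w * exp (of_nat (k + m) * complex_of_real (ln (cmod w)))) \<in> borel_measurable disk_dA"
      by (rule borel_measurable_integrable)
    show "AE w in disk_dA. f w * (w ^ k * cnj w ^ m) =
        f w * angular_phase n w * exp (of_nat (k + m) * complex_of_real (ln (cmod w)))"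
      using AE_disk_dA_nonzero by eventually_elim (simp add: monomial_polar[OF n] del: of_nat_add)
  qed
  finally show ?thesis .
qed

context cubic_coanalytic_symbol
begin

lemma moment_polynomial_symbol:
  assumes rep: "\<And>k. T (disk_monomial k) = (\<lambda>z. \<Sum>j\<le>N. c j * (toeplitz g ^^ j) (disk_monomial k) z)"
  shows "of_nat (Suc k) * moment (T (disk_monomial k)) m = (\<Sum>j\<le>N. c j * power_entry a j (int m - int k) k)"
proof -
  have "moment (T (disk_monomial k)) m = (\<Sum>j\<le>N. c j * moment ((toeplitz g ^^ j) (disk_monomial k)) m)"
    unfolding rep by (rule moment_sum) (auto intro!: poly_spaceD(1)[OF symbol_funpow_poly_space])
  then show ?thesis
    by (simp only: moment_power_entry[symmetric] sum_distrib_left mult.left_commute)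
qed

text \<open>The diagonals of an operator that is both a Toeplitz operator and a polynomial in T_g. On the left is the continuation
given by the symbol, on the right the one given by the recursion. They agree at all large integers z, where
nothing is truncated; after division by z + 1 both are bounded and holomorphic on a right half-plane, so
they agree there, and by the identity theorem wherever both are holomorphic.\<close>

lemma toeplitz_polynomial_diagonal:
  assumes f: "integrable disk_dA f" and T: "toeplitz_extension f T"
    and rep: "\<And>k. T (disk_monomial k) = (\<lambda>z. \<Sum>j\<le>N. c j * (toeplitz g ^^ j) (disk_monomial k) z)"
    and z: "0 < Re (2 * z + of_int n)" "z \<notin> \<int>"
  shows "(z + 1) * diagonal_mellin f n (2 * z + of_int n) = (\<Sum>j\<le>N. c j * bilateral_entry a j n z)"
proof -
  define L where "L z = diagonal_mellin f n (2 * z + of_int n)" for z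
  define R where "R z = (\<Sum>j\<le>N. c j * bilateral_entry a j n z)" for z
  \<comment> \<open>right of K no entry is truncated and all functions below are holomorphic and bounded\<close>
  define K where "K = nat \<bar>int N - n\<bar> + nat \<bar>n\<bar>"
  have K: "int j - n \<le> int K" if "j \<le> N" for j using that by (simp add: K_def)
  have Kn: "0 \<le> int K + n" by (simp add: K_def)
  note prems = diagonal_mellin_prems(1)[OF f, of n] diagonal_mellin_prems(2,3)[OF f]
  have Lhol: "L holomorphic_on {z. 0 < Re (2 * z + of_int n)}"
  proof -
    have "(diagonal_mellin f n \<circ> (\<lambda>z. 2 * z + of_int n)) holomorphic_on {z. 0 < Re (2 * z + of_int n)}"
    proof (rule holomorphic_on_compose_gen)
      show "diagonal_mellin f n holomorphic_on {s. 0 < Re s}"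
        unfolding diagonal_mellin_def[abs_def] by (rule laplace_holomorphic[OF prems])
    qed (auto intro!: holomorphic_intros)
    then show ?thesis by (simp add: L_def[abs_def] o_def)
  qed
  have Lbound: "cmod (L z) \<le> (\<integral>w. cmod (f w * angular_phase n w) \<partial>disk_dA)" if "0 \<le> Re (2 * z + of_int n)" for z
    unfolding L_def diagonal_mellin_def by (rule laplace_norm_le[OF prems that])
  define H where "H z = L (z + of_nat K) - R (z + of_nat K) / (z + of_nat K + 1)" for z
  obtain B where B: "\<And>j z. of_int (int j - n) < Re z \<Longrightarrow> cmod (bilateral_entry a j n z) \<le> B j"
    using bilateral_entry_halfplane[of a _ n, THEN conjunct2] by metis
  have "H z = 0" if z: "0 < Re z" for z
  proof (rule bounded_halfplane_integer_zeros[OF _ _ _ z])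
    have sub: "0 < Re (2 * (z + of_nat K) + of_int n)" "of_int (int j - n) < Re (z + of_nat K)"
      if "0 < Re z" "j \<le> N" for z :: complex and j
    proof -
      have "real_of_int (int j - n) \<le> real_of_int (int K)" "real_of_int 0 \<le> real_of_int (int K + n)"
        unfolding of_int_le_iff using K[OF that(2)] Kn by simp_all
      then show "0 < Re (2 * (z + of_nat K) + of_int n)" "of_int (int j - n) < Re (z + of_nat K)"
        using that(1) by simp_all
    qed
    have ne: "z + of_nat K + 1 \<noteq> 0" if "0 < Re z" for z :: complex
      using that by (auto simp: complex_eq_iff)
    have "(L \<circ> (\<lambda>z. z + of_nat K)) holomorphic_on {z. 0 < Re z}"
      by (rule holomorphic_on_compose_gen[OF _ Lhol]) (use sub[of _ 0] in \<open>auto intro!: holomorphic_intros\<close>)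
    moreover have "(bilateral_entry a j n \<circ> (\<lambda>z. z + of_nat K)) holomorphic_on {z. 0 < Re z}" if "j \<le> N" for j
      by (rule holomorphic_on_compose_gen[OF _ bilateral_entry_halfplane[THEN conjunct1]])
        (use sub[OF _ that] in \<open>auto intro!: holomorphic_intros\<close>)
    ultimately show "H holomorphic_on {z. 0 < Re z}"
      unfolding H_def[abs_def] R_def o_def using ne by (intro holomorphic_intros) auto
    show "cmod (H z) \<le> (\<integral>w. cmod (f w * angular_phase n w) \<partial>disk_dA) + (\<Sum>j\<le>N. cmod (c j) * B j)"
      if z: "0 < Re z" for z
    proof -
      have R: "cmod (R (z + of_nat K)) \<le> (\<Sum>j\<le>N. cmod (c j) * B j)"
        unfolding R_def
        by (rule sum_norm_le) (use sub(2)[OF z] in \<open>auto simp: norm_mult intro!: mult_left_mono B\<close>)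
      have "1 \<le> Re (z + of_nat K + 1)" using z by simp
      then have "1 \<le> cmod (z + of_nat K + 1)"
        using complex_Re_le_cmod order_trans by blast
      then have "cmod (R (z + of_nat K) / (z + of_nat K + 1)) \<le> cmod (R (z + of_nat K))"
        unfolding norm_divide
        using mult_left_mono[of 1 "cmod (z + of_nat K + 1)" "cmod (R (z + of_nat K))"]
        by (intro mult_imp_div_pos_le) (linarith, simp)
      moreover have "cmod (L (z + of_nat K)) \<le> (\<integral>w. cmod (f w * angular_phase n w) \<partial>disk_dA)"
        by (rule Lbound) (use sub(1)[OF z, of 0] in simp)
      ultimately show ?thesis
        unfolding H_def using R norm_triangle_ineq4[of "L (z + of_nat K)" "R (z + of_nat K) / (z + of_nat K + 1)"]
        by linarith
    qed
    show "H (of_nat i) = 0" for i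
    proof -
      define k where "k = i + K"
      define m where "m = nat (int k + n)"
      have m: "int m - int k = n" using Kn by (simp add: m_def k_def)
      have "R (of_nat k) = (\<Sum>j\<le>N. c j * power_entry a j n k)"
        unfolding R_def by (intro sum.cong refl, subst power_entry_eq_bilateral) (use K in \<open>force simp: k_def\<close>)+
      also have "\<dots> = of_nat (Suc k) * moment (T (disk_monomial k)) m"
        by (simp only: moment_polynomial_symbol[OF rep] m)
      also have "moment (T (disk_monomial k)) m = L (of_nat k)"
      proof -
        have "int (k + m) = 2 * int k + n" using m by simp
        then have "complex_of_int (int (k + m)) = of_int (2 * int k + n)" by (simp only:)
        then show ?thesis
          unfolding L_def by (simp add: moment_eq_diagonal_mellin[OF f T m])
      qed
      finally have Rk: "R (of_nat k) = of_nat (Suc k) * L (of_nat k)" .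
      have index: "of_nat i + of_nat K = (of_nat k :: complex)" "of_nat k + 1 = (of_nat (Suc k) :: complex)"
        by (simp_all add: k_def)
      show ?thesis
        unfolding H_def index Rk by (simp del: of_nat_Suc)
    qed
  qed
  then have right: "(z + 1) * L z = R z" if "real K < Re z" for z
  proof -
    have "H (z - of_nat K) = 0" using that \<open>\<And>z. 0 < Re z \<Longrightarrow> H z = 0\<close> by simp
    moreover have "z + 1 \<noteq> 0" using that by (auto simp: complex_eq_iff)
    ultimately show ?thesis by (simp add: H_def field_simps)
  qed
  have "(z + 1) * L z = R z"
  proof (rule analytic_continuation_open[where f = "\<lambda>z. (z + 1) * L z" and g = R and s = "{z. real K < Re z} - \<int>" and s' = "{z. 0 < Re (2 * z + of_int n)} - \<int>"])
    have half: "{z. 0 < Re (2 * z + of_int n)} = {z. - real_of_int n / 2 < Re z}"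
      by (auto simp: field_simps)
    show "open ({z. real K < Re z} - \<int> :: complex set)" "open ({z. 0 < Re (2 * z + of_int n)} - \<int> :: complex set)"
      unfolding half by (intro open_Diff open_halfspace_Re_gt closed_Ints)+
    show "connected ({z. 0 < Re (2 * z + of_int n)} - \<int> :: complex set)"
      unfolding half
      by (intro connected_open_diff_countable open_halfspace_Re_gt convex_connected convex_halfspace_Re_gt countable_int) simp
    show "{z. real K < Re z} - \<int> \<subseteq> ({z. 0 < Re (2 * z + of_int n)} - \<int> :: complex set)"
    proof -
      have "real_of_int 0 \<le> real_of_int (int K + n)"
        unfolding of_int_le_iff using Kn by simp
      then show ?thesis by auto
    qed
    have "Complex (real K + 1) 1 \<in> {z. real K < Re z} - \<int>"
      by (auto simp: Ints_def complex_eq_iff)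
    then show "{z. real K < Re z} - \<int> \<noteq> ({} :: complex set)" by blast
    show "(\<lambda>z. (z + 1) * L z) holomorphic_on {z. 0 < Re (2 * z + of_int n)} - \<int>"
      by (intro holomorphic_intros holomorphic_on_subset[OF Lhol]) auto
    show "R holomorphic_on {z. 0 < Re (2 * z + of_int n)} - \<int>"
      unfolding R_def[abs_def]
      by (intro holomorphic_intros holomorphic_on_subset[OF bilateral_entry_holomorphic]) auto
  qed (use right z in auto)
  then show ?thesis by (simp add: L_def R_def)
qed

text \<open>The contradiction comes from the diagonal n = N - 1 - l at k = l - 3, that is, from the entry with m = k + n = N - 4.
By the previous lemma the symbol prescribes the limit of the untruncated entries at k, and it is the
true entry; but the limit exceeds the true entry by 2 c N * a l, the contribution of the path from l - 3 down to
-3 and up to N - 4. For N = 2 and N = 3 the position m is negative, and what is contradicted is the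
finiteness of the limit: the factor p is zero then. Since 2 k + n = l + N - 7, the assumption l \<ge> 5 puts k in the
closed half-plane where the Mellin transform exists; for l = 5 and N = 2 it is on the
boundary, so k can only be approached from the right.\<close>

lemma toeplitz_polynomial_degree_le_1:
  assumes f: "integrable disk_dA f" and T: "toeplitz_extension f T"
    and rep: "\<And>k. T (disk_monomial k) = (\<lambda>z. \<Sum>j\<le>N. c j * (toeplitz g ^^ j) (disk_monomial k) z)"
    and N: "2 \<le> N" and l: "5 \<le> l" "a l \<noteq> 0"
  shows "c N = 0"
proof -
  define n where "n = int N - 1 - int l"
  define k where "k = l - 3"
  define m where "m = int N - 4"
  define p where "p = complex_of_int ((m + 1) * (m + 2))"
  have mk: "m - int k = n" and k3: "k + 3 = l" using l by (simp_all add: m_def k_def n_def)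
  have kn: "0 \<le> 2 * int k + n" using l N by (simp add: n_def k_def)
  define t where "t i = inverse (real (Suc (Suc i)))" for i
  have t: "0 < t i" "t i < 1" for i
    by (simp_all add: t_def inverse_less_1_iff)
  have tlim: "t \<longlonglongrightarrow> 0"
    unfolding t_def[abs_def] by (rule LIMSEQ_Suc[OF LIMSEQ_inverse_real_of_nat])
  then have tright: "filterlim t (at_right 0) sequentially"
    by (rule tendsto_imp_filterlim_at_right) (use t in auto)
  define W where "W i = (of_int m + 1 + complex_of_real (t i)) * (of_int m + 2 + of_real (t i))" for i
  have Wlim: "W \<longlonglongrightarrow> p"
  proof -
    have "W \<longlonglongrightarrow> (of_int m + 1 + complex_of_real 0) * (of_int m + 2 + of_real 0)"
      unfolding W_def[abs_def] by (intro tendsto_intros tlim)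
    then show ?thesis by (simp add: p_def)
  qed
  have eq: "W i * ((of_nat k + of_real (t i) + 1) * diagonal_mellin f n (2 * (of_nat k + of_real (t i)) + of_int n)) =
      (\<Sum>j\<le>N. c j * (W i * bilateral_entry a j (m - int k) (of_nat k + of_real (t i))))" for i
  proof -
    have "of_nat k + complex_of_real (t i) \<notin> \<int>"
    proof
      assume "of_nat k + complex_of_real (t i) \<in> \<int>"
      then obtain q where "of_nat k + complex_of_real (t i) = of_int q"
        by (rule Ints_cases)
      then have "of_int (int k - q) + complex_of_real (t i) = 0" by (simp add: algebra_simps)
      then show False using of_int_add_ne_zero[OF t(1)[of i] t(2)[of i], of "int k - q"] by blast
    qed
    moreover have "0 < Re (2 * (of_nat k + complex_of_real (t i)) + of_int n)"
    proof -
      have "real_of_int 0 \<le> real_of_int (2 * int k + n)" unfolding of_int_le_iff using kn by simp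
      then show ?thesis using t(1)[of i] by simp
    qed
    ultimately have "(of_nat k + of_real (t i) + 1) * diagonal_mellin f n (2 * (of_nat k + of_real (t i)) + of_int n) =
        (\<Sum>j\<le>N. c j * bilateral_entry a j n (of_nat k + of_real (t i)))"
      by (intro toeplitz_polynomial_diagonal[OF f T rep])
    then show ?thesis
      unfolding mk by (simp only: sum_distrib_left mult.left_commute[of "W i"])
  qed
  have "(\<lambda>i. W i * ((of_nat k + of_real (t i) + 1) * diagonal_mellin f n (2 * (of_nat k + of_real (t i)) + of_int n))) \<longlonglongrightarrow>
      p * ((of_nat k + of_real 0 + 1) * diagonal_mellin f n (2 * (of_nat k + of_real 0) + of_int n))"
  proof (intro tendsto_mult Wlim)
    show "(\<lambda>i. of_nat k + complex_of_real (t i) + 1) \<longlonglongrightarrow> of_nat k + of_real 0 + 1"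
      by (intro tendsto_intros tlim)
    show "(\<lambda>i. diagonal_mellin f n (2 * (of_nat k + of_real (t i)) + of_int n)) \<longlonglongrightarrow>
        diagonal_mellin f n (2 * (of_nat k + of_real 0) + of_int n)"
      unfolding diagonal_mellin_def
    proof (rule laplace_tendsto[OF diagonal_mellin_prems[OF f]])
      have "real_of_int 0 \<le> real_of_int (2 * int k + n)" unfolding of_int_le_iff using kn by simp
      then show "0 \<le> Re (2 * (of_nat k + complex_of_real (t i)) + of_int n)" for i
        using t(1)[of i] by simp
      show "(\<lambda>i. 2 * (of_nat k + complex_of_real (t i)) + of_int n) \<longlonglongrightarrow> 2 * (of_nat k + of_real 0) + of_int n"
        by (intro tendsto_intros tlim)
    qed
  qed
  moreover have "(\<lambda>i. \<Sum>j\<le>N. c j * (W i * bilateral_entry a j (m - int k) (of_nat k + of_real (t i)))) \<longlonglongrightarrow>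
      (\<Sum>j\<le>N. c j * (p * power_entry a j (m - int k) k + (if m = int j - 4 \<and> 1 \<le> j then 2 * a (k + 3) else 0)))"
  proof (intro tendsto_sum tendsto_mult_left)
    fix j assume "j \<in> {..N}"
    then have "int j - 4 \<le> m" by (simp add: m_def)
    from filterlim_compose[OF bilateral_entry_limit[OF this, where k = k and a = a] tright]
    show "(\<lambda>i. W i * bilateral_entry a j (m - int k) (of_nat k + of_real (t i))) \<longlonglongrightarrow>
        p * power_entry a j (m - int k) k + (if m = int j - 4 \<and> 1 \<le> j then 2 * a (k + 3) else 0)"
      unfolding W_def p_def .
  qed
  ultimately have "p * ((of_nat k + of_real 0 + 1) * diagonal_mellin f n (2 * (of_nat k + of_real 0) + of_int n)) =
      (\<Sum>j\<le>N. c j * (p * power_entry a j (m - int k) k + (if m = int j - 4 \<and> 1 \<le> j then 2 * a (k + 3) else 0)))"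
    unfolding eq by (rule LIMSEQ_unique)
  also have "\<dots> = p * (\<Sum>j\<le>N. c j * power_entry a j n k) + (\<Sum>j\<le>N. if j = N then 2 * c N * a l else 0)"
    unfolding mk k3 sum_distrib_left sum.distrib[symmetric]
    by (intro sum.cong refl) (use N in \<open>auto simp: m_def algebra_simps\<close>)
  also have "(\<Sum>j\<le>N. if j = N then 2 * c N * a l else 0) = 2 * c N * a l"
    by simp
  finally have main: "p * (of_nat (Suc k) * diagonal_mellin f n (of_int (2 * int k + n))) =
      p * (\<Sum>j\<le>N. c j * power_entry a j n k) + 2 * c N * a l"
    by (simp add: add.commute)
  have "p * (of_nat (Suc k) * diagonal_mellin f n (of_int (2 * int k + n))) = p * (\<Sum>j\<le>N. c j * power_entry a j n k)"
  proof (cases "0 \<le> m")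
    case True
    define q where "q = nat m"
    have q: "int q - int k = n" using True mk by (simp add: q_def)
    have "of_nat (k + q) = complex_of_int (2 * int k + n)"
      unfolding q[symmetric] by simp
    then have "diagonal_mellin f n (of_int (2 * int k + n)) = moment (T (disk_monomial k)) q"
      by (simp only: moment_eq_diagonal_mellin[OF f T q])
    then show ?thesis
      by (simp only: moment_polynomial_symbol[OF rep] q)
  next
    case False
    then have "m = - 1 \<or> m = - 2" using N by (auto simp: m_def)
    then have "p = 0" by (auto simp: p_def)
    then show ?thesis by simp
  qed
  then have "2 * c N * a l = 0"
    unfolding main by (simp only: add_cancel_left_right)
  then show ?thesis
    using l by simp
qed

end

text \<open>Equality on the monomials is enough, because a bounded extension of a Toeplitz operator from the
polynomials is unique.\<close>

lemma toeplitz_extension_linear_combination: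
  assumes T: "toeplitz_extension f T" and S: "bergman_bounded_operator S"
    and rep: "\<And>k. T (disk_monomial k) = (\<lambda>z. c1 * S (disk_monomial k) z + c0 * disk_monomial k z)"
    and h: "h \<in> bergman_space"
  shows "T h = (\<lambda>z. c1 * S h z + c0 * h z)"
proof -
  define Y where "Y h = (\<lambda>z. c1 * S h z + c0 * h z)" for h
  have Yb: "bergman_bounded_operator Y"
    unfolding Y_def[abs_def] by (rule bounded_operator_combination[OF S bounded_operator_identity])
  have Tb: "bergman_bounded_operator T"
    using T by (simp add: toeplitz_extension_def)
  have "Y (disk_restrict (poly p)) = T (disk_restrict (poly p))" for p
  proof -
    have p: "disk_restrict (poly p) = (\<lambda>z. \<Sum>i\<le>degree p. coeff p i * disk_monomial i z)"
      by (simp add: disk_restrict_def poly_altdef fun_eq_iff)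
    show ?thesis
      unfolding p bergman_linear_sum[OF bounded_operator_linear[OF Yb] finite_atMost disk_monomial_bergman]
        bergman_linear_sum[OF bounded_operator_linear[OF Tb] finite_atMost disk_monomial_bergman]
      by (simp only: rep Y_def)
  qed
  then have "toeplitz_extension f Y"
    using T Yb by (simp add: toeplitz_extension_def)
  from toeplitz_extension_unique[OF T this h] show ?thesis
    by (simp only: Y_def)
qed

theorem theorem2:
  fixes f g :: "complex \<Rightarrow> complex" and a :: "nat \<Rightarrow> complex" and N :: int
  assumes a_convergent: "\<And>z. z \<in> ball 0 1 \<Longrightarrow> summable (\<lambda>l. a (Suc l) * cnj z ^ Suc l)"
    and a_bounded: "bounded ((\<lambda>z. \<Sum>l. a (Suc l) * cnj z ^ Suc l) ` ball 0 1)"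
    and a_nonzero: "\<exists>l\<ge>5. a l \<noteq> 0"
    and g: "\<And>r \<theta> z. 0 \<le> r \<Longrightarrow> r < 1 \<Longrightarrow> z = of_real r * cis \<theta> \<Longrightarrow>
              g z = cis \<theta> * of_real (r ^ 3) + (\<Sum>l. a (Suc l) * cnj z ^ Suc l)"
    and f_L1: "integrable disk_dA f"
    and f_nonzero: "\<not> (AE z in disk_dA. f z = 0)"
    and f_bounded: "toeplitz_bounded f"
    and N: "N \<ge> 1"
    and f_truncated: "\<And>n. n > N \<Longrightarrow> AE r in lebesgue_on {0..<1}. angular_coeff f n r = 0"
    and f_N_nonzero: "\<not> (AE r in lebesgue_on {0..<1}. angular_coeff f N r = 0)"
    and commute: "\<And>k. toeplitz f (toeplitz g (disk_restrict (\<lambda>z. z ^ k))) =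
                       toeplitz g (toeplitz f (disk_restrict (\<lambda>z. z ^ k)))"
  shows "\<exists>C1 C0. \<forall>h\<in>bergman_space. toeplitz f h = (\<lambda>z. C1 * toeplitz g h z + C0 * h z)"
proof -
  interpret cubic_coanalytic_symbol a g
  proof
    fix z :: complex assume z: "z \<in> ball 0 1"
    have polar: "z = of_real (cmod z) * cis (Arg z)"
      using rcis_cmod_Arg[of z] by (simp add: rcis_def)
    have "cis (Arg z) * of_real (cmod z ^ 3) = (of_real (cmod z) * cis (Arg z)) * of_real ((cmod z)\<^sup>2)"
      by (simp add: power3_eq_cube power2_eq_square)
    also have "\<dots> = z * (z * cnj z)"
      unfolding polar[symmetric] complex_norm_square ..
    finally have "cis (Arg z) * of_real (cmod z ^ 3) = z ^ 2 * cnj z"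
      by (simp add: power2_eq_square)
    then show "g z = z ^ 2 * cnj z + (\<Sum>l. a (Suc l) * cnj z ^ Suc l)"
      using g[OF _ _ polar] z by simp
  qed (use a_convergent a_bounded in auto)
  have T: "toeplitz_extension f (toeplitz f)"
    by (rule toeplitz_extension_toeplitz[OF f_bounded])
  then have Tlin: "bergman_linear (toeplitz f)"
    by (simp add: toeplitz_extension_def bounded_operator_linear)
  have "toeplitz f (disk_monomial 0) \<in> poly_space (nat N)"
    unfolding poly_space_def
  proof safe
    show "toeplitz f (disk_monomial 0) \<in> bergman_space"
      by (rule bergman_linear_in[OF Tlin disk_monomial_bergman])
    fix m assume "nat N < m"
    then have "AE r in lebesgue_on {0..<1}. angular_coeff f (int m - int 0) r = 0"
      by (intro f_truncated) simp
    then show "moment (toeplitz f (disk_monomial 0)) m = 0"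
      unfolding moment_toeplitz_monomial[OF f_L1 T] by (rule angular_coeff_orthogonal[OF f_L1])
  qed
  from commutant_polynomial[OF Tlin this commute] obtain c where
    c: "\<And>k. toeplitz f (disk_monomial k) = (\<lambda>z. \<Sum>j\<le>nat N. c j * (toeplitz g ^^ j) (disk_monomial k) z)"
    by blast
  obtain l where l: "5 \<le> l" "a l \<noteq> 0" using a_nonzero by blast
  have high: "c j = 0" if j: "2 \<le> j" "j \<le> nat N" for j
  proof (rule ccontr)
    assume "c j \<noteq> 0"
    \<comment> \<open>the degree of the polynomial in T_g may be smaller than N\<close>
    define I where "I = {j. 2 \<le> j \<and> j \<le> nat N \<and> c j \<noteq> 0}"
    have I: "finite I" "I \<noteq> {}" using j \<open>c j \<noteq> 0\<close> by (auto simp: I_def)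
    define M where "M = Max I"
    have M: "2 \<le> M" "M \<le> nat N" "c M \<noteq> 0" using Max_in[OF I] by (auto simp: M_def I_def)
    have above: "c i = 0" if "M < i" "i \<le> nat N" for i
    proof (rule ccontr)
      assume "c i \<noteq> 0"
      then have "i \<in> I" using that M(1) by (simp add: I_def)
      then have "i \<le> M" unfolding M_def by (rule Max_ge[OF I(1)])
      with that(1) show False by simp
    qed
    have "toeplitz f (disk_monomial k) = (\<lambda>z. \<Sum>j\<le>M. c j * (toeplitz g ^^ j) (disk_monomial k) z)" for k
      unfolding c by (intro ext sum.mono_neutral_right) (use M above in auto)
    then have "c M = 0"
      by (rule toeplitz_polynomial_degree_le_1[OF f_L1 T _ M(1) l])
    then show False using M(3) by blast
  qed
  have "toeplitz f (disk_monomial k) = (\<lambda>z. c 1 * toeplitz g (disk_monomial k) z + c 0 * disk_monomial k z)" for k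
  proof
    fix z
    have "toeplitz f (disk_monomial k) z = (\<Sum>j\<le>1. c j * (toeplitz g ^^ j) (disk_monomial k) z)"
      unfolding c by (rule sum.mono_neutral_right) (use N high in auto)
    then show "toeplitz f (disk_monomial k) z = c 1 * toeplitz g (disk_monomial k) z + c 0 * disk_monomial k z"
      by simp
  qed
  then show ?thesis
    using toeplitz_extension_linear_combination[OF T toeplitz_symbol_bounded] by blast
qed

end
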